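(* Let $R$ be a real closed field, let $G$ be a linear algebraic group over $R$ such that $G(R)$ is semialgebraically compact, and let $V$ be an affine $G$-variety. Let $f\in R[V]$ be a $G$-invariant sum of squares, i.e. $f\in R[V]^G$ and $f$ is a finite sum of squares of elements of $R[V]$. Then $f$ can be written $$f=f_1^2+\cdots+f_m^2$$ in such a way that every $f_i\in R[V]$ is semi-invariant (of some type $\omega_i$).
   Context: An affine $R$-variety $V$ is a reduced affine scheme of finite type over $R$; $R[V]$ is its coordinate ring and $V(R)$ its set of $R$-points. Standing assumption: $G(R)$ is Zariski dense in $G$. The set $G(R)$ is semialgebraically compact if it is closed and bounded in some affine space $R^N$ (this implies that $G$ is reductive). An affine $G$-variety is an affine $R$-variety $V$ with an action $G\times V\to V$ given by a morphism of $R$-varieties. Then $G(R)$ acts on $R[V]$ by $f\mapsto f^g$, $f^g(x)=f(gx)$, and $R[V]^G$ is the subring of invariants; $R[V]$ is a union of finite-dimensional $G$-submodules. For $\omega$ an isomorphism type of a finite-dimensional irreducible $G$-module (over $R$), an element $f\in R[V]$ is called semi-invariant of type $\omega$ if the $G$-submodule of $R[V]$ generated by $f$ is isomorphic to a direct sum of copies of $\omega$. *)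

theory Defs
  imports
    "HOL-Library.Poly_Mapping"
    "HOL-Library.FuncSet"
    "HOL-Algebra.Module"
    "HOL-Algebra.QuotRing"
    "HOL-Algebra.Algebraic_Closure_Type"
begin

section \<open>Real closed fields\<close>

text \<open>The type \<open>'a poly\<close> is not available inside a class specification, so a polynomial of degree
  \<open>n\<close> is written out through its coefficients, as in the library class \<open>alg_closed_field\<close>.\<close>

class real_closed_field = linordered_field +
  assumes nonneg_is_square: "0 \<le> a \<Longrightarrow> \<exists>x. x ^ 2 = a"
    and odd_degree_has_root: "odd n \<Longrightarrow> f n \<noteq> 0 \<Longrightarrow> \<exists>x. (\<Sum>k\<le>n. f k * x ^ k) = 0"


section \<open>Polynomials in finitely many variables\<close>

text \<open>\<open>('v, 'r) mpoly\<close> with \<open>'v\<close> finite is the polynomial ring over \<open>'r\<close> in variables indexed by \<open>'v\<close>;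
  the points of the corresponding affine space over \<open>'r\<close> are the functions \<open>'v \<Rightarrow> 'r\<close>.\<close>

type_synonym ('v, 'r) mpoly = "('v \<Rightarrow>\<^sub>0 nat) \<Rightarrow>\<^sub>0 'r"

definition Const :: "'r::comm_ring_1 \<Rightarrow> ('v, 'r) mpoly" where
  "Const c = Poly_Mapping.single 0 c"

definition Var :: "'v \<Rightarrow> ('v, 'r::comm_ring_1) mpoly" where
  "Var i = Poly_Mapping.single (Poly_Mapping.single i 1) 1"

text \<open>Evaluation at \<open>x\<close> in an algebra whose structure map is \<open>h\<close>.\<close>

definition aeval :: "('r::comm_ring_1 \<Rightarrow> 's::comm_ring_1) \<Rightarrow> ('v \<Rightarrow> 's) \<Rightarrow> ('v, 'r) mpoly \<Rightarrow> 's" where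
  "aeval h x p =
     (\<Sum>m\<in>Poly_Mapping.keys p. h (Poly_Mapping.lookup p m) *
        (\<Prod>i\<in>Poly_Mapping.keys m. x i ^ Poly_Mapping.lookup m i))"

definition peval :: "('v \<Rightarrow> 'r) \<Rightarrow> ('v, 'r::comm_ring_1) mpoly \<Rightarrow> 'r" where
  "peval x p = aeval (\<lambda>c. c) x p"

definition subst :: "('v \<Rightarrow> ('w, 'r) mpoly) \<Rightarrow> ('v, 'r::comm_ring_1) mpoly \<Rightarrow> ('w, 'r) mpoly" where
  "subst \<phi> p = aeval Const \<phi> p"

definition poly_ring :: "('v, 'r::comm_ring_1) mpoly ring" where
  "poly_ring = ring_of_type_algebra"


section \<open>Affine varieties and their morphisms\<close>

text \<open>An affine \<open>'r\<close>-scheme of finite type is given by an ideal of a polynomial ring.  Its coordinate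
  ring is the quotient, an algebra over \<open>ring_of_type_algebra :: 'r ring\<close>.  (The unit ideal, that is,
  the empty scheme, is allowed.)\<close>

definition coord_ring :: "('v, 'r::comm_ring_1) mpoly set \<Rightarrow> ('r, ('v, 'r) mpoly set) module" where
  "coord_ring I = ring.extend (poly_ring Quot I)
     (module.fields (\<lambda>c F. (I +>\<^bsub>poly_ring\<^esub> Const c) \<otimes>\<^bsub>poly_ring Quot I\<^esub> F))"

definition affine_variety :: "('v::finite, 'r::field) mpoly set \<Rightarrow> bool" where
  "affine_variety I \<longleftrightarrow> ideal I poly_ring \<and>
     (\<forall>F\<in>carrier (coord_ring I). \<forall>k::nat.
        F [^]\<^bsub>coord_ring I\<^esub> k = \<zero>\<^bsub>coord_ring I\<^esub> \<longrightarrow> F = \<zero>\<^bsub>coord_ring I\<^esub>)"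

definition rational_points :: "('v, 'r::comm_ring_1) mpoly set \<Rightarrow> ('v \<Rightarrow> 'r) set" where
  "rational_points I = {x. \<forall>p\<in>I. peval x p = 0}"

text \<open>The only closed subscheme of the scheme of \<open>I\<close> through which all points of \<open>S\<close> factor is the
  whole scheme.\<close>

definition zariski_dense :: "('v \<Rightarrow> 'r) set \<Rightarrow> ('v, 'r::comm_ring_1) mpoly set \<Rightarrow> bool" where
  "zariski_dense S I \<longleftrightarrow> S \<subseteq> rational_points I \<and> (\<forall>p. (\<forall>x\<in>S. peval x p = 0) \<longrightarrow> p \<in> I)"

text \<open>The coordinate ring of the fibre product over \<open>'r\<close> is the tensor product of the coordinate rings:
  the disjoint union of the variables modulo the ideal generated by both ideals.  No radical has to be
  taken, as tensor products of reduced algebras over a field of characteristic zero are reduced.\<close>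

definition scheme_prod ::
    "('v, 'r::comm_ring_1) mpoly set \<Rightarrow> ('w, 'r) mpoly set \<Rightarrow> ('v + 'w, 'r) mpoly set" where
  "scheme_prod I J = genideal poly_ring
     (subst (\<lambda>i. Var (Inl i)) ` I \<union> subst (\<lambda>j. Var (Inr j)) ` J)"

text \<open>A tuple \<open>\<phi>\<close> of polynomials defines a morphism from the scheme of \<open>I\<close> to the scheme of \<open>J\<close>.  Tuples
  that are congruent modulo \<open>I\<close> define the same morphism.\<close>

definition scheme_morphism ::
    "('v, 'r::comm_ring_1) mpoly set \<Rightarrow> ('w, 'r) mpoly set \<Rightarrow> ('w \<Rightarrow> ('v, 'r) mpoly) \<Rightarrow> bool" where
  "scheme_morphism I J \<phi> \<longleftrightarrow> (\<forall>q\<in>J. subst \<phi> q \<in> I)"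

definition same_morphism ::
    "('v, 'r::comm_ring_1) mpoly set \<Rightarrow> ('w \<Rightarrow> ('v, 'r) mpoly) \<Rightarrow> ('w \<Rightarrow> ('v, 'r) mpoly) \<Rightarrow> bool" where
  "same_morphism I \<phi> \<psi> \<longleftrightarrow> (\<forall>k. \<phi> k - \<psi> k \<in> I)"

text \<open>\<open>mcomp \<phi> \<psi>\<close> is \<open>\<phi>\<close> after \<open>\<psi>\<close>.  The morphism into a product with components \<open>\<phi>\<close> and \<open>\<psi>\<close> is
  \<open>case_sum \<phi> \<psi>\<close>.\<close>

definition mcomp ::
    "('u \<Rightarrow> ('w, 'r::comm_ring_1) mpoly) \<Rightarrow> ('w \<Rightarrow> ('v, 'r) mpoly) \<Rightarrow> 'u \<Rightarrow> ('v, 'r) mpoly" where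
  "mcomp \<phi> \<psi> = (\<lambda>k. subst \<psi> (\<phi> k))"

text \<open>The pullback \<open>R[J] \<rightarrow> R[I]\<close> of functions along a morphism.  The union is over equal cosets when
  \<open>\<phi>\<close> is a morphism.\<close>

definition pullback ::
    "('v, 'r::comm_ring_1) mpoly set \<Rightarrow> ('w \<Rightarrow> ('v, 'r) mpoly) \<Rightarrow> ('w, 'r) mpoly set \<Rightarrow>
      ('v, 'r) mpoly set" where
  "pullback I \<phi> F = (\<Union>p\<in>F. I +>\<^bsub>poly_ring\<^esub> subst \<phi> p)"


section \<open>Linear algebraic groups and their actions on affine varieties\<close>

record (overloaded) ('g, 'r) group_scheme =
  gideal :: "('g, 'r) mpoly set"
  gmult :: "'g \<Rightarrow> ('g + 'g, 'r) mpoly"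
  gunit :: "'g \<Rightarrow> 'r"
  ginv :: "'g \<Rightarrow> ('g, 'r) mpoly"

text \<open>A linear algebraic group is an affine variety with a group structure given by morphisms of
  varieties; the axioms are the usual commutative diagrams (left and right unit and inverse).\<close>

definition linear_algebraic_group :: "('g::finite, 'r::field) group_scheme \<Rightarrow> bool" where
  "linear_algebraic_group G \<longleftrightarrow>
     affine_variety (gideal G) \<and>
     scheme_morphism (scheme_prod (gideal G) (gideal G)) (gideal G) (gmult G) \<and>
     gunit G \<in> rational_points (gideal G) \<and>
     scheme_morphism (gideal G) (gideal G) (ginv G) \<and>
     same_morphism (scheme_prod (gideal G) (scheme_prod (gideal G) (gideal G)))
       (mcomp (gmult G) (case_sum (\<lambda>i. Var (Inl i)) (mcomp (gmult G) (\<lambda>i. Var (Inr i)))))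
       (mcomp (gmult G)
          (case_sum
             (mcomp (gmult G) (case_sum (\<lambda>i. Var (Inl i)) (\<lambda>i. Var (Inr (Inl i)))))
             (\<lambda>i. Var (Inr (Inr i))))) \<and>
     same_morphism (gideal G) (mcomp (gmult G) (case_sum (\<lambda>i. Const (gunit G i)) Var)) Var \<and>
     same_morphism (gideal G) (mcomp (gmult G) (case_sum Var (\<lambda>i. Const (gunit G i)))) Var \<and>
     same_morphism (gideal G) (mcomp (gmult G) (case_sum (ginv G) Var)) (\<lambda>i. Const (gunit G i)) \<and>
     same_morphism (gideal G) (mcomp (gmult G) (case_sum Var (ginv G))) (\<lambda>i. Const (gunit G i))"

abbreviation group_points :: "('g, 'r::comm_ring_1) group_scheme \<Rightarrow> ('g \<Rightarrow> 'r) set" where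
  "group_points G \<equiv> rational_points (gideal G)"

definition inv_point :: "('g, 'r::comm_ring_1) group_scheme \<Rightarrow> ('g \<Rightarrow> 'r) \<Rightarrow> 'g \<Rightarrow> 'r" where
  "inv_point G g = (\<lambda>i. peval g (ginv G i))"

text \<open>Closed and bounded in the affine space \<open>'v \<Rightarrow> 'r\<close>, for the order topology of \<open>'r\<close>.\<close>

definition semialg_compact :: "('v::finite \<Rightarrow> 'r::linordered_field) set \<Rightarrow> bool" where
  "semialg_compact S \<longleftrightarrow>
     (\<forall>x. (\<forall>\<epsilon>>0. \<exists>y\<in>S. \<forall>i. \<bar>x i - y i\<bar> < \<epsilon>) \<longrightarrow> x \<in> S) \<and>
     (\<exists>B. \<forall>x\<in>S. \<forall>i. \<bar>x i\<bar> \<le> B)"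

text \<open>An affine variety \<open>V\<close> with an action \<open>\<alpha> : G \<times> V \<rightarrow> V\<close> by a morphism of varieties.\<close>

definition affine_G_variety ::
    "('g::finite, 'r::field) group_scheme \<Rightarrow> ('n::finite, 'r) mpoly set \<Rightarrow>
      ('n \<Rightarrow> ('g + 'n, 'r) mpoly) \<Rightarrow> bool" where
  "affine_G_variety G V \<alpha> \<longleftrightarrow>
     affine_variety V \<and>
     scheme_morphism (scheme_prod (gideal G) V) V \<alpha> \<and>
     same_morphism (scheme_prod (gideal G) (scheme_prod (gideal G) V))
       (mcomp \<alpha> (case_sum (\<lambda>i. Var (Inl i)) (mcomp \<alpha> (\<lambda>i. Var (Inr i)))))
       (mcomp \<alpha>
          (case_sum
             (mcomp (gmult G) (case_sum (\<lambda>i. Var (Inl i)) (\<lambda>i. Var (Inr (Inl i)))))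
             (\<lambda>j. Var (Inr (Inr j))))) \<and>
     same_morphism V (mcomp \<alpha> (case_sum (\<lambda>i. Const (gunit G i)) Var)) Var"

text \<open>\<open>translate V \<alpha> g f\<close> is the function \<open>f\<^sup>g\<close>, that is \<open>x \<mapsto> f(gx)\<close>: the pullback of \<open>f\<close> along
  the morphism \<open>x \<mapsto> gx\<close> from \<open>V\<close> to \<open>V\<close>.\<close>

definition translate ::
    "('n, 'r::comm_ring_1) mpoly set \<Rightarrow> ('n \<Rightarrow> ('g + 'n, 'r) mpoly) \<Rightarrow> ('g \<Rightarrow> 'r) \<Rightarrow>
      ('n, 'r) mpoly set \<Rightarrow> ('n, 'r) mpoly set" where
  "translate V \<alpha> g f = pullback V (mcomp \<alpha> (case_sum (\<lambda>i. Const (g i)) Var)) f"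

definition invariant_ring ::
    "('g, 'r::comm_ring_1) group_scheme \<Rightarrow> ('n, 'r) mpoly set \<Rightarrow> ('n \<Rightarrow> ('g + 'n, 'r) mpoly) \<Rightarrow>
      ('n, 'r) mpoly set set" where
  "invariant_ring G V \<alpha> =
     {f \<in> carrier (coord_ring V). \<forall>g\<in>group_points G. translate V \<alpha> g f = f}"


section \<open>G-modules\<close>

text \<open>A \<open>G\<close>-module is a module record \<open>M\<close> over \<open>'r\<close> with a left action \<open>act\<close> of the group \<open>S\<close> of
  rational points of \<open>G\<close>.  These points are used to test stability and equivariance, which for
  rational modules is the same as for the algebraic group if the points are Zariski dense.\<close>

definition is_gsubmodule ::
    "'p set \<Rightarrow> ('r::comm_ring_1, 'm) module \<Rightarrow> ('p \<Rightarrow> 'm \<Rightarrow> 'm) \<Rightarrow> 'm set \<Rightarrow> bool" where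
  "is_gsubmodule S M act W \<longleftrightarrow>
     submodule W (ring_of_type_algebra :: 'r ring) M \<and> (\<forall>g\<in>S. \<forall>w\<in>W. act g w \<in> W)"

definition generated_gsubmodule ::
    "'p set \<Rightarrow> ('r::comm_ring_1, 'm) module \<Rightarrow> ('p \<Rightarrow> 'm \<Rightarrow> 'm) \<Rightarrow> 'm \<Rightarrow> 'm set" where
  "generated_gsubmodule S M act x = \<Inter>{W. is_gsubmodule S M act W \<and> x \<in> W}"

definition irreducible_gmodule ::
    "'p set \<Rightarrow> ('r::comm_ring_1, 'm) module \<Rightarrow> ('p \<Rightarrow> 'm \<Rightarrow> 'm) \<Rightarrow> bool" where
  "irreducible_gmodule S M act \<longleftrightarrow>
     carrier M \<noteq> {\<zero>\<^bsub>M\<^esub>} \<and>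
     (\<forall>W. is_gsubmodule S M act W \<longrightarrow> W = {\<zero>\<^bsub>M\<^esub>} \<or> W = carrier M)"

definition isomorphic_gmodules ::
    "'p set \<Rightarrow> ('r, 'm) module \<Rightarrow> ('p \<Rightarrow> 'm \<Rightarrow> 'm) \<Rightarrow> ('r, 'k) module \<Rightarrow> ('p \<Rightarrow> 'k \<Rightarrow> 'k) \<Rightarrow> bool"
  where
  "isomorphic_gmodules S M act N act' \<longleftrightarrow>
     (\<exists>T. bij_betw T (carrier M) (carrier N) \<and>
        (\<forall>x\<in>carrier M. \<forall>y\<in>carrier M. T (x \<oplus>\<^bsub>M\<^esub> y) = T x \<oplus>\<^bsub>N\<^esub> T y) \<and>
        (\<forall>c. \<forall>x\<in>carrier M. T (c \<odot>\<^bsub>M\<^esub> x) = c \<odot>\<^bsub>N\<^esub> T x) \<and>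
        (\<forall>g\<in>S. \<forall>x\<in>carrier M. T (act g x) = act' g (T x)))"

text \<open>The direct sum of \<open>k\<close> copies of \<open>M\<close>, with the componentwise action.\<close>

definition module_power :: "('r, 'm) module \<Rightarrow> nat \<Rightarrow> ('r, nat \<Rightarrow> 'm) module" where
  "module_power M k =
     \<lparr>carrier = {..<k} \<rightarrow>\<^sub>E carrier M,
      monoid.mult = (\<lambda>u v. \<lambda>j\<in>{..<k}. u j \<otimes>\<^bsub>M\<^esub> v j),
      monoid.one = (\<lambda>j\<in>{..<k}. \<one>\<^bsub>M\<^esub>),
      ring.zero = (\<lambda>j\<in>{..<k}. \<zero>\<^bsub>M\<^esub>),
      ring.add = (\<lambda>u v. \<lambda>j\<in>{..<k}. u j \<oplus>\<^bsub>M\<^esub> v j),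
      module.smult = (\<lambda>c u. \<lambda>j\<in>{..<k}. c \<odot>\<^bsub>M\<^esub> u j)\<rparr>"

definition act_power :: "nat \<Rightarrow> ('p \<Rightarrow> 'm \<Rightarrow> 'm) \<Rightarrow> 'p \<Rightarrow> (nat \<Rightarrow> 'm) \<Rightarrow> nat \<Rightarrow> 'm" where
  "act_power k act g u = (\<lambda>j\<in>{..<k}. act g (u j))"

text \<open>Up to isomorphism, a \<open>d\<close>-dimensional \<open>G\<close>-module is \<open>'r\<^sup>d\<close> with \<open>G\<close> acting through a homomorphism
  of algebraic groups from \<open>G\<close> to \<open>GL\<^sub>d\<close>, given by a \<open>d \<times> d\<close> matrix \<open>\<rho>\<close> of functions on \<open>G\<close>.  The
  matrix is invertible because \<open>\<rho>(g) \<rho>(g\<^sup>-\<^sup>1) = \<rho>(1) = 1\<close>.\<close>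

definition matrix_representation ::
    "('g, 'r::comm_ring_1) group_scheme \<Rightarrow> nat \<Rightarrow> (nat \<Rightarrow> nat \<Rightarrow> ('g, 'r) mpoly) \<Rightarrow> bool" where
  "matrix_representation G d \<rho> \<longleftrightarrow>
     (\<forall>i<d. \<forall>j<d. peval (gunit G) (\<rho> i j) = (if i = j then 1 else 0)) \<and>
     (\<forall>i<d. \<forall>j<d.
        subst (gmult G) (\<rho> i j)
          - (\<Sum>l<d. subst (\<lambda>k. Var (Inl k)) (\<rho> i l) * subst (\<lambda>k. Var (Inr k)) (\<rho> l j))
        \<in> scheme_prod (gideal G) (gideal G))"

definition scalar_module :: "('r::comm_ring_1, 'r) module" where
  "scalar_module = ring.extend ring_of_type_algebra (module.fields (\<lambda>c x. c * x))"

abbreviation std_module :: "nat \<Rightarrow> ('r::comm_ring_1, nat \<Rightarrow> 'r) module" where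
  "std_module d \<equiv> module_power scalar_module d"

definition matrix_act ::
    "nat \<Rightarrow> (nat \<Rightarrow> nat \<Rightarrow> ('g, 'r::comm_ring_1) mpoly) \<Rightarrow> ('g \<Rightarrow> 'r) \<Rightarrow> (nat \<Rightarrow> 'r) \<Rightarrow> nat \<Rightarrow> 'r" where
  "matrix_act d \<rho> g v = (\<lambda>i\<in>{..<d}. \<Sum>j<d. peval g (\<rho> i j) * v j)"

definition irreducible_representation ::
    "('g, 'r::comm_ring_1) group_scheme \<Rightarrow> nat \<Rightarrow> (nat \<Rightarrow> nat \<Rightarrow> ('g, 'r) mpoly) \<Rightarrow> bool" where
  "irreducible_representation G d \<rho> \<longleftrightarrow>
     matrix_representation G d \<rho> \<and>
     irreducible_gmodule (group_points G) (std_module d) (matrix_act d \<rho>)"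


section \<open>Semi-invariants\<close>

text \<open>Since \<open>f \<mapsto> f\<^sup>g\<close> is a right action, the left module structure on \<open>R[V]\<close> is by translation with
  the inverse.\<close>

definition coord_act ::
    "('g, 'r::comm_ring_1) group_scheme \<Rightarrow> ('n, 'r) mpoly set \<Rightarrow> ('n \<Rightarrow> ('g + 'n, 'r) mpoly) \<Rightarrow>
      ('g \<Rightarrow> 'r) \<Rightarrow> ('n, 'r) mpoly set \<Rightarrow> ('n, 'r) mpoly set" where
  "coord_act G V \<alpha> g f = translate V \<alpha> (inv_point G g) f"

text \<open>\<open>f\<close> is semi-invariant of the type of the representation \<open>\<rho>\<close> on \<open>'r\<^sup>d\<close>.  The number \<open>k\<close> of
  copies is automatically finite, as the module generated by \<open>f\<close> has finite dimension; \<open>k = 0\<close>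
  occurs exactly for \<open>f = 0\<close>.\<close>

definition semi_invariant_of_type ::
    "('g, 'r::comm_ring_1) group_scheme \<Rightarrow> ('n, 'r) mpoly set \<Rightarrow> ('n \<Rightarrow> ('g + 'n, 'r) mpoly) \<Rightarrow>
      nat \<Rightarrow> (nat \<Rightarrow> nat \<Rightarrow> ('g, 'r) mpoly) \<Rightarrow> ('n, 'r) mpoly set \<Rightarrow> bool" where
  "semi_invariant_of_type G V \<alpha> d \<rho> f \<longleftrightarrow>
     f \<in> carrier (coord_ring V) \<and>
     (\<exists>k. isomorphic_gmodules (group_points G)
        (coord_ring V
           \<lparr>carrier := generated_gsubmodule (group_points G) (coord_ring V) (coord_act G V \<alpha>) f\<rparr>)
        (coord_act G V \<alpha>)
        (module_power (std_module d) k)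
        (act_power k (matrix_act d \<rho>)))"

definition semi_invariant ::
    "('g, 'r::comm_ring_1) group_scheme \<Rightarrow> ('n, 'r) mpoly set \<Rightarrow> ('n \<Rightarrow> ('g + 'n, 'r) mpoly) \<Rightarrow>
      ('n, 'r) mpoly set \<Rightarrow> bool" where
  "semi_invariant G V \<alpha> f \<longleftrightarrow>
     (\<exists>d \<rho>. irreducible_representation G d \<rho> \<and> semi_invariant_of_type G V \<alpha> d \<rho> f)"

end

theory Submission
  imports Defs "HOL-Computational_Algebra.Polynomial_FPS"
begin

text \<open>The polynomials \<open>p\<^sub>1, \<dots>, p\<^sub>m\<close> with \<open>f = \<Sum> p\<^sub>i\<^sup>2\<close> lie in a finite-dimensional stable subspace \<open>W\<close>,
  so \<open>f\<close> is the image under multiplication of a positive semidefinite symmetric tensor in \<open>W \<otimes> W\<close>.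
  These tensors form a closed convex set on which \<open>G(R)\<close> acts.  Averaging over \<open>G(R)\<close> is not available
  over a real closed field; instead, a tensor that minimises the largest norm in its orbit exists by
  quantifier elimination, and by convexity it is a fixed point.  An invariant positive semidefinite
  tensor is an invariant inner product on its image \<open>U \<subseteq> W\<close>, and \<open>f\<close> is the sum of the squares of
  any orthonormal basis of \<open>U\<close>.  A basis adapted to a decomposition of \<open>U\<close> into orthogonal irreducible
  submodules consists of semi-invariants.\<close>

section \<open>Real closed fields\<close>

subsection \<open>Newton's identities\<close>

text \<open>A real closed field need not be complete, and bounded closed sets in it need not be
  compact, so limits are replaced by infima of definable subsets of the line, which are finite
  unions of points and intervals. The axioms provide only square roots and roots in odd degree; this
  is why intermediate values have to be derived from the algebra of R(i). Definability is semantic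
  (truth depends only on the signs of finitely many polynomials), which avoids a syntax of formulas.
  \<open>G(R)\<close> is definable because its ideal is finitely generated, and its boundedness
  bounds the matrix coefficients and hence the norms along an orbit.

  Tensors are used instead of tuples of polynomials because only there the representations of one
  \<open>f\<close> as a sum of squares form a convex set; invariance of \<open>f\<close> makes this
  set stable. An element of the adapted basis is nonzero, so it generates the irreducible submodule
  in which it lies, and a single copy of the type occurs. Zariski density turns matrix identities at
  rational points into identities in the coordinate ring of the product, as a representation of
  \<open>G\<close> requires.\<close>

definition psum :: "'a::comm_ring_1 list \<Rightarrow> nat \<Rightarrow> 'a" where
  "psum as k = (\<Sum>a\<leftarrow>as. a ^ k)"

text \<open>Reversing \<Prod>(X - a) gives constant coefficient 1, so that Newton's identities
  become a statement about the logarithmic derivative of a power series.\<close>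

definition newton_fps :: "'a::comm_ring_1 list \<Rightarrow> 'a fps" where
  "newton_fps as = (\<Prod>a\<leftarrow>as. 1 - fps_const a * fps_X)"

lemma fps_geometric_mult:
  fixes c :: "'a::comm_ring_1"
  shows "(1 - fps_const c * fps_X) * Abs_fps (\<lambda>k. c ^ Suc k) = fps_const c"
proof (rule fps_ext)
  fix n
  have "(1 - fps_const c * fps_X) * Abs_fps (\<lambda>k. c ^ Suc k)
      = Abs_fps (\<lambda>k. c ^ Suc k) - fps_const c * (fps_X * Abs_fps (\<lambda>k. c ^ Suc k))"
    by (simp add: algebra_simps)
  then show "fps_nth ((1 - fps_const c * fps_X) * Abs_fps (\<lambda>k. c ^ Suc k)) n = fps_nth (fps_const c) n"
    by (cases n) (simp_all add: fps_mult_left_const_nth)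
qed

text \<open>The factor 1 - aX contributes -a / (1 - aX) to the logarithmic derivative, which is
  minus the geometric series with coefficients \<open>a ^ Suc k\<close>;
  \<open>fps_geometric_mult\<close> expresses this without division.\<close>

lemma fps_deriv_newton_fps:
  "fps_deriv (newton_fps as) = - (newton_fps as * Abs_fps (\<lambda>k. psum as (Suc k)))"
proof (induction as)
  case Nil
  then show ?case by (simp add: newton_fps_def psum_def fps_eq_iff fps_mult_nth)
next
  case (Cons c as)
  let ?P = "newton_fps as" and ?G = "Abs_fps (\<lambda>k. psum as (Suc k))" and ?H = "Abs_fps (\<lambda>k. c ^ Suc k)"
  let ?l = "1 - fps_const c * fps_X"
  have P: "newton_fps (c # as) = ?l * ?P" by (simp add: newton_fps_def)
  have G: "Abs_fps (\<lambda>k. psum (c # as) (Suc k)) = ?H + ?G"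
    by (simp add: fps_eq_iff psum_def)
  have "fps_deriv (newton_fps (c # as)) = ?l * (- (?P * ?G)) - fps_const c * ?P"
    unfolding P by (simp add: Cons.IH flip: fps_const_neg)
  also have "\<dots> = ?l * (- (?P * ?G)) - (?l * ?H) * ?P"
    by (simp only: fps_geometric_mult)
  also have "\<dots> = - ((?l * ?P) * (?H + ?G))"
    by (simp add: algebra_simps)
  finally show ?case by (simp only: P G)
qed

section \<open>Subfields, coefficients and power sums\<close>

definition is_subfield :: "'a::field set \<Rightarrow> bool" where
  "is_subfield F \<longleftrightarrow> 0 \<in> F \<and> 1 \<in> F \<and>
     (\<forall>x\<in>F. \<forall>y\<in>F. x + y \<in> F \<and> x - y \<in> F \<and> x * y \<in> F \<and> x / y \<in> F)"

lemma is_subfieldD: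
  assumes "is_subfield F"
  shows "0 \<in> F" "1 \<in> F" "x \<in> F \<Longrightarrow> y \<in> F \<Longrightarrow> x + y \<in> F" "x \<in> F \<Longrightarrow> y \<in> F \<Longrightarrow> x - y \<in> F"
    "x \<in> F \<Longrightarrow> y \<in> F \<Longrightarrow> x * y \<in> F" "x \<in> F \<Longrightarrow> y \<in> F \<Longrightarrow> x / y \<in> F" "x \<in> F \<Longrightarrow> - x \<in> F"
proof -
  show "x \<in> F \<Longrightarrow> - x \<in> F" using assms unfolding is_subfield_def by (metis diff_0)
qed (use assms in \<open>simp_all add: is_subfield_def\<close>)

lemma is_subfield_sum: "is_subfield F \<Longrightarrow> (\<And>i. i \<in> A \<Longrightarrow> f i \<in> F) \<Longrightarrow> sum f A \<in> F"
  by (induction A rule: infinite_finite_induct) (auto intro: is_subfieldD)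

lemma is_subfield_of_nat: "is_subfield F \<Longrightarrow> of_nat n \<in> F"
  by (induction n) (auto intro: is_subfieldD)

lemma is_subfield_power: "is_subfield F \<Longrightarrow> x \<in> F \<Longrightarrow> x ^ n \<in> F"
  by (induction n) (auto intro: is_subfieldD)

lemma newton_identity:
  "of_nat (Suc n) * fps_nth (newton_fps as) (Suc n)
    = - (\<Sum>i\<le>n. fps_nth (newton_fps as) i * psum as (Suc (n - i)))"
proof -
  have "fps_nth (fps_deriv (newton_fps as)) n
      = fps_nth (- (newton_fps as * Abs_fps (\<lambda>k. psum as (Suc k)))) n"
    by (simp only: fps_deriv_newton_fps)
  then show ?thesis by (simp add: fps_mult_nth atLeast0AtMost)
qed

lemma newton_fps_nth_0: "fps_nth (newton_fps as) 0 = 1"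
  by (induction as) (simp_all add: newton_fps_def)

text \<open>Newton's identity expresses \<open>Suc m\<close> times the next coefficient through the
  earlier ones; characteristic zero permits the division by \<open>Suc m\<close>.\<close>

lemma newton_coeffs_in_subfield:
  fixes as :: "'a::field_char_0 list"
  assumes F: "is_subfield F" and ps: "\<And>k. psum as (Suc k) \<in> F"
  shows "fps_nth (newton_fps as) n \<in> F"
proof (induction n rule: less_induct)
  case (less n)
  show ?case
  proof (cases n)
    case 0
    then show ?thesis using F by (simp add: newton_fps_nth_0 is_subfieldD)
  next
    case (Suc m)
    have "of_nat (Suc m) * fps_nth (newton_fps as) n \<in> F"
      unfolding Suc newton_identity
      by (intro is_subfieldD(7) is_subfield_sum is_subfieldD(5) F ps less.IH) (simp add: Suc)
    then have "of_nat (Suc m) * fps_nth (newton_fps as) n / of_nat (Suc m) \<in> F"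
      by (intro is_subfieldD(6) F is_subfield_of_nat)
    then show ?thesis by (simp del: of_nat_Suc)
  qed
qed

lemma newton_psums_in_subfield:
  fixes as :: "'a::field_char_0 list"
  assumes F: "is_subfield F" and co: "\<And>n. fps_nth (newton_fps as) n \<in> F"
  shows "psum as (Suc k) \<in> F"
proof (induction k rule: less_induct)
  case (less k)
  have "of_nat (Suc k) * fps_nth (newton_fps as) (Suc k)
      = - (psum as (Suc k) + (\<Sum>i\<in>{1..k}. fps_nth (newton_fps as) i * psum as (Suc (k - i))))"
    by (simp only: newton_identity) (simp add: atMost_atLeast0 sum.atLeast_Suc_atMost newton_fps_nth_0)
  then have "psum as (Suc k) = - (of_nat (Suc k) * fps_nth (newton_fps as) (Suc k))
      - (\<Sum>i\<in>{1..k}. fps_nth (newton_fps as) i * psum as (Suc (k - i)))"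
    by (simp del: of_nat_Suc)
  also have "\<dots> \<in> F"
    by (intro is_subfieldD(4,5,7) is_subfield_sum F is_subfield_of_nat co less.IH) auto
  finally show ?case .
qed

lemma fps_of_reflect_linear_factors:
  fixes as :: "'a::field list"
  shows "fps_of_poly (reflect_poly (\<Prod>a\<leftarrow>as. [:-a, 1:])) = newton_fps as"
proof (induction as)
  case Nil
  then show ?case by (simp add: newton_fps_def)
next
  case (Cons c as)
  have "fps_of_poly (reflect_poly [:-c, 1:]) = 1 - fps_const c * fps_X"
    by (cases "c = 0")
      (auto simp: reflect_poly_def fps_of_poly_pCons cCons_def fps_of_poly_const simp flip: fps_const_neg)
  then show ?case
    by (simp only: list.map prod_list.Cons reflect_poly_mult fps_of_poly_mult Cons.IH newton_fps_def)
qed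

lemma degree_linear_factors: "degree (\<Prod>a\<leftarrow>as. [:-a::'a::field, 1:]) = length as"
proof (induction as)
  case (Cons a as)
  have "(\<Prod>a\<leftarrow>as. [:-a, 1:]) \<noteq> (0::'a poly)" by (auto simp: prod_list_zero_iff)
  then show ?case using Cons.IH
    by (simp only: list.map prod_list.Cons, subst degree_mult_eq) auto
qed simp

lemma poly_linear_factors_eq_0_iff:
  "poly (\<Prod>a\<leftarrow>as. [:-a::'a::field, 1:]) z = 0 \<longleftrightarrow> z \<in> set as"
  by (induction as) (auto simp: algebra_simps)

text \<open>Takes the place of the fundamental theorem on symmetric polynomials: the power sums of a
  transformed list of roots are easy to compute, its coefficients are not.\<close>

lemma coeffs_in_subfield_iff_psums:
  fixes as :: "'a::field_char_0 list"
  assumes F: "is_subfield F"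
  shows "(\<forall>i. coeff (\<Prod>a\<leftarrow>as. [:-a, 1:]) i \<in> F) \<longleftrightarrow> (\<forall>k. psum as (Suc k) \<in> F)"
proof -
  let ?p = "\<Prod>a\<leftarrow>as. [:-a, 1:]"
  have nth: "fps_nth (newton_fps as) n = (if n > degree ?p then 0 else coeff ?p (degree ?p - n))" for n
    by (metis fps_of_reflect_linear_factors fps_of_poly_nth coeff_reflect_poly)
  have "(\<forall>i. coeff ?p i \<in> F) \<longleftrightarrow> (\<forall>n. fps_nth (newton_fps as) n \<in> F)"
  proof
    assume "\<forall>n. fps_nth (newton_fps as) n \<in> F"
    show "\<forall>i. coeff ?p i \<in> F"
    proof
      fix i
      show "coeff ?p i \<in> F"
      proof (cases "i \<le> degree ?p")
        case True
        then show ?thesis using nth[of "degree ?p - i"] \<open>\<forall>n. _\<close>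
          by (metis diff_diff_cancel diff_le_self leD)
      next
        case False
        then show ?thesis using F by (simp add: coeff_eq_0 is_subfieldD)
      qed
    qed
  qed (use F in \<open>auto simp: nth is_subfieldD\<close>)
  then show ?thesis
    using newton_coeffs_in_subfield[OF F] newton_psums_in_subfield[OF F] by blast
qed

section \<open>Sums over pairs of roots\<close>

fun pairs :: "'a list \<Rightarrow> ('a \<times> 'a) list" where
  "pairs [] = []"
| "pairs (a # as) = map (\<lambda>b. (a, b)) as @ pairs as"

lemma length_pairs: "2 * length (pairs as) = length as * (length as - 1)"
proof -
  have "2 * length (pairs as) + length as = length as * length as"
    by (induction as) (auto simp: algebra_simps)
  then show ?thesis by (simp add: diff_mult_distrib2)
qed

lemma set_pairs: "(a, b) \<in> set (pairs as) \<Longrightarrow> a \<in> set as \<and> b \<in> set as"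
  by (induction as) auto

lemma sum_list_pairs:
  fixes f :: "'a \<Rightarrow> 'b::comm_ring_1"
  shows "2 * (\<Sum>(a, b)\<leftarrow>pairs as. f a * f b) = (\<Sum>a\<leftarrow>as. f a)^2 - (\<Sum>a\<leftarrow>as. (f a)^2)"
proof (induction as)
  case (Cons c as)
  have "(\<Sum>(a, b)\<leftarrow>map (\<lambda>b. (c, b)) as. f a * f b) = f c * (\<Sum>a\<leftarrow>as. f a)"
    by (simp add: o_def sum_list_const_mult)
  then show ?case using Cons.IH by (simp add: algebra_simps power2_eq_square)
qed simp

lemma psum_shift:
  "(\<Sum>a\<leftarrow>as. (t + a) ^ m) = (\<Sum>k\<le>m. of_nat (m choose k) * t ^ k * psum as (m - k))"
proof (induction as)
  case (Cons a as)
  have "(t + a) ^ m = (\<Sum>k\<le>m. of_nat (m choose k) * t ^ k * a ^ (m - k))"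
    by (rule binomial_ring)
  then show ?case using Cons.IH by (simp add: psum_def sum.distrib algebra_simps)
qed (simp add: psum_def)

text \<open>Twice the k-th power sum over the pairs is (\<Sum>(t + a)^k)^2 - \<Sum>(t + a)^(2k), and
  both parts are polynomials in t and the power sums of \<open>as\<close>.\<close>

lemma pair_products_coeffs:
  fixes as :: "'a::field_char_0 list"
  assumes F: "is_subfield F" and co: "\<And>i. coeff (\<Prod>a\<leftarrow>as. [:-a, 1:]) i \<in> F" and t: "t \<in> F"
  shows "coeff (\<Prod>c\<leftarrow>map (\<lambda>(a, b). (t + a) * (t + b)) (pairs as). [:-c, 1:]) i \<in> F"
proof -
  \<comment> \<open>Index 0 is the length of the list; the criterion covers only indices from 1
    on.\<close>
  have ps: "psum as k \<in> F" for k
    using coeffs_in_subfield_iff_psums[OF F, of as] co is_subfield_of_nat[OF F, of "length as"]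
    by (cases k) (auto simp: psum_def sum_list_triv)
  have sh: "(\<Sum>a\<leftarrow>as. (t + a) ^ m) \<in> F" for m
    unfolding psum_shift
    by (intro is_subfield_sum is_subfieldD(5) F is_subfield_of_nat is_subfield_power t ps)
  have "psum (map (\<lambda>(a, b). (t + a) * (t + b)) (pairs as)) k \<in> F" for k
  proof -
    have "psum (map (\<lambda>(a, b). (t + a) * (t + b)) (pairs as)) k
        = (\<Sum>(a, b)\<leftarrow>pairs as. (t + a) ^ k * (t + b) ^ k)"
      by (simp add: psum_def o_def case_prod_unfold power_mult_distrib)
    then have "2 * psum (map (\<lambda>(a, b). (t + a) * (t + b)) (pairs as)) k
        = (\<Sum>a\<leftarrow>as. (t + a) ^ k)^2 - (\<Sum>a\<leftarrow>as. (t + a) ^ (k * 2))"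
      using sum_list_pairs[of "\<lambda>a. (t + a) ^ k" as] by (simp add: power_mult)
    also have "\<dots> \<in> F" by (intro is_subfieldD(4) is_subfield_power F sh)
    finally have "2 * psum (map (\<lambda>(a, b). (t + a) * (t + b)) (pairs as)) k / of_nat 2 \<in> F"
      by (intro is_subfieldD(6) F is_subfield_of_nat)
    then show ?thesis by simp
  qed
  then show ?thesis using coeffs_in_subfield_iff_psums[OF F] by blast
qed

subsection \<open>Roots over the quadratic extension\<close>

lemma rcf_sqrt:
  fixes a :: "'r::real_closed_field"
  assumes "0 \<le> a"
  obtains x where "0 \<le> x" "x ^ 2 = a"
  using nonneg_is_square[OF assms] by (metis abs_ge_zero power2_abs)

definition ac_i :: "'r::real_closed_field alg_closure" where
  "ac_i = (SOME i. i ^ 2 = -1)"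

lemma ac_i_sq: "(ac_i :: 'r::real_closed_field alg_closure) * ac_i = -1"
proof -
  have "\<exists>i :: 'r alg_closure. i ^ 2 = -1"
    by (rule nth_root_exists) simp
  then show ?thesis unfolding ac_i_def power2_eq_square by (rule someI_ex)
qed

definition ac_cplx :: "'r::real_closed_field \<Rightarrow> 'r \<Rightarrow> 'r alg_closure" where
  "ac_cplx a b = to_ac a + ac_i * to_ac b"

lemma ac_cplx_arith:
  "ac_cplx a b + ac_cplx c d = ac_cplx (a + c) (b + d)"
  "ac_cplx a b - ac_cplx c d = ac_cplx (a - c) (b - d)"
  "ac_cplx a b * ac_cplx c d = ac_cplx (a * c - b * d) (a * d + b * c)"
proof -
  have "ac_cplx a b * ac_cplx c d = to_ac (a * c) + (ac_i * ac_i) * to_ac (b * d)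
      + ac_i * to_ac (a * d + b * c)"
    by (simp add: ac_cplx_def algebra_simps)
  then show "ac_cplx a b * ac_cplx c d = ac_cplx (a * c - b * d) (a * d + b * c)"
    by (simp add: ac_i_sq ac_cplx_def)
qed (simp_all add: ac_cplx_def algebra_simps)

text \<open>The product with the conjugate is a^2 + b^2, which vanishes in an ordered field only if
  both a and b do.\<close>

lemma ac_cplx_eq_0_iff: "ac_cplx a b = 0 \<longleftrightarrow> a = 0 \<and> b = 0"
proof
  assume "ac_cplx a b = 0"
  then have "ac_cplx a b * ac_cplx a (- b) = 0" by simp
  then have "ac_cplx (a * a + b * b) 0 = 0" by (simp only: ac_cplx_arith) (simp add: algebra_simps)
  then have "to_ac (a * a + b * b) = 0" by (simp add: ac_cplx_def)
  then show "a = 0 \<and> b = 0" by (simp only: to_ac_eq_0_iff)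
      (metis add_nonneg_eq_0_iff mult_eq_0_iff zero_le_square)
qed (simp add: ac_cplx_def)

definition ac_cplxs :: "'r::real_closed_field alg_closure set" where
  "ac_cplxs = {ac_cplx a b | a b. True}"

lemma to_ac_in_cplxs: "to_ac a \<in> ac_cplxs"
  unfolding ac_cplxs_def ac_cplx_def by (rule CollectI) (rule exI[of _ a], rule exI[of _ 0], simp)

lemma is_subfield_cplxs: "is_subfield (ac_cplxs :: 'r::real_closed_field alg_closure set)"
  unfolding is_subfield_def
proof (intro conjI ballI)
  show "(0 :: 'r alg_closure) \<in> ac_cplxs" "(1 :: 'r alg_closure) \<in> ac_cplxs"
    using to_ac_in_cplxs[of 0] to_ac_in_cplxs[of 1] by simp_all
  fix x y :: "'r alg_closure" assume "x \<in> ac_cplxs" "y \<in> ac_cplxs"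
  then obtain a b c d where [simp]: "x = ac_cplx a b" "y = ac_cplx c d" by (auto simp: ac_cplxs_def)
  show "x + y \<in> ac_cplxs" "x - y \<in> ac_cplxs" "x * y \<in> ac_cplxs"
    by (auto simp: ac_cplx_arith ac_cplxs_def)
  show "x / y \<in> ac_cplxs"
  proof (cases "c = 0 \<and> d = 0")
    case True
    then show ?thesis using to_ac_in_cplxs[of 0] by (simp add: ac_cplx_def)
  next
    case False
    define n where "n = c * c + d * d"
    have n0: "n \<noteq> 0" using False unfolding n_def by (metis add_nonneg_eq_0_iff mult_eq_0_iff zero_le_square)
    have "y * ac_cplx (c / n) (- d / n) = ac_cplx 1 0"
    proof -
      have "c * (c / n) - d * (- d / n) = 1" "c * (- d / n) + d * (c / n) = 0"
        using n0 by (simp_all add: n_def flip: add_divide_distrib)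
      then show ?thesis by (simp add: ac_cplx_arith)
    qed
    then have "y * ac_cplx (c / n) (- d / n) = 1" by (simp add: ac_cplx_def)
    moreover have "y \<noteq> 0" using False by (simp add: ac_cplx_eq_0_iff)
    ultimately have "x / y = x * ac_cplx (c / n) (- d / n)"
      by (metis divide_inverse inverse_unique)
    then show ?thesis by (auto simp: ac_cplx_arith ac_cplxs_def)
  qed
qed

text \<open>The half-angle formula: with r the absolute value of z = a + ib, a root has real part
  sqrt((r + a)/2) and imaginary part sqrt((r - a)/2) up to sign. Both radicands are nonnegative
  because \<bar>a\<bar> \<le> r.\<close>

lemma cplxs_sqrt:
  assumes "z \<in> ac_cplxs"
  shows "\<exists>w\<in>ac_cplxs. w ^ 2 = z"
proof -
  obtain a b where z: "z = ac_cplx a b" using assms by (auto simp: ac_cplxs_def)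
  obtain r where r: "0 \<le> r" "r ^ 2 = a ^ 2 + b ^ 2" by (rule rcf_sqrt[of "a ^ 2 + b ^ 2"]) simp
  have "\<bar>a\<bar> \<le> r" by (rule power2_le_imp_le) (use r in auto)
  then have "0 \<le> (r + a) / 2" "0 \<le> (r - a) / 2" by auto
  then obtain u v where uv: "0 \<le> u" "u ^ 2 = (r + a) / 2" "0 \<le> v" "v ^ 2 = (r - a) / 2"
    by (metis rcf_sqrt)
  have "(2 * u * v) ^ 2 = 4 * u ^ 2 * v ^ 2" by (simp add: power2_eq_square)
  also have "\<dots> = r ^ 2 - a ^ 2" by (simp only: uv) (simp add: power2_eq_square field_simps)
  finally have "(2 * u * v) ^ 2 = b ^ 2" using r by simp
  then have b: "2 * u * v = \<bar>b\<bar>" using uv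
    by (metis abs_of_nonneg mult_nonneg_nonneg power2_eq_iff_nonneg abs_ge_zero power2_abs zero_le_numeral)
  \<comment> \<open>So far 2uv is only known to be the absolute value of b; the sign of the
    imaginary part is chosen to match b.\<close>
  define v' where "v' = (if b \<ge> 0 then v else - v)"
  have "ac_cplx u v' ^ 2 = ac_cplx (u ^ 2 - v ^ 2) (2 * u * v')"
    by (simp add: power2_eq_square ac_cplx_arith v'_def algebra_simps)
  also have "u ^ 2 - v ^ 2 = a" by (simp only: uv) (simp add: field_simps)
  also have "2 * u * v' = b" using b by (auto simp: v'_def abs_if split: if_splits)
  finally show ?thesis using z by (auto simp: ac_cplxs_def)
qed

section \<open>Polynomials over R evaluated in the algebraic closure\<close>

lemma poly_map_to_ac_pCons:
  "poly (map_poly to_ac (pCons a p)) z = to_ac a + z * poly (map_poly to_ac p) z"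
  by (simp add: map_poly_pCons)

lemma poly_map_to_ac_add:
  "poly (map_poly to_ac (p + q)) z = poly (map_poly to_ac p) z + poly (map_poly to_ac q) z"
  by (induction p q rule: poly_induct2) (simp_all add: poly_map_to_ac_pCons algebra_simps)

lemma poly_map_to_ac_smult:
  "poly (map_poly to_ac (smult c p)) z = to_ac c * poly (map_poly to_ac p) z"
  by (induction p) (simp_all add: poly_map_to_ac_pCons algebra_simps)

lemma poly_map_to_ac_mult:
  "poly (map_poly to_ac (p * q)) z = poly (map_poly to_ac p) z * poly (map_poly to_ac q) z"
  by (induction p) (simp_all add: poly_map_to_ac_pCons poly_map_to_ac_add poly_map_to_ac_smult algebra_simps)

lemma poly_map_to_ac_of: "poly (map_poly to_ac p) (to_ac x) = to_ac (poly p x)"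
  by (induction p) (simp_all add: poly_map_to_ac_pCons)

lemma is_subfield_range_to_ac: "is_subfield (range to_ac :: 'r::real_closed_field alg_closure set)"
  unfolding is_subfield_def
  by (auto simp flip: to_ac_add to_ac_diff to_ac_mult to_ac_divide to_ac_0 to_ac_1)

text \<open>Laplace's induction on the power of 2 dividing the degree.  With roots \<open>a\<^sub>i\<close>, the polynomial with
  roots \<open>(t + a\<^sub>i) (t + a\<^sub>j)\<close>, \<open>i < j\<close>, has coefficients in the ground field; two values of \<open>t\<close> that
  select the same pair determine \<open>a\<^sub>i + a\<^sub>j\<close> and \<open>a\<^sub>i a\<^sub>j\<close>.\<close>

theorem rcf_root_in_cplxs:
  fixes p :: "'r::real_closed_field poly"
  assumes "degree p > 0"
  shows "\<exists>z\<in>ac_cplxs. poly (map_poly to_ac p) z = 0"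
proof -
  have main: "\<exists>z\<in>ac_cplxs. poly (map_poly to_ac p) z = 0"
    if "degree p = 2 ^ k * m" "odd m" for k m and p :: "'r poly"
    using that
  proof (induction k arbitrary: p m)
    case 0
    then have "odd (degree p)" "coeff p (degree p) \<noteq> 0" by auto
    then obtain x where "(\<Sum>k\<le>degree p. coeff p k * x ^ k) = 0"
      using odd_degree_has_root[of "degree p" "coeff p"] by blast
    then have "poly p x = 0" by (simp add: poly_altdef)
    then have "poly (map_poly to_ac p) (to_ac x) = 0" by (simp add: poly_map_to_ac_of)
    then show ?case using to_ac_in_cplxs by blast
  next
    case (Suc k)
    have p0: "p \<noteq> 0" using Suc.prems by auto
    let ?P = "map_poly to_ac p"
    have cP: "coeff ?P i = to_ac (coeff p i)" for i by (simp add: coeff_map_poly)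
    have P0: "?P \<noteq> 0" using p0 by (simp add: map_poly_eq_0_iff)
    have dP: "degree ?P = degree p" by (simp add: degree_map_poly)
    obtain A where A: "size A = degree ?P" "?P = smult (lead_coeff ?P) (\<Prod>x\<in>#A. [:-x, 1:])"
      using alg_closed_imp_factorization[OF P0] by blast
    obtain as where as: "mset as = A" using ex_mset by blast
    let ?Q = "\<Prod>a\<leftarrow>as. [:-a, 1:]"
    have PQ: "?P = smult (lead_coeff ?P) ?Q"
      using A(2) unfolding as[symmetric] by (simp only: prod_mset_prod_list mset_map[symmetric])
    have len: "length as = degree p" using A(1) as dP by (metis size_mset)
    have coQ: "coeff ?Q i \<in> range to_ac" for i
    proof -
      have "to_ac (coeff p i) = to_ac (coeff p (degree p)) * coeff ?Q i"
        by (metis PQ cP dP coeff_smult)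
      then have "coeff ?Q i = to_ac (coeff p i / lead_coeff p)"
        using p0 by simp
      then show ?thesis by blast
    qed
    have ex: "\<exists>ab\<in>set (pairs as). (of_nat t + fst ab) * (of_nat t + snd ab) \<in> ac_cplxs" for t :: nat
    proof -
      let ?bs = "map (\<lambda>(a, b). (of_nat t + a) * (of_nat t + b)) (pairs as)"
      let ?R = "\<Prod>c\<leftarrow>?bs. [:-c, 1:]"
      have t: "of_nat t \<in> range (to_ac :: 'r \<Rightarrow> _)"
        by (intro is_subfield_of_nat is_subfield_range_to_ac)
      have coR: "coeff ?R i \<in> range to_ac" for i
        by (rule pair_products_coeffs[OF is_subfield_range_to_ac coQ t])
      define q where "q = map_poly of_ac ?R"
      have qR: "map_poly to_ac q = ?R"
        by (rule poly_eqI) (use coR in \<open>simp add: q_def coeff_map_poly to_ac_of_ac\<close>)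
      have "degree (map_poly to_ac q) = degree q" by (simp add: degree_map_poly)
      then have "degree q = length ?bs" unfolding qR degree_linear_factors by simp
      then have "2 * degree q = degree p * (degree p - 1)"
        using length_pairs[of as] len by simp
      \<comment> \<open>Half of n (n - 1) with n = 2^(k+1) m: one factor 2 is lost, and the cofactor
        m (n - 1) stays odd because n is even.\<close>
      then have dq: "degree q = 2 ^ k * (m * (degree p - 1))" using Suc.prems by simp
      have "even (degree p)" "degree p > 0" using Suc.prems p0 by (auto simp: odd_pos)
      then have "odd (m * (degree p - 1))" using Suc.prems by simp
      from Suc.IH[OF dq this] obtain z where z: "z \<in> ac_cplxs" "poly ?R z = 0"
        unfolding qR by blast
      then have "z \<in> set ?bs"
        by (simp only: poly_linear_factors_eq_0_iff)
      then show ?thesis using z by force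
    qed
    then obtain f where f: "\<And>t::nat. f t \<in> set (pairs as)"
      "\<And>t::nat. (of_nat t + fst (f t)) * (of_nat t + snd (f t)) \<in> ac_cplxs"
      by metis
    have "finite (f ` UNIV)" by (rule finite_subset[of _ "set (pairs as)"]) (use f in auto)
    then obtain t0 where "\<not> finite {t. f t = f t0}"
      using pigeonhole_infinite[of "UNIV :: nat set" f] by auto
    then obtain t1 where t1: "f t1 = f t0" "t1 \<noteq> t0"
      by (metis (mono_tags, lifting) finite.simps finite_subset insertCI mem_Collect_eq subsetI)
    obtain a b where ab: "f t0 = (a, b)" by fastforce
    note C = is_subfieldD[OF is_subfield_cplxs] is_subfield_of_nat[OF is_subfield_cplxs]
    have in0: "(of_nat t0 + a) * (of_nat t0 + b) \<in> ac_cplxs"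
        and in1: "(of_nat t1 + a) * (of_nat t1 + b) \<in> ac_cplxs"
      using f(2)[of t0] f(2)[of t1] t1 ab by auto
    have ne: "(of_nat t1 - of_nat t0 :: 'r alg_closure) \<noteq> 0" using t1 by simp
    \<comment> \<open>The product (t + a)(t + b) is t^2 + t(a + b) + ab, so its difference quotient
      in t isolates a + b.\<close>
    have "((of_nat t1 + a) * (of_nat t1 + b) - (of_nat t0 + a) * (of_nat t0 + b)) / (of_nat t1 - of_nat t0)
        = of_nat t1 + of_nat t0 + (a + b)"
      using ne by (simp add: field_simps)
    moreover have "((of_nat t1 + a) * (of_nat t1 + b) - (of_nat t0 + a) * (of_nat t0 + b))
        / (of_nat t1 - of_nat t0) \<in> ac_cplxs"
      by (intro C in0 in1)
    ultimately have "of_nat t1 + of_nat t0 + (a + b) - (of_nat t1 + of_nat t0) \<in> ac_cplxs"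
      by (intro is_subfieldD(4)[OF is_subfield_cplxs]) (auto intro: C(3) C(8))
    then have s: "a + b \<in> ac_cplxs" by simp
    have "(of_nat t0 + a) * (of_nat t0 + b) - of_nat t0 * (of_nat t0 + (a + b)) \<in> ac_cplxs"
      by (intro C in0 s)
    then have pr: "a * b \<in> ac_cplxs" by (simp add: algebra_simps)
    \<comment> \<open>The discriminant of the quadratic with roots a and b: its square root in R(i)
      is a - b up to sign, and half the sum of a + b and a - b is a.\<close>
    have "(a + b) * (a + b) - of_nat 4 * (a * b) \<in> ac_cplxs" by (intro C s pr)
    then obtain w where w: "w \<in> ac_cplxs" "w ^ 2 = (a + b) * (a + b) - of_nat 4 * (a * b)"
      using cplxs_sqrt by blast
    have "w ^ 2 = (a - b) ^ 2" unfolding w(2) by (simp add: power2_eq_square algebra_simps)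
    then have "a - b = w \<or> a - b = - w" by (auto simp: power2_eq_iff)
    then have "a - b \<in> ac_cplxs" using w C by auto
    then have "((a + b) + (a - b)) / of_nat 2 \<in> ac_cplxs" by (rule C(6)[OF C(3)[OF s] C(8)])
    then have a: "a \<in> ac_cplxs" by (simp add: field_simps)
    have "a \<in> set as" using f(1)[of t0] ab set_pairs by metis
    then have "poly ?Q a = 0" by (simp only: poly_linear_factors_eq_0_iff)
    then have "poly ?P a = 0" by (metis PQ poly_smult mult_zero_right)
    then show ?case using a by blast
  qed
  have "degree p \<noteq> 0" "\<not> is_unit (2::nat)" using assms by auto
  then obtain m where "degree p = 2 ^ multiplicity 2 (degree p) * m" "odd m"
    by (rule multiplicity_decompose')
  then show ?thesis by (rule main)
qed

subsection \<open>Intermediate values and Rolle's theorem\<close>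

text \<open>Induction on the degree, splitting off a factor that leaves the sign change intact. A
  root u in R outside [a, b] gives the factor X - u of constant sign there; a non-real root u + iv
  gives (X - u)^2 + v^2, which is positive.\<close>

lemma rcf_poly_IVT:
  fixes p :: "'r::real_closed_field poly"
  assumes "a < b" "poly p a * poly p b < 0"
  shows "\<exists>x. a < x \<and> x < b \<and> poly p x = 0"
  using assms(2)
proof (induction "degree p" arbitrary: p rule: less_induct)
  case less
  have p0: "p \<noteq> 0" using less.prems by auto
  have ab: "poly p a \<noteq> 0" "poly p b \<noteq> 0" using less.prems by auto
  have "degree p > 0"
  proof (rule ccontr)
    assume "\<not> degree p > 0"
    then obtain c where "p = [:c:]" by (metis degree_eq_zeroE neq0_conv)
    then show False using less.prems by (auto simp: mult_less_0_iff)
  qed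
  then obtain u v where uv: "poly (map_poly to_ac p) (ac_cplx u v) = 0"
    using rcf_root_in_cplxs[of p] by (auto simp: ac_cplxs_def)
  show ?case
  proof (cases "v = 0")
    case True
    then have "poly p u = 0" using uv by (simp add: ac_cplx_def poly_map_to_ac_of)
    then obtain q where q: "p = [:-u, 1:] * q" by (metis poly_eq_0_iff_dvd dvdE)
    have dq: "degree q < degree p" using p0 by (subst q, subst degree_mult_eq) (auto simp: q)
    have "u \<noteq> a" "u \<noteq> b" using ab \<open>poly p u = 0\<close> by auto
    show ?thesis
    proof (cases "a < u \<and> u < b")
      case True
      then show ?thesis using \<open>poly p u = 0\<close> by blast
    next
      case False
      then have "0 < (a - u) * (b - u)" using \<open>u \<noteq> a\<close> \<open>u \<noteq> b\<close> assms(1)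
        by (auto simp: zero_less_mult_iff)
      moreover have "poly p a * poly p b = ((a - u) * (b - u)) * (poly q a * poly q b)"
        unfolding q poly_mult by (simp add: algebra_simps)
      ultimately have "poly q a * poly q b < 0" using less.prems
        by (metis mult_less_0_iff order_less_asym)
      from less.hyps[OF dq this] show ?thesis by (auto simp: q)
    qed
  next
    case False
    define D where "D = [:u ^ 2 + v ^ 2, - 2 * u, 1:]"
    have dD: "degree D = 2" by (simp add: D_def)
    have D0: "D \<noteq> 0" by (simp add: D_def)
    have Dz: "poly (map_poly to_ac D) (ac_cplx u v) = 0"
    proof -
      have "poly (map_poly to_ac D) (ac_cplx u v)
          = ac_cplx (u ^ 2 + v ^ 2) 0 + ac_cplx u v * (ac_cplx (- 2 * u) 0 + ac_cplx u v * ac_cplx 1 0)"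
        by (simp add: D_def map_poly_pCons) (simp add: ac_cplx_def)
      also have "\<dots> = ac_cplx 0 0"
        by (simp add: ac_cplx_arith power2_eq_square algebra_simps)
      finally show ?thesis by (simp add: ac_cplx_eq_0_iff)
    qed
    \<comment> \<open>A remainder of degree at most 1 over R that vanishes at a point u + iv with v
      \<noteq> 0 is zero, so D divides p.\<close>
    define r where "r = p mod D"
    have "p = (p div D) * D + r" by (simp add: r_def)
    then have rz: "poly (map_poly to_ac r) (ac_cplx u v) = 0"
      using uv by (metis Dz poly_map_to_ac_add poly_map_to_ac_mult mult_zero_right add_0)
    have "degree r < 2 \<or> r = 0" using degree_mod_less[OF D0, of p] dD by (auto simp: r_def)
    then have "degree r \<le> 1" by auto
    then have "r = [:coeff r 0, coeff r 1:]"
      by (intro poly_eqI) (auto simp: coeff_pCons coeff_eq_0 split: nat.splits)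
    then obtain c d where r: "r = [:c, d:]" by blast
    have "ac_cplx (c + d * u) (d * v) = 0" using rz by (simp add: r map_poly_pCons ac_cplx_def algebra_simps)
    then have "r = 0" using False by (auto simp: ac_cplx_eq_0_iff r)
    then obtain q where q: "p = D * q" by (metis r_def dvd_eq_mod_eq_0 dvdE)
    have dq: "degree q < degree p" using p0 by (subst q, subst degree_mult_eq) (auto simp: q dD)
    have Dpos: "poly D x > 0" for x
    proof -
      have "poly D x = (x - u) ^ 2 + v ^ 2" by (simp add: D_def power2_eq_square algebra_simps)
      then show ?thesis using False by (simp add: add_nonneg_pos)
    qed
    have "poly p a * poly p b = (poly D a * poly D b) * (poly q a * poly q b)"
      by (simp add: q)
    then have "poly q a * poly q b < 0"
      using less.prems mult_pos_pos[OF Dpos[of a] Dpos[of b]]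
      by (metis mult_less_0_iff order_less_asym)
    from less.hyps[OF dq this] show ?thesis by (auto simp: q)
  qed
qed

lemma rcf_poly_sgn_const:
  fixes p :: "'r::real_closed_field poly"
  assumes "a \<le> b" "\<And>x. a \<le> x \<Longrightarrow> x \<le> b \<Longrightarrow> poly p x \<noteq> 0"
  shows "sgn (poly p a) = sgn (poly p b)"
proof (rule ccontr)
  assume *: "sgn (poly p a) \<noteq> sgn (poly p b)"
  then have "a < b" using assms(1) by (cases "a = b") auto
  moreover have "poly p a * poly p b < 0"
    using * assms(2)[of a] assms(2)[of b] assms(1)
    by (auto simp: sgn_if mult_less_0_iff split: if_splits)
  ultimately show False using rcf_poly_IVT assms(2) by (meson less_imp_le)
qed

text \<open>An algebraic proof without extrema: with c the next root after a, write p = (X - a)^m (X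
  - c)^n q, where q(a) and q(c) have the same sign, and find a sign change of the remaining factor
  of the derivative.\<close>

lemma rcf_poly_rolle:
  fixes p :: "'r::real_closed_field poly"
  assumes "a < b" "poly p a = 0" "poly p b = 0"
  shows "\<exists>x. a < x \<and> x < b \<and> poly (pderiv p) x = 0"
proof (cases "p = 0")
  case True
  then show ?thesis using assms(1) dense by auto
next
  case False
  let ?X = "{x. poly p x = 0 \<and> a < x \<and> x \<le> b}"
  have fin: "finite ?X" by (rule finite_subset[OF _ poly_roots_finite[OF False]]) auto
  have "b \<in> ?X" using assms by simp
  define c where "c = Min ?X"
  have cX: "c \<in> ?X" unfolding c_def using fin \<open>b \<in> ?X\<close> Min_in by blast
  have cmin: "\<not> (a < x \<and> x < c \<and> poly p x = 0)" for x
    using Min_le[OF fin, of x] cX unfolding c_def[symmetric] by auto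
  obtain m p1 where m: "p = [:-a, 1:] ^ m * p1" "poly p1 a \<noteq> 0"
    using order_decomp[OF False, of a] poly_eq_0_iff_dvd by blast
  have "p1 \<noteq> 0" using m by auto
  then obtain n q where n: "p1 = [:-c, 1:] ^ n * q" "poly q c \<noteq> 0"
    using order_decomp[of p1 c] poly_eq_0_iff_dvd by blast
  have "m \<noteq> 0" using m assms(2) by (intro notI) auto
  moreover have "n \<noteq> 0" using n m cX by (intro notI) auto
  ultimately obtain m' n' where mn: "m = Suc m'" "n = Suc n'" by (meson not0_implies_Suc)
  have qa: "poly q a \<noteq> 0" using m n by auto
  have "\<not> poly q a * poly q c < 0"
    using rcf_poly_IVT[of a c q] cX cmin m n by auto
  then have qq: "0 < poly q a * poly q c" using qa n by (metis linorder_neqE_linordered_idom mult_eq_0_iff)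
  \<comment> \<open>The derivative divided by (X - a)^(m-1) (X - c)^(n-1). Its values m (a - c) q(a)
    and n (c - a) q(c) at a and c have opposite signs.\<close>
  define q1 where "q1 = smult (of_nat m) ([:-c, 1:] * q) + smult (of_nat n) ([:-a, 1:] * q)
    + [:-a, 1:] * [:-c, 1:] * pderiv q"
  have lin: "pderiv [:- x, 1:] = 1" for x :: 'r by (simp add: pderiv_pCons)
  have p': "poly (pderiv p) x = (x - a) ^ m' * (x - c) ^ n' * poly q1 x" for x
    unfolding m(1) n(1) mn q1_def pderiv_mult pderiv_power_Suc lin
    by (simp add: algebra_simps)
  have "poly q1 a * poly q1 c = - (of_nat m * of_nat n * (c - a) ^ 2 * (poly q a * poly q c))"
    by (simp add: q1_def power2_eq_square algebra_simps)
  also have "\<dots> < 0" using qq mn cX by (auto intro!: mult_pos_pos simp del: of_nat_Suc)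
  finally have "poly q1 a * poly q1 c < 0" .
  then obtain x where "a < x" "x < c" "poly q1 x = 0" using rcf_poly_IVT[of a c q1] cX by auto
  then show ?thesis using p' cX by (metis mult_zero_right less_le_trans mem_Collect_eq)
qed

lemma rcf_poly_MVT:
  fixes p :: "'r::real_closed_field poly"
  assumes "a < b"
  shows "\<exists>x. a < x \<and> x < b \<and> poly p b - poly p a = (b - a) * poly (pderiv p) x"
proof -
  let ?h = "smult (b - a) p - smult (poly p b - poly p a) [:-a, 1:] - [:(b - a) * poly p a:]"
  have "poly ?h a = 0" "poly ?h b = 0" by (simp_all add: algebra_simps)
  then obtain x where "a < x" "x < b" "poly (pderiv ?h) x = 0"
    using rcf_poly_rolle[OF assms] by blast
  moreover have "poly (pderiv ?h) x = (b - a) * poly (pderiv p) x - (poly p b - poly p a)"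
    by (simp add: pderiv_diff pderiv_smult pderiv_pCons)
  ultimately show ?thesis by (metis eq_iff_diff_eq_0)
qed

text \<open>The uniform bound \<delta> strengthens the induction: in the Horner step a + x p(x) it
  makes x p(x) reach 1 - a once x is at least (1 - a) / \<delta>.\<close>

lemma poly_eventually_pos:
  fixes p :: "'r::linordered_field poly"
  assumes "lead_coeff p > 0"
  shows "\<exists>M \<delta>. 0 < \<delta> \<and> (\<forall>x\<ge>M. \<delta> \<le> poly p x)"
  using assms
proof (induction p)
  case (pCons a p)
  show ?case
  proof (cases "p = 0")
    case True
    then show ?thesis using pCons.prems by (intro exI[of _ 0] exI[of _ a]) auto
  next
    case False
    then obtain M \<delta> where M: "0 < \<delta>" "\<And>x. x \<ge> M \<Longrightarrow> \<delta> \<le> poly p x"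
      using pCons by auto
    have "1 \<le> a + x * poly p x" if "x \<ge> max (max M 0) ((1 - a) / \<delta>)" for x
    proof -
      have "1 - a \<le> x * \<delta>" using that M(1) by (simp add: field_simps)
      also have "\<dots> \<le> x * poly p x" using that M by (intro mult_left_mono) auto
      finally show ?thesis by simp
    qed
    then show ?thesis
      by (intro exI[of _ "max (max M 0) ((1 - a) / \<delta>)"] exI[of _ 1]) auto
  qed
qed simp

lemma poly_eventually_sgn:
  fixes p :: "'r::linordered_field poly"
  shows "\<exists>M. \<forall>x\<ge>M. sgn (poly p x) = sgn (lead_coeff p)"
proof -
  consider "lead_coeff p > 0" | "lead_coeff p < 0" | "p = 0" by (metis leading_coeff_0_iff linorder_neqE)
  then show ?thesis
  proof cases
    case 1
    then show ?thesis using poly_eventually_pos[OF 1] by (metis sgn_pos less_le_trans)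
  next
    case 2
    then have "lead_coeff (- p) > 0" by simp
    then obtain M \<delta> where "0 < \<delta>" "\<forall>x\<ge>M. \<delta> \<le> poly (- p) x" using poly_eventually_pos by blast
    then have "\<forall>x\<ge>M. poly p x < 0" by fastforce
    then show ?thesis using 2 by (intro exI[of _ M]) simp
  qed simp
qed

text \<open>Serves the induction over derivatives: beyond all roots the sign of \<open>p\<close>
  follows from that of its derivative, so no sign data at infinity have to be carried along.\<close>

lemma poly_pderiv_sgn_at_top:
  fixes p :: "'r::linordered_field poly"
  assumes "degree p > 0"
  shows "\<exists>M. \<forall>x\<ge>M. sgn (poly p x) = sgn (poly (pderiv p) x) \<and> poly p x \<noteq> 0"
proof -
  have "lead_coeff (pderiv p) = of_nat (degree p) * lead_coeff p"
    using assms by (simp add: coeff_pderiv degree_pderiv)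
  then have "sgn (lead_coeff (pderiv p)) = sgn (lead_coeff p)"
    using assms by (simp add: sgn_mult)
  moreover obtain M1 where "\<forall>x\<ge>M1. sgn (poly p x) = sgn (lead_coeff p)"
    using poly_eventually_sgn by blast
  moreover obtain M2 where "\<forall>x\<ge>M2. sgn (poly (pderiv p) x) = sgn (lead_coeff (pderiv p))"
    using poly_eventually_sgn by blast
  moreover have "sgn (lead_coeff p) \<noteq> 0" using assms by (auto simp: sgn_0_0)
  ultimately show ?thesis by (intro exI[of _ "max M1 M2"]) (auto simp: sgn_0_0)
qed

lemma poly_pderiv_sgn_at_bot:
  fixes p :: "'r::linordered_field poly"
  assumes "degree p > 0"
  shows "\<exists>M. \<forall>x\<le>M. sgn (poly p x) = - sgn (poly (pderiv p) x) \<and> poly p x \<noteq> 0"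
proof -
  let ?q = "pcompose p [:0, -1:]"
  have "degree ?q > 0" using assms by (simp add: degree_pcompose)
  then obtain M where M: "\<forall>x\<ge>M. sgn (poly ?q x) = sgn (poly (pderiv ?q) x) \<and> poly ?q x \<noteq> 0"
    using poly_pderiv_sgn_at_top by blast
  have q: "poly ?q x = poly p (- x)" "poly (pderiv ?q) x = - poly (pderiv p) (- x)" for x
    by (simp_all add: poly_pcompose pderiv_pcompose pderiv_pCons)
  have "sgn (poly p x) = - sgn (poly (pderiv p) x) \<and> poly p x \<noteq> 0" if "x \<le> - M" for x
    using M[rule_format, of "- x"] that unfolding q by (simp add: sgn_minus)
  then show ?thesis by blast
qed

section \<open>Quantifier elimination\<close>

subsection \<open>Order isomorphisms preserving signs\<close>

text \<open>Sign diagrams are compared without being listed: two families of polynomials have the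
  same diagram if some monotone bijection of the line carries the signs of one to those of the
  other. No compatibility with the algebra is required of it.\<close>

definition order_iso :: "('r::linorder \<Rightarrow> 'r) \<Rightarrow> bool" where
  "order_iso \<phi> \<longleftrightarrow> strict_mono \<phi> \<and> surj \<phi>"

lemma order_iso_less: "order_iso \<phi> \<Longrightarrow> \<phi> x < \<phi> y \<longleftrightarrow> x < y"
  by (auto simp: order_iso_def strict_mono_less)

lemma order_iso_le: "order_iso \<phi> \<Longrightarrow> \<phi> x \<le> \<phi> y \<longleftrightarrow> x \<le> y"
  by (auto simp: order_iso_def strict_mono_less_eq)

lemma order_iso_eq: "order_iso \<phi> \<Longrightarrow> \<phi> x = \<phi> y \<longleftrightarrow> x = y"
  by (auto simp: order_iso_def strict_mono_eq)

lemma order_iso_obtain: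
  assumes "order_iso \<phi>"
  obtains x where "\<phi> x = y"
  using assms by (metis order_iso_def surjD)

lemma order_iso_inv: "order_iso \<phi> \<Longrightarrow> order_iso (inv_into UNIV \<phi>)"
proof -
  assume *: "order_iso \<phi>"
  then have inv: "\<phi> (inv_into UNIV \<phi> y) = y" "inv_into UNIV \<phi> (\<phi> y) = y" for y
    by (auto simp: order_iso_def surj_f_inv_f inv_f_f strict_mono_imp_inj_on)
  have "strict_mono (inv_into UNIV \<phi>)"
    using order_iso_less[OF *] inv(1) by (auto intro!: strict_monoI) (metis inv(1))
  moreover have "surj (inv_into UNIV \<phi>)" by (rule surjI) (rule inv(2))
  ultimately show ?thesis by (simp add: order_iso_def)
qed

lemma extend_to_order_iso:
  fixes f :: "'r::linordered_field \<Rightarrow> 'r"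
  assumes "finite A" "\<And>x y. x \<in> A \<Longrightarrow> y \<in> A \<Longrightarrow> x < y \<Longrightarrow> f x < f y"
  shows "\<exists>\<psi>. order_iso \<psi> \<and> (\<forall>a\<in>A. \<psi> a = f a)"
  using assms
proof (induction A rule: finite_linorder_max_induct)
  case empty
  show ?case by (intro exI[of _ "\<lambda>x. x"]) (auto simp: order_iso_def strict_mono_def)
next
  case (insert b A)
  show ?case
  proof (cases "A = {}")
    case True
    have "surj (\<lambda>x. x + (f b - b))" by (rule surjI[of _ "\<lambda>y. y - (f b - b)"]) simp
    then show ?thesis using True
      by (intro exI[of _ "\<lambda>x. x + (f b - b)"]) (auto simp: order_iso_def strict_mono_def)
  next
    case False
    obtain \<psi> where \<psi>: "order_iso \<psi>" "\<forall>a\<in>A. \<psi> a = f a" using insert by blast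
    define a where "a = Max A"
    have a: "a \<in> A" "\<And>x. x \<in> A \<Longrightarrow> x \<le> a" using insert.hyps False by (auto simp: a_def)
    have ab: "a < b" "f a < f b" using insert a by auto
    define k where "k = (f b - f a) / (b - a)"
    have k: "k > 0" using ab by (simp add: k_def)
    \<comment> \<open>Beyond the largest point a of \<open>A\<close> the map is continued affinely,
      with the slope \<open>k\<close> that makes it reach \<open>f b\<close> at b.\<close>
    define \<chi> where "\<chi> x = (if x \<le> a then \<psi> x else f a + (x - a) * k)" for x
    have "\<chi> x < \<chi> y" if "x < y" for x y
    proof -
      have "\<psi> x \<le> f a" if "x \<le> a" using \<psi> a that by (metis order_iso_le)
      moreover have "0 < (y - a) * k" if "a < y" using that k by simp
      moreover have "(x - a) * k < (y - a) * k" using k \<open>x < y\<close> by simp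
      ultimately show ?thesis using \<open>x < y\<close> order_iso_less[OF \<psi>(1), of x y]
        by (auto simp: \<chi>_def not_le intro: le_less_trans)
    qed
    moreover have "\<exists>x. \<chi> x = y" for y
    proof (cases "y \<le> f a")
      case True
      obtain x where x: "\<psi> x = y" using \<psi>(1) by (rule order_iso_obtain)
      then have "x \<le> a" using True \<psi> a by (metis order_iso_le)
      then show ?thesis using x by (auto simp: \<chi>_def)
    next
      case False
      then have "\<chi> (a + (y - f a) / k) = y" using k by (auto simp: \<chi>_def field_simps)
      then show ?thesis by blast
    qed
    ultimately have "order_iso \<chi>" unfolding order_iso_def strict_mono_def surj_def by metis
    moreover have "\<chi> x = f x" if "x \<in> insert b A" for x
      using that ab a \<psi> by (auto simp: \<chi>_def k_def)
    ultimately show ?thesis by blast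
  qed
qed

text \<open>Two order isomorphisms that agree on \<open>Z\<close> map a point outside \<open>Z\<close> into the same gap.\<close>

lemma sgn_same_gap:
  fixes r :: "'r::real_closed_field poly"
  assumes "order_iso \<phi>" "order_iso \<psi>" "\<forall>z\<in>Z. \<psi> z = \<phi> z" "x \<notin> Z"
    and roots: "\<And>y. poly r y = 0 \<Longrightarrow> y \<in> \<phi> ` Z"
  shows "sgn (poly r (\<phi> x)) = sgn (poly r (\<psi> x))"
proof -
  have no: "\<not> (\<phi> x \<le> y \<and> y \<le> \<psi> x)" "\<not> (\<psi> x \<le> y \<and> y \<le> \<phi> x)" if "poly r y = 0" for y
  proof -
    obtain z where z: "z \<in> Z" "y = \<phi> z" "y = \<psi> z" using roots[OF \<open>poly r y = 0\<close>] assms(3) by force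
    then show "\<not> (\<phi> x \<le> y \<and> y \<le> \<psi> x)" "\<not> (\<psi> x \<le> y \<and> y \<le> \<phi> x)"
      using assms(4) order_iso_le[OF assms(1)] order_iso_le[OF assms(2)] by (metis order_antisym)+
  qed
  show ?thesis
  proof (cases "\<phi> x \<le> \<psi> x")
    case True
    then show ?thesis using rcf_poly_sgn_const no by blast
  next
    case False
    then show ?thesis using rcf_poly_sgn_const[of "\<psi> x" "\<phi> x" r] no by force
  qed
qed

text \<open>If \<xi> is not in \<open>Z\<close>, it lies between consecutive points a and b of
  \<open>Z\<close>. The derivative has no zero between them, so by the mean value theorem p(a) and
  p(b) have opposite signs. These signs transfer to q, which therefore has a root in the
  corresponding gap.\<close>

lemma root_transfer:
  fixes p q :: "'r::real_closed_field poly"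
  assumes iso: "order_iso \<phi>" and fin: "finite Z"
    and pZ: "\<And>x. poly (pderiv p) x = 0 \<Longrightarrow> x \<in> Z"
    and sZ: "\<And>z. z \<in> Z \<Longrightarrow> sgn (poly p z) = sgn (poly q (\<phi> z))"
    and bounds: "u \<in> Z" "v \<in> Z" "u < \<xi>" "\<xi> < v"
    and root: "poly p \<xi> = 0"
  shows "\<exists>\<eta>. poly q \<eta> = 0 \<and> (\<forall>z\<in>Z. (z < \<xi> \<longleftrightarrow> \<phi> z < \<eta>) \<and> (\<xi> < z \<longleftrightarrow> \<eta> < \<phi> z))"
proof (cases "\<xi> \<in> Z")
  case True
  then have "poly q (\<phi> \<xi>) = 0" using sZ[OF True] root by (metis sgn_0 sgn_0_0)
  then show ?thesis using iso by (intro exI[of _ "\<phi> \<xi>"]) (auto simp: order_iso_less)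
next
  case False
  define a where "a = Max {z \<in> Z. z < \<xi>}"
  define b where "b = Min {z \<in> Z. \<xi> < z}"
  have a: "a \<in> Z" "a < \<xi>" "\<And>z. z \<in> Z \<Longrightarrow> z < \<xi> \<Longrightarrow> z \<le> a"
  proof -
    have "u \<in> {z \<in> Z. z < \<xi>}" using bounds by simp
    then have "a \<in> {z \<in> Z. z < \<xi>}" unfolding a_def using fin by (intro Max_in) auto
    then show "a \<in> Z" "a < \<xi>" by auto
    show "\<And>z. z \<in> Z \<Longrightarrow> z < \<xi> \<Longrightarrow> z \<le> a" unfolding a_def using fin by (intro Max_ge) auto
  qed
  have b: "b \<in> Z" "\<xi> < b" "\<And>z. z \<in> Z \<Longrightarrow> \<xi> < z \<Longrightarrow> b \<le> z"
  proof -
    have "v \<in> {z \<in> Z. \<xi> < z}" using bounds by simp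
    then have "b \<in> {z \<in> Z. \<xi> < z}" unfolding b_def using fin by (intro Min_in) auto
    then show "b \<in> Z" "\<xi> < b" by auto
    show "\<And>z. z \<in> Z \<Longrightarrow> \<xi> < z \<Longrightarrow> b \<le> z" unfolding b_def using fin by (intro Min_le) auto
  qed
  have gap: "z \<notin> Z" if "a < z" "z < b" for z
    using a(3)[of z] b(3)[of z] that False by (metis linorder_neqE_linordered_idom not_less)
  obtain c1 where c1: "a < c1" "c1 < \<xi>" "poly p \<xi> - poly p a = (\<xi> - a) * poly (pderiv p) c1"
    using rcf_poly_MVT[OF a(2)] by blast
  obtain c2 where c2: "\<xi> < c2" "c2 < b" "poly p b - poly p \<xi> = (b - \<xi>) * poly (pderiv p) c2"
    using rcf_poly_MVT[OF b(2)] by blast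
  have "sgn (poly (pderiv p) c1) = sgn (poly (pderiv p) c2)"
    by (rule rcf_poly_sgn_const) (use c1 c2 gap pZ in force)+
  moreover have "poly (pderiv p) c1 \<noteq> 0" using pZ gap c1 b by (meson less_trans)
  ultimately have pos: "0 < poly (pderiv p) c1 * poly (pderiv p) c2"
    by (metis sgn_mult sgn_greater mult_sgn_abs sgn_if zero_less_mult_iff zero_less_one sgn_less
        not_less_iff_gr_or_eq)
  have "poly p a * poly p b = - (((\<xi> - a) * (b - \<xi>)) * (poly (pderiv p) c1 * poly (pderiv p) c2))"
  proof -
    have "poly p a = - ((\<xi> - a) * poly (pderiv p) c1)" using c1(3) root by linarith
    moreover have "poly p b = (b - \<xi>) * poly (pderiv p) c2" using c2(3) root by linarith
    ultimately show ?thesis by simp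
  qed
  also have "\<dots> < 0" using pos a(2) b(2) by simp
  finally have "sgn (poly p a * poly p b) = -1" by simp
  then have "sgn (poly q (\<phi> a) * poly q (\<phi> b)) = -1" using sZ a(1) b(1) by (simp add: sgn_mult)
  then have "poly q (\<phi> a) * poly q (\<phi> b) < 0" by (simp only: sgn_1_neg)
  moreover have "\<phi> a < \<phi> b" using iso a b by (simp add: order_iso_less)
  ultimately obtain \<eta> where \<eta>: "\<phi> a < \<eta>" "\<eta> < \<phi> b" "poly q \<eta> = 0"
    using rcf_poly_IVT by blast
  have "(z < \<xi> \<longleftrightarrow> \<phi> z < \<eta>) \<and> (\<xi> < z \<longleftrightarrow> \<eta> < \<phi> z)" if z: "z \<in> Z" for z
  proof -
    have "z < \<xi> \<Longrightarrow> \<phi> z < \<eta>" using a(3)[OF z] \<eta>(1) iso by (metis order_iso_le le_less_trans)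
    moreover have "\<xi> < z \<Longrightarrow> \<eta> < \<phi> z" using b(3)[OF z] \<eta>(2) iso by (metis order_iso_le less_le_trans)
    moreover have "z \<noteq> \<xi>" using z False by auto
    ultimately show ?thesis by (metis linorder_neqE_linordered_idom order_less_asym)
  qed
  then show ?thesis using \<eta> by blast
qed

text \<open>The inductive step of the Cohen-Hoermander method: between consecutive points of \<open>Z\<close> the
  polynomial is monotone, so its signs on \<open>Z\<close> determine where it has roots.\<close>

lemma order_iso_extend_sgn:
  fixes p q :: "'r::real_closed_field poly"
  assumes iso: "order_iso \<phi>" and fin: "finite Z" and deg: "degree p > 0" "degree q > 0"
    and d: "\<And>x. sgn (poly (pderiv p) x) = sgn (poly (pderiv q) (\<phi> x))"
    and pZ: "\<And>x. poly (pderiv p) x = 0 \<Longrightarrow> x \<in> Z"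
    and sZ: "\<And>z. z \<in> Z \<Longrightarrow> sgn (poly p z) = sgn (poly q (\<phi> z))"
  shows "\<exists>\<psi>. order_iso \<psi> \<and> (\<forall>z\<in>Z. \<psi> z = \<phi> z) \<and> (\<forall>x. sgn (poly p x) = sgn (poly q (\<psi> x)))"
proof -
  have qZ: "y \<in> \<phi> ` Z" if "poly (pderiv q) y = 0" for y
    using iso that d pZ by (metis order_iso_obtain sgn_0_0 imageI)
  obtain M1 where M1: "\<And>x. x \<le> M1 \<Longrightarrow> sgn (poly p x) = - sgn (poly (pderiv p) x) \<and> poly p x \<noteq> 0"
    using poly_pderiv_sgn_at_bot[OF deg(1)] by blast
  obtain M2 where M2: "\<And>x. x \<le> M2 \<Longrightarrow> sgn (poly q x) = - sgn (poly (pderiv q) x) \<and> poly q x \<noteq> 0"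
    using poly_pderiv_sgn_at_bot[OF deg(2)] by blast
  obtain N1 where N1: "\<And>x. x \<ge> N1 \<Longrightarrow> sgn (poly p x) = sgn (poly (pderiv p) x) \<and> poly p x \<noteq> 0"
    using poly_pderiv_sgn_at_top[OF deg(1)] by blast
  obtain N2 where N2: "\<And>x. x \<ge> N2 \<Longrightarrow> sgn (poly q x) = sgn (poly (pderiv q) x) \<and> poly q x \<noteq> 0"
    using poly_pderiv_sgn_at_top[OF deg(2)] by blast
  obtain m2 n2 where mn: "\<phi> m2 = M2" "\<phi> n2 = N2" using iso by (metis order_iso_obtain)
  \<comment> \<open>Points to the left and to the right of all roots of p whose images bound all
    roots of q. Adding them to \<open>Z\<close> gives every root a neighbour on both sides, and the
    signs at them are forced by those of the derivatives.\<close>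
  define u where "u = min M1 m2"
  define v where "v = max N1 n2"
  have u: "u \<le> M1" "\<phi> u \<le> M2" using iso mn by (auto simp: u_def order_iso_le simp flip: mn)
  have v: "v \<ge> N1" "\<phi> v \<ge> N2" using iso mn by (auto simp: v_def order_iso_le simp flip: mn)
  define Y where "Y = insert u (insert v Z)"
  have Y: "finite Y" "u \<in> Y" "v \<in> Y" "Z \<subseteq> Y" using fin by (auto simp: Y_def)
  have sY: "sgn (poly p z) = sgn (poly q (\<phi> z))" if "z \<in> Y" for z
    using that sZ M1[OF u(1)] M2[OF u(2)] N1[OF v(1)] N2[OF v(2)] d by (auto simp: Y_def)
  have pb: "u < x \<and> x < v" if "poly p x = 0" for x
    using that M1[of x] N1[of x] u v by (metis linorder_not_less order_trans)
  have qb: "\<phi> u < x \<and> x < \<phi> v" if "poly q x = 0" for x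
    using that M2[of x] N2[of x] u v by (metis linorder_not_less order_trans)
  define N where "N \<xi> \<eta> \<longleftrightarrow> (\<forall>z\<in>Y. (z < \<xi> \<longleftrightarrow> \<phi> z < \<eta>) \<and> (\<xi> < z \<longleftrightarrow> \<eta> < \<phi> z))" for \<xi> \<eta>
  have fwd: "\<exists>\<eta>. poly q \<eta> = 0 \<and> N \<xi> \<eta>" if "poly p \<xi> = 0" for \<xi>
    unfolding N_def
    by (rule root_transfer[OF iso Y(1) _ sY Y(2,3)]) (use that pb pZ Y in auto)
  have bwd: "\<exists>\<xi>. poly p \<xi> = 0 \<and> N \<xi> \<eta>" if "poly q \<eta> = 0" for \<eta>
  proof -
    have inv: "inv_into UNIV \<phi> (\<phi> z) = z" for z
      using iso by (metis order_iso_def inv_f_f strict_mono_imp_inj_on)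
    have qZY: "x \<in> \<phi> ` Y" if "poly (pderiv q) x = 0" for x using qZ[OF that] Y(4) by blast
    have "\<exists>\<xi>. poly p \<xi> = 0 \<and> (\<forall>z\<in>\<phi> ` Y. (z < \<eta> \<longleftrightarrow> inv_into UNIV \<phi> z < \<xi>) \<and> (\<eta> < z \<longleftrightarrow> \<xi> < inv_into UNIV \<phi> z))"
      by (rule root_transfer[OF order_iso_inv[OF iso], of _ q p "\<phi> u" "\<phi> v"])
        (use Y qZY sY inv qb that in auto)
    then show ?thesis by (auto simp: N_def inv)
  qed
  define A where "A = {x. poly p x = 0} \<union> Y"
  have "p \<noteq> 0" using deg by auto
  then have finA: "finite A" using Y by (simp add: A_def poly_roots_finite)
  have "\<exists>\<eta>. N x \<eta> \<and> (poly p x = 0 \<longrightarrow> poly q \<eta> = 0)" if "x \<in> A" for x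
  proof (cases "poly p x = 0")
    case False
    then have "N x (\<phi> x)" using that iso by (auto simp: N_def A_def order_iso_less)
    then show ?thesis using False by blast
  qed (use fwd in blast)
  then obtain f where f: "\<And>x. x \<in> A \<Longrightarrow> N x (f x)"
    "\<And>x. x \<in> A \<Longrightarrow> poly p x = 0 \<Longrightarrow> poly q (f x) = 0" by metis
  have fY: "f z = \<phi> z" if "z \<in> Y" for z
    using f(1)[of z] that unfolding N_def A_def by (metis UnCI linorder_neqE order_less_irrefl)
  \<comment> \<open>Two roots of p enclose a zero of its derivative, which lies in \<open>Z\<close>.
    So some z in \<open>Y\<close> lies between x and y, and the positions relative to z order the
    images.\<close>
  have mono: "f x < f y" if "x \<in> A" "y \<in> A" "x < y" for x y
  proof -
    have "\<exists>z\<in>Y. x \<le> z \<and> z \<le> y"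
    proof (cases "x \<in> Y \<or> y \<in> Y")
      case True
      then show ?thesis using \<open>x < y\<close> by (meson less_imp_le order_refl)
    next
      case False
      then have "poly p x = 0" "poly p y = 0" using that by (auto simp: A_def)
      then show ?thesis using rcf_poly_rolle[OF \<open>x < y\<close>] pZ Y by (meson less_imp_le subsetD)
    qed
    then obtain z where z: "z \<in> Y" "x \<le> z" "z \<le> y" by blast
    have Nx: "z < x \<longleftrightarrow> \<phi> z < f x" "x < z \<longleftrightarrow> f x < \<phi> z" and Ny: "z < y \<longleftrightarrow> \<phi> z < f y" "y < z \<longleftrightarrow> f y < \<phi> z"
      using f(1)[OF that(1)] f(1)[OF that(2)] z(1) unfolding N_def by blast+
    have "f x \<le> \<phi> z" "\<phi> z \<le> f y" using Nx(1) Ny(2) z by (auto simp: not_less)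
    moreover have "x < z \<or> z < y" using \<open>x < y\<close> z by auto
    ultimately show ?thesis using Nx(2) Ny(1) by (meson le_less_trans less_le_trans)
  qed
  obtain \<psi> where \<psi>: "order_iso \<psi>" "\<And>a. a \<in> A \<Longrightarrow> \<psi> a = f a"
    using extend_to_order_iso[of A f] finA mono by blast
  have \<psi>Y: "\<psi> z = \<phi> z" if "z \<in> Y" for z using that \<psi> fY by (simp add: A_def)
  \<comment> \<open>A root of q is determined by its position relative to \<open>Y\<close>: two
    roots in the same position would enclose a zero of the derivative of q, which lies in the image
    of \<open>Z\<close>.\<close>
  have qroot: "\<exists>\<xi>. poly p \<xi> = 0 \<and> \<psi> \<xi> = \<eta>" if \<eta>: "poly q \<eta> = 0" for \<eta>
  proof -
    obtain \<xi> where \<xi>: "poly p \<xi> = 0" "N \<xi> \<eta>" using bwd[OF \<eta>] by blast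
    then have A: "\<xi> \<in> A" by (simp add: A_def)
    have q0: "poly q (f \<xi>) = 0" using f(2)[OF A] \<xi> by simp
    have no: "\<not> (\<phi> z < \<eta> \<and> f \<xi> < \<phi> z)" "\<not> (\<phi> z < f \<xi> \<and> \<eta> < \<phi> z)" if "z \<in> Y" for z
      using f(1)[OF A] \<xi>(2) that unfolding N_def by (metis order_less_asym)+
    have "f \<xi> = \<eta>"
    proof (rule ccontr)
      assume "f \<xi> \<noteq> \<eta>"
      then consider "f \<xi> < \<eta>" | "\<eta> < f \<xi>" by (rule linorder_neqE)
      then show False
      proof cases
        case 1
        then obtain w where "f \<xi> < w" "w < \<eta>" "poly (pderiv q) w = 0"
          using rcf_poly_rolle q0 \<eta> by blast
        then show ?thesis using qZ no(1) Y by blast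
      next
        case 2
        then obtain w where "\<eta> < w" "w < f \<xi>" "poly (pderiv q) w = 0"
          using rcf_poly_rolle q0 \<eta> by blast
        then show ?thesis using qZ no(2) Y by blast
      qed
    qed
    then show ?thesis using \<xi> \<psi>(2)[OF A] by auto
  qed
  have qA: "\<psi> t \<noteq> y" if "t \<notin> A" "poly q y = 0 \<or> poly (pderiv q) y = 0" for t y
  proof
    assume t: "\<psi> t = y"
    from that(2) show False
    proof
      assume "poly q y = 0"
      then show False using qroot t \<psi>(1) that(1) by (metis (mono_tags) A_def UnI1 mem_Collect_eq order_iso_eq)
    next
      assume "poly (pderiv q) y = 0"
      then obtain z where "z \<in> Z" "y = \<phi> z" using qZ by blast
      moreover from this have "z \<in> Y" using Y by blast
      ultimately have "t = z" "z \<in> Y" using t \<psi>Y[of z] order_iso_eq[OF \<psi>(1), of t z] by auto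
      then show False using that(1) by (simp add: A_def)
    qed
  qed
  have qgap: "poly q y \<noteq> 0" "poly (pderiv q) y \<noteq> 0"
    if "\<psi> s \<le> y" "y \<le> \<psi> x" "\<And>t. s \<le> t \<Longrightarrow> t \<le> x \<Longrightarrow> t \<notin> A" for s x y
  proof -
    obtain t where t: "\<psi> t = y" using \<psi>(1) by (rule order_iso_obtain)
    then have "t \<notin> A" using that \<psi>(1) by (auto simp: order_iso_le)
    then show "poly q y \<noteq> 0" "poly (pderiv q) y \<noteq> 0" using qA t by blast+
  qed
  have "sgn (poly p x) = sgn (poly q (\<psi> x))" for x
  proof (cases "x \<in> A")
    case True
    then show ?thesis using sY \<psi>Y f(2)[OF True] \<psi>(2)[OF True] by (auto simp: A_def)
  next
    case False
    show ?thesis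
    proof (cases "{a \<in> A. a < x} = {}")
      case True
      then have xu: "x < u" using Y(2) False
        by (metis (mono_tags, lifting) A_def UnCI empty_iff linorder_neqE mem_Collect_eq)
      have np: "poly p y \<noteq> 0" if "x \<le> y" "y \<le> u" for y using pb[of y] that by auto
      have nq: "poly q y \<noteq> 0" if "\<psi> x \<le> y" "y \<le> \<psi> u" for y using qb[of y] that \<psi>Y[OF Y(2)] by auto
      have "sgn (poly p x) = sgn (poly p u)" using xu np by (intro rcf_poly_sgn_const) auto
      moreover have "sgn (poly q (\<psi> x)) = sgn (poly q (\<psi> u))"
        using xu nq \<psi>(1) by (intro rcf_poly_sgn_const) (auto simp: order_iso_le)
      ultimately show ?thesis using sY[OF Y(2)] \<psi>Y[OF Y(2)] by simp
    next
      case ne: False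
      define a where "a = Max {a \<in> A. a < x}"
      have a: "a \<in> A" "a < x" using Max_in[OF _ ne] finA by (auto simp: a_def)
      have gap: "t \<notin> A" if "a < t" "t \<le> x" for t
      proof
        assume "t \<in> A"
        then have "t < x" using that False by (metis order_le_less)
        then have "t \<le> a" unfolding a_def using finA \<open>t \<in> A\<close> by (intro Max_ge) auto
        then show False using that by simp
      qed
      have \<psi>ax: "\<psi> a < \<psi> x" using a \<psi>(1) by (simp add: order_iso_less)
      have qgap': "poly q y \<noteq> 0" "poly (pderiv q) y \<noteq> 0" if "\<psi> a < y" "y \<le> \<psi> x" for y
      proof -
        obtain t where "\<psi> t = y" using \<psi>(1) by (rule order_iso_obtain)
        then show "poly q y \<noteq> 0" "poly (pderiv q) y \<noteq> 0"
          using qgap[of t y t] that gap \<psi>(1) by (metis order_antisym order_iso_le order_iso_less order_refl)+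
      qed
      \<comment> \<open>Here a is the last point of \<open>A\<close> to the left of x. If p(a) is
        nonzero, its sign persists up to x; if a is a root, p takes the sign of its derivative to
        the right of a, and that sign is already matched by \<phi>.\<close>
      show ?thesis
      proof (cases "poly p a = 0")
        case False
        then have aY: "a \<in> Y" using a by (simp add: A_def)
        then have qa: "poly q (\<psi> a) \<noteq> 0" using sY[OF aY] \<psi>Y[OF aY] False by (metis sgn_0_0)
        have "sgn (poly p a) = sgn (poly p x)"
          using a gap False by (intro rcf_poly_sgn_const) (auto simp: A_def order_le_less)
        moreover have "sgn (poly q (\<psi> a)) = sgn (poly q (\<psi> x))"
          using \<psi>ax qgap' qa by (intro rcf_poly_sgn_const) (auto simp: order_le_less)
        ultimately show ?thesis using sY[OF aY] \<psi>Y[OF aY] by simp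
      next
        case True
        then have qa: "poly q (\<psi> a) = 0" using f(2) \<psi>(2) a by simp
        obtain c where c: "a < c" "c < x" "poly p x - poly p a = (x - a) * poly (pderiv p) c"
          using rcf_poly_MVT[OF a(2)] by blast
        have "sgn (poly (pderiv p) c) = sgn (poly (pderiv p) x)"
          by (rule rcf_poly_sgn_const) (use c gap pZ Y in \<open>force simp: A_def\<close>)+
        then have p: "sgn (poly p x) = sgn (poly (pderiv p) x)"
          using c True a by (simp add: sgn_mult)
        obtain c' where c': "\<psi> a < c'" "c' < \<psi> x"
          "poly q (\<psi> x) - poly q (\<psi> a) = (\<psi> x - \<psi> a) * poly (pderiv q) c'"
          using rcf_poly_MVT[OF \<psi>ax] by blast
        have "sgn (poly (pderiv q) c') = sgn (poly (pderiv q) (\<psi> x))"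
          using c' qgap' by (intro rcf_poly_sgn_const) auto
        then have q: "sgn (poly q (\<psi> x)) = sgn (poly (pderiv q) (\<psi> x))"
          using c' qa \<psi>ax by (simp add: sgn_mult)
        have "sgn (poly (pderiv q) (\<phi> x)) = sgn (poly (pderiv q) (\<psi> x))"
          by (rule sgn_same_gap[OF iso \<psi>(1), of Z]) (use \<psi>Y Y False qZ in \<open>auto simp: A_def\<close>)
        then show ?thesis using p q d by simp
      qed
    qed
  qed
  then show ?thesis using \<psi>(1) \<psi>Y Y by blast
qed

subsection \<open>Polynomials depending on parameters\<close>

text \<open>Polynomial functions of an assignment of values to variables. Only values matter, so no
  formal polynomials appear, and the type of variables may be infinite.\<close>

inductive_set polfun :: "(('v \<Rightarrow> 'r::comm_ring_1) \<Rightarrow> 'r) set" where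
  polfun_const: "(\<lambda>_. c) \<in> polfun"
| polfun_var: "(\<lambda>e. e v) \<in> polfun"
| polfun_add: "p \<in> polfun \<Longrightarrow> q \<in> polfun \<Longrightarrow> (\<lambda>e. p e + q e) \<in> polfun"
| polfun_mult: "p \<in> polfun \<Longrightarrow> q \<in> polfun \<Longrightarrow> (\<lambda>e. p e * q e) \<in> polfun"

lemma polfun_minus: "p \<in> polfun \<Longrightarrow> (\<lambda>e. - p e) \<in> polfun"
  using polfun_mult[OF polfun_const[of "-1"], of p] by simp

lemma polfun_diff: "p \<in> polfun \<Longrightarrow> q \<in> polfun \<Longrightarrow> (\<lambda>e. p e - q e) \<in> polfun"
  using polfun_add[OF _ polfun_minus, of p q] by simp

lemma polfun_sum: "(\<And>i. i \<in> A \<Longrightarrow> f i \<in> polfun) \<Longrightarrow> (\<lambda>e. \<Sum>i\<in>A. f i e) \<in> polfun"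
  by (induction A rule: infinite_finite_induct) (auto intro: polfun_const polfun_add)

lemma polfun_prod: "(\<And>i. i \<in> A \<Longrightarrow> f i \<in> polfun) \<Longrightarrow> (\<lambda>e. \<Prod>i\<in>A. f i e) \<in> polfun"
  by (induction A rule: infinite_finite_induct) (auto intro: polfun_const polfun_mult)

lemma polfun_power: "p \<in> polfun \<Longrightarrow> (\<lambda>e. p e ^ n) \<in> polfun"
  by (induction n) (auto intro: polfun_const polfun_mult)

lemma polfun_subst:
  assumes "q \<in> polfun" "\<And>v. (\<lambda>e. \<sigma> e v) \<in> polfun"
  shows "(\<lambda>e. q (\<sigma> e)) \<in> polfun"
  using assms(1) by induction (auto intro: assms(2) polfun.intros)

lemma polfun_if:
  "(c \<Longrightarrow> p \<in> polfun) \<Longrightarrow> (\<not> c \<Longrightarrow> q \<in> polfun) \<Longrightarrow> (\<lambda>e. if c then p e else q e) \<in> polfun"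
  by (cases c) simp_all

lemmas polfun_intros = polfun_if polfun_const polfun_var polfun_add polfun_mult polfun_minus polfun_diff
  polfun_sum polfun_prod polfun_power

text \<open>A pair \<open>(n, c)\<close> stands for the polynomial of formal degree less than \<open>n\<close> with coefficient functions
  \<open>c\<close>.\<close>

type_synonym ('v, 'r) ppoly = "nat \<times> (nat \<Rightarrow> ('v \<Rightarrow> 'r) \<Rightarrow> 'r)"

definition pp_at :: "('v \<Rightarrow> 'r::comm_ring_1) \<Rightarrow> ('v, 'r) ppoly \<Rightarrow> 'r poly" where
  "pp_at e p = (\<Sum>i<fst p. monom (snd p i e) i)"

definition pp_ok :: "('v, 'r::comm_ring_1) ppoly \<Rightarrow> bool" where
  "pp_ok p \<longleftrightarrow> (\<forall>i. snd p i \<in> polfun)"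

text \<open>The coefficient of highest formal degree, which may vanish at some parameters. For
  formal size 0 the truncated index is 0, and the value is not a coefficient of the
  polynomial.\<close>

abbreviation pp_lead :: "('v, 'r) ppoly \<Rightarrow> ('v \<Rightarrow> 'r) \<Rightarrow> 'r" where
  "pp_lead p \<equiv> snd p (fst p - 1)"

lemma coeff_pp_at: "coeff (pp_at e p) i = (if i < fst p then snd p i e else 0)"
  by (simp add: pp_at_def coeff_sum)

lemma pp_at_trunc: "pp_lead p e = 0 \<Longrightarrow> pp_at e (fst p - 1, snd p) = pp_at e p"
  by (rule poly_eqI) (auto simp: coeff_pp_at, metis Suc_pred less_antisym not_gr_zero not_less_zero)

lemma polfun_expand:
  assumes "q \<in> polfun"
  shows "\<exists>p. pp_ok p \<and> (\<forall>e x. q (e(v := x)) = poly (pp_at e p) x)"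
  using assms
proof induction
  case (polfun_const c)
  show ?case
    by (intro exI[of _ "(1, \<lambda>_ _. c)"]) (auto simp: pp_ok_def pp_at_def poly_monom intro: polfun_intros)
next
  case (polfun_var w)
  show ?case
  proof (cases "w = v")
    case True
    then show ?thesis
      by (intro exI[of _ "(2, \<lambda>i _. of_nat i)"])
        (auto simp: pp_ok_def pp_at_def poly_monom numeral_2_eq_2 intro: polfun_intros)
  next
    case False
    then show ?thesis
      by (intro exI[of _ "(1, \<lambda>_ e. e w)"]) (auto simp: pp_ok_def pp_at_def poly_monom intro: polfun_intros)
  qed
next
  case (polfun_add p q)
  then obtain p' q' where pq: "pp_ok p'" "\<And>e x. p (e(v := x)) = poly (pp_at e p') x"
    "pp_ok q'" "\<And>e x. q (e(v := x)) = poly (pp_at e q') x" by blast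
  define r where "r = (max (fst p') (fst q'), \<lambda>i e. coeff (pp_at e p') i + coeff (pp_at e q') i)"
  have "pp_at e r = pp_at e p' + pp_at e q'" for e
    by (rule poly_eqI) (auto simp: coeff_pp_at r_def)
  moreover have "pp_ok r" using pq by (auto simp: pp_ok_def r_def coeff_pp_at intro!: polfun_intros)
  ultimately show ?case using pq by (intro exI[of _ r]) (simp del: fun_upd_apply)
next
  case (polfun_mult p q)
  then obtain p' q' where pq: "pp_ok p'" "\<And>e x. p (e(v := x)) = poly (pp_at e p') x"
    "pp_ok q'" "\<And>e x. q (e(v := x)) = poly (pp_at e q') x" by blast
  define r where "r = (fst p' + fst q', \<lambda>i e. coeff (pp_at e p' * pp_at e q') i)"
  have "coeff (pp_at e p' * pp_at e q') i = 0" if "fst p' + fst q' \<le> i" for e i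
    unfolding coeff_mult by (rule sum.neutral) (use that in \<open>auto simp: coeff_pp_at\<close>)
  then have "pp_at e r = pp_at e p' * pp_at e q'" for e
    by (intro poly_eqI) (auto simp: coeff_pp_at r_def)
  moreover have "pp_ok r"
    using pq unfolding pp_ok_def r_def by (auto simp: coeff_mult coeff_pp_at intro!: polfun_intros)
  ultimately show ?case using pq by (intro exI[of _ r]) (simp del: fun_upd_apply)
qed

text \<open>Division with remainder without inverting the leading coefficient, which depends on the
  parameters and may vanish: every reduction step multiplies the dividend by it. One exponent and
  one remainder serve all parameters at once.\<close>

lemma pp_pseudo_rem:
  fixes p q :: "('v, 'r::comm_ring_1) ppoly"
  assumes "pp_ok p" "pp_ok q" "fst q > 0"
  shows "\<exists>r k. pp_ok r \<and> fst r < fst q \<and>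
    (\<forall>e. \<exists>s. smult (pp_lead q e ^ k) (pp_at e p) = s * pp_at e q + pp_at e r)"
  using assms(1)
proof (induction "fst p" arbitrary: p rule: less_induct)
  case less
  show ?case
  proof (cases "fst p < fst q")
    case True
    then show ?thesis using less.prems
      by (intro exI[of _ p] exI[of _ 0]) (auto intro: exI[of _ 0])
  next
    case False
    define d where "d = fst p - fst q"
    \<comment> \<open>One reduction step, lead(q) p - lead(p) X^d q; the formal size drops by one
      because the top coefficient cancels identically.\<close>
    define p1 where "p1 = (fst p - 1,
        \<lambda>i e. pp_lead q e * snd p i e - (if d \<le> i then pp_lead p e * snd q (i - d) e else 0))"
    have "pp_ok p1" using less.prems assms(2)
      by (auto simp: pp_ok_def p1_def intro!: polfun_intros)
    moreover have "fst p1 < fst p" using False assms(3) by (simp add: p1_def)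
    ultimately obtain r k where rk: "pp_ok r" "fst r < fst q"
      "\<And>e. \<exists>s. smult (pp_lead q e ^ k) (pp_at e p1) = s * pp_at e q + pp_at e r"
      using less.hyps by blast
    have eq: "smult (pp_lead q e) (pp_at e p) = monom (pp_lead p e) d * pp_at e q + pp_at e p1" for e
    proof (rule poly_eqI)
      fix i
      have "i - d < fst q \<longleftrightarrow> i < fst p" if "d \<le> i" using that False by (auto simp: d_def)
      moreover have "i < fst p - 1 \<or> i = fst p - 1 \<or> fst p \<le> i" by auto
      moreover have "fst p - Suc d = fst q - 1" "d \<le> fst p - 1" "fst p > 0" using False assms(3)
        by (auto simp: d_def)
      ultimately show "coeff (smult (pp_lead q e) (pp_at e p)) i
          = coeff (monom (pp_lead p e) d * pp_at e q + pp_at e p1) i"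
        by (auto simp: coeff_pp_at coeff_monom_mult p1_def)
    qed
    have "\<exists>s. smult (pp_lead q e ^ Suc k) (pp_at e p) = s * pp_at e q + pp_at e r" for e
    proof -
      obtain s where s: "smult (pp_lead q e ^ k) (pp_at e p1) = s * pp_at e q + pp_at e r"
        using rk(3) by blast
      have "smult (pp_lead q e ^ Suc k) (pp_at e p) = smult (pp_lead q e ^ k) (smult (pp_lead q e) (pp_at e p))"
        by (simp add: mult.commute)
      also have "\<dots> = (smult (pp_lead q e ^ k) (monom (pp_lead p e) d) + s) * pp_at e q + pp_at e r"
        by (simp only: eq smult_add_right s) (simp add: algebra_simps)
      finally show ?thesis by blast
    qed
    then show ?thesis using rk by blast
  qed
qed

text \<open>The pseudo-remainder is multiplied once more by the same power of the leading
  coefficient. At a zero of q the factor between p and the new remainder is then a nonzero square,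
  so the signs agree.\<close>

lemma pp_rem_sgn:
  fixes p q :: "('v, 'r::linordered_field) ppoly"
  assumes "pp_ok p" "pp_ok q" "fst q > 0"
  shows "\<exists>r. pp_ok r \<and> fst r < fst q \<and>
    (\<forall>e z. pp_lead q e \<noteq> 0 \<longrightarrow> poly (pp_at e q) z = 0 \<longrightarrow>
      sgn (poly (pp_at e p) z) = sgn (poly (pp_at e r) z))"
proof -
  obtain r k where r: "pp_ok r" "fst r < fst q"
    "\<And>e. \<exists>s. smult (pp_lead q e ^ k) (pp_at e p) = s * pp_at e q + pp_at e r"
    using pp_pseudo_rem[OF assms] by blast
  define r' where "r' = (fst r, \<lambda>i e. pp_lead q e ^ k * snd r i e)"
  have r': "pp_at e r' = smult (pp_lead q e ^ k) (pp_at e r)" for e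
    by (rule poly_eqI) (simp add: coeff_pp_at r'_def)
  have "sgn (poly (pp_at e p) z) = sgn (poly (pp_at e r') z)"
    if "pp_lead q e \<noteq> 0" "poly (pp_at e q) z = 0" for e z
  proof -
    let ?l = "pp_lead q e ^ k"
    obtain s where "smult ?l (pp_at e p) = s * pp_at e q + pp_at e r" using r(3) by blast
    then have "poly (smult ?l (pp_at e p)) z = poly (s * pp_at e q + pp_at e r) z"
      by (rule arg_cong)
    then have "?l * poly (pp_at e p) z = poly (pp_at e r) z"
      using that(2) by simp
    then have "?l * ?l * poly (pp_at e p) z = poly (pp_at e r') z"
      by (simp add: r' mult.assoc)
    moreover have "x * x > 0" if "x \<noteq> 0" for x :: 'r
      using that by (auto simp: zero_less_mult_iff linorder_neq_iff)
    then have "?l * ?l > 0" using that(1) by simp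
    ultimately show ?thesis by (metis mult.left_neutral sgn_mult sgn_pos)
  qed
  moreover have "pp_ok r'" using r(1) assms(2) by (auto simp: pp_ok_def r'_def intro!: polfun_intros)
  ultimately show ?thesis using r(2) by (intro exI[of _ r']) (simp add: r'_def)
qed

definition sgn_eq :: "(('v \<Rightarrow> 'r::linordered_field) \<Rightarrow> 'r) set \<Rightarrow> ('v \<Rightarrow> 'r) \<Rightarrow> ('v \<Rightarrow> 'r) \<Rightarrow> bool" where
  "sgn_eq Q e e' \<longleftrightarrow> (\<forall>q\<in>Q. sgn (q e) = sgn (q e'))"

definition sgn_conj :: "('v, 'r::linordered_field) ppoly list \<Rightarrow> ('v \<Rightarrow> 'r) \<Rightarrow> ('v \<Rightarrow> 'r) \<Rightarrow> ('r \<Rightarrow> 'r) \<Rightarrow> bool" where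
  "sgn_conj L e e' \<phi> \<longleftrightarrow> order_iso \<phi> \<and>
     (\<forall>p\<in>set L. \<forall>x. sgn (poly (pp_at e p) x) = sgn (poly (pp_at e' p) (\<phi> x)))"

text \<open>The elimination step proper. The largest member \<open>p\<close> is replaced by its
  derivative and by its remainders modulo the derivative and the other members. All of these have
  smaller formal size, so the multiset of sizes decreases. At a zero of a divisor the sign of
  \<open>p\<close> is that of the remainder, as \<open>order_iso_extend_sgn\<close>
  requires.\<close>

lemma pp_sgn_patterns:
  fixes L :: "('v, 'r::real_closed_field) ppoly list"
  assumes "\<forall>p\<in>set L. pp_ok p"
  shows "\<exists>Q. finite Q \<and> Q \<subseteq> polfun \<and> (\<forall>e e'. sgn_eq Q e e' \<longrightarrow> (\<exists>\<phi>. sgn_conj L e e' \<phi>))"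
  using assms
proof (induction L rule: wf_induct_rule[OF wf_inv_image[OF wf_mult1[OF wf_less_than],
    of "\<lambda>L. mset (map fst L)"]])
  case (1 L)
  have IH: "\<exists>Q. finite Q \<and> Q \<subseteq> polfun \<and> (\<forall>e e'. sgn_eq Q e e' \<longrightarrow> (\<exists>\<phi>. sgn_conj (L' @ remove1 p L) e e' \<phi>))"
    if "p \<in> set L" "\<forall>q\<in>set L'. fst q < fst p \<and> pp_ok q" for p L'
  proof (rule "1.IH")
    have "mset (map fst L) = add_mset (fst p) (mset (map fst (remove1 p L)))"
      using that(1) by (simp flip: image_mset_add_mset)
    moreover have "mset (map fst (L' @ remove1 p L)) = mset (map fst (remove1 p L)) + mset (map fst L')"
      by simp
    ultimately show "(L' @ remove1 p L, L) \<in> inv_image (mult1 less_than) (\<lambda>L. mset (map fst L))"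
      using that(2) unfolding in_inv_image mult1_def
      by (intro CollectI case_prodI exI[of _ "fst p"] exI[of _ "mset (map fst (remove1 p L))"]
          exI[of _ "mset (map fst L')"]) auto
    show "\<forall>q\<in>set (L' @ remove1 p L). pp_ok q"
      using that(2) "1.prems" by (auto dest: notin_set_remove1)
  qed
  show ?case
  proof (cases "\<forall>p\<in>set L. fst p \<le> 1")
    case True
    \<comment> \<open>With all formal sizes at most 1 nothing depends on x, and the identity map
      matches the signs.\<close>
    define Q where "Q = (\<lambda>p. snd p 0) ` set L"
    have "sgn_conj L e e' (\<lambda>x. x)" if "sgn_eq Q e e'" for e e'
      unfolding sgn_conj_def
    proof (intro conjI ballI allI)
      show "order_iso (\<lambda>x::'r. x)" by (simp add: order_iso_def strict_mono_def)
      fix p x assume p: "p \<in> set L"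
      have "fst p = 0 \<or> fst p = 1" using True p by force
      moreover have "sgn (snd p 0 e) = sgn (snd p 0 e')" using that p by (auto simp: sgn_eq_def Q_def)
      ultimately show "sgn (poly (pp_at e p) x) = sgn (poly (pp_at e' p) x)"
        by (auto simp: pp_at_def poly_monom)
    qed
    moreover have "finite Q" "Q \<subseteq> polfun" using "1.prems" by (auto simp: Q_def pp_ok_def)
    ultimately show ?thesis by blast
  next
    case False
    define N where "N = Max (fst ` set L)"
    have "set L \<noteq> {}" using False by auto
    then have "N \<in> fst ` set L" unfolding N_def by (intro Max_in) auto
    then obtain p where p: "p \<in> set L" "fst p = N" by auto
    have Nmax: "fst q \<le> N" if "q \<in> set L" for q using that by (simp add: N_def)
    then have N2: "N \<ge> 2" using False by force
    define L0 where "L0 = remove1 p L"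
    have setL: "set L = insert p (set L0)" unfolding L0_def using p(1)
      by (metis set_mset_mset set_mset_add_mset_insert mset_remove1 insert_DiffM in_multiset_in_set)
    have L0: "q \<in> set L" "pp_ok q" "fst q \<le> N" if "q \<in> set L0" for q
      using that setL "1.prems" Nmax by auto
    define dp :: "('v, 'r) ppoly" where "dp = (N - 1, \<lambda>i e. of_nat (Suc i) * snd p (Suc i) e)"
    have ok: "pp_ok p" "pp_ok dp" using "1.prems" p by (auto simp: dp_def pp_ok_def intro!: polfun_intros)
    have dp: "pp_at e dp = pderiv (pp_at e p)" for e
      by (rule poly_eqI) (use p N2 in \<open>auto simp: coeff_pp_at coeff_pderiv dp_def\<close>)
    have "\<exists>r. pp_ok r \<and> fst r < N \<and> (fst q > 0 \<longrightarrow> (\<forall>e z. pp_lead q e \<noteq> 0 \<longrightarrow> poly (pp_at e q) z = 0 \<longrightarrow>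
      sgn (poly (pp_at e p) z) = sgn (poly (pp_at e r) z)))" if "pp_ok q" "fst q \<le> N" for q
    proof (cases "fst q > 0")
      case True
      then show ?thesis using pp_rem_sgn[OF ok(1) that(1)] that(2) by (meson less_le_trans)
    next
      case False
      \<comment> \<open>For formal size 0 there is nothing to divide by; the zero polynomial is a
        placeholder of admissible size.\<close>
      then show ?thesis using ok N2 by (intro exI[of _ "(0, snd p)"]) (auto simp: pp_ok_def)
    qed
    then obtain R where R: "\<And>q. pp_ok q \<Longrightarrow> fst q \<le> N \<Longrightarrow> pp_ok (R q) \<and> fst (R q) < N"
      "\<And>q e z. pp_ok q \<Longrightarrow> fst q \<le> N \<Longrightarrow> fst q > 0 \<Longrightarrow> pp_lead q e \<noteq> 0 \<Longrightarrow> poly (pp_at e q) z = 0 \<Longrightarrow>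
      sgn (poly (pp_at e p) z) = sgn (poly (pp_at e (R q)) z)" by metis
    have "\<forall>q\<in>set (dp # map R (dp # L0)). fst q < fst p \<and> pp_ok q"
      using R(1) ok L0 N2 p by (auto simp: dp_def)
    from IH[OF p(1) this] obtain Q1 where Q1: "finite Q1" "Q1 \<subseteq> polfun"
      "\<And>e e'. sgn_eq Q1 e e' \<Longrightarrow> \<exists>\<phi>. sgn_conj ((dp # map R (dp # L0)) @ L0) e e' \<phi>"
      unfolding L0_def by blast
    \<comment> \<open>For parameters at which the formal leading coefficient of q vanishes, q is
      shortened by one term; \<open>T q\<close> will be the finite set belonging to the shortened
      list.\<close>
    have "\<exists>Q. finite Q \<and> Q \<subseteq> polfun \<and> (\<forall>e e'. sgn_eq Q e e' \<longrightarrow>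
      (\<exists>\<phi>. sgn_conj ((fst q - 1, snd q) # remove1 q L) e e' \<phi>))" if "q \<in> set L" "fst q > 0" for q
      using IH[OF that(1), of "[(fst q - 1, snd q)]"] that "1.prems" by (auto simp: pp_ok_def)
    then obtain T where T: "\<And>q. q \<in> set L \<Longrightarrow> fst q > 0 \<Longrightarrow> finite (T q) \<and> T q \<subseteq> polfun"
      "\<And>q e e'. q \<in> set L \<Longrightarrow> fst q > 0 \<Longrightarrow> sgn_eq (T q) e e' \<Longrightarrow>
        \<exists>\<phi>. sgn_conj ((fst q - 1, snd q) # remove1 q L) e e' \<phi>" by metis
    define L1 where "L1 = {q \<in> set L. fst q > 0}"
    \<comment> \<open>The signs of the leading coefficients decide, alike for e and e', whether some
      q has to be shortened or the main case applies.\<close>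
    define Q where "Q = Q1 \<union> (\<Union>q\<in>L1. insert (pp_lead q) (T q))"
    have T1: "finite (T q)" "T q \<subseteq> polfun" "pp_lead q \<in> polfun" if "q \<in> L1" for q
      using T(1)[of q] that "1.prems" by (auto simp: L1_def pp_ok_def)
    have "finite L1" by (simp add: L1_def)
    then have Qfin: "finite Q" "Q \<subseteq> polfun"
      unfolding Q_def using Q1(1,2) T1 by (blast intro: finite_UN_I)+
    have "\<exists>\<phi>. sgn_conj L e e' \<phi>" if ee: "sgn_eq Q e e'" for e e'
    proof (cases "\<exists>q\<in>L1. pp_lead q e = 0")
      case True
      then obtain q where q: "q \<in> set L" "fst q > 0" "pp_lead q e = 0" by (auto simp: L1_def)
      have "q \<in> L1" using q by (simp add: L1_def)
      then have "pp_lead q \<in> Q" "T q \<subseteq> Q" unfolding Q_def by blast+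
      then have "sgn (pp_lead q e) = sgn (pp_lead q e')" "sgn_eq (T q) e e'"
        using ee unfolding sgn_eq_def by blast+
      then have q': "pp_lead q e' = 0" using q(3) by (metis sgn_0 sgn_0_0)
      obtain \<phi> where \<phi>: "sgn_conj ((fst q - 1, snd q) # remove1 q L) e e' \<phi>"
        using T(2)[OF q(1,2) \<open>sgn_eq (T q) e e'\<close>] by blast
      have "set L \<subseteq> insert q (set (remove1 q L))"
        by (metis in_set_remove1 insertCI subsetI)
      then have "sgn_conj L e e' \<phi>"
        using \<phi> pp_at_trunc[OF q(3)] pp_at_trunc[OF q'] unfolding sgn_conj_def by auto
      then show ?thesis by blast
    next
      case False
      then have le: "pp_lead q e \<noteq> 0" if "q \<in> L1" for q using that by blast
      have le': "pp_lead q e' \<noteq> 0" if "q \<in> L1" for q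
      proof -
        have "sgn (pp_lead q e) = sgn (pp_lead q e')" using ee that by (auto simp: sgn_eq_def Q_def)
        then show ?thesis using le[OF that] by (metis sgn_0 sgn_0_0)
      qed
      have "sgn_eq Q1 e e'" using ee by (auto simp: sgn_eq_def Q_def)
      then obtain \<phi> where \<phi>: "sgn_conj ((dp # map R (dp # L0)) @ L0) e e' \<phi>" using Q1(3) by blast
      then have iso: "order_iso \<phi>"
        and sdp: "\<And>x. sgn (poly (pp_at e dp) x) = sgn (poly (pp_at e' dp) (\<phi> x))"
        and sR: "\<And>q x. q \<in> insert dp (set L0)
            \<Longrightarrow> sgn (poly (pp_at e (R q)) x) = sgn (poly (pp_at e' (R q)) (\<phi> x))"
        and sL0: "\<And>q x. q \<in> set L0 \<Longrightarrow> sgn (poly (pp_at e q) x) = sgn (poly (pp_at e' q) (\<phi> x))"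
        by (auto simp: sgn_conj_def)
      have pL1: "p \<in> L1" using p N2 by (simp add: L1_def)
      define B where "B = {q \<in> insert dp (set L0). fst q > 0}"
      have B: "pp_ok q" "fst q \<le> N" "fst q > 0" if "q \<in> B" for q
      proof -
        have q: "q = dp \<or> q \<in> set L0" "fst q > 0" using that by (auto simp: B_def)
        then show "fst q > 0" by simp
        have "fst dp \<le> N" by (simp add: dp_def)
        then show "pp_ok q" "fst q \<le> N" using q(1) ok(2) L0(2,3) by blast+
      qed
      obtain m where m: "N = Suc (Suc m)" using N2 by (metis add_2_eq_Suc le_Suc_ex)
      have ndp: "pp_lead dp e \<noteq> 0" "pp_lead dp e' \<noteq> 0"
        using le[OF pL1] le'[OF pL1] p N2 by (auto simp: dp_def m simp del: of_nat_Suc)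
      have Ble: "pp_lead q e \<noteq> 0" "pp_lead q e' \<noteq> 0" if "q \<in> B" for q
      proof -
        have "q = dp \<or> q \<in> L1" using that L0(1) unfolding B_def L1_def by blast
        then show "pp_lead q e \<noteq> 0" "pp_lead q e' \<noteq> 0" using ndp le le' by blast+
      qed
      have Bnz: "pp_at e q \<noteq> 0" if "q \<in> B" for q
        using Ble(1)[OF that] coeff_pp_at[of e q "fst q - 1"] B(3)[OF that] by auto
      define Z where "Z = (\<Union>q\<in>B. {z. poly (pp_at e q) z = 0})"
      have finZ: "finite Z" using Bnz by (auto simp: Z_def B_def poly_roots_finite)
      have sB: "sgn (poly (pp_at e q) x) = sgn (poly (pp_at e' q) (\<phi> x))" if "q \<in> B" for q x
        using that sdp sL0 unfolding B_def by blast
      have degp: "degree (pp_at e p) > 0" "degree (pp_at e' p) > 0"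
      proof -
        have "coeff (pp_at e p) (N - 1) \<noteq> 0" "coeff (pp_at e' p) (N - 1) \<noteq> 0"
          using le[OF pL1] le'[OF pL1] p N2 by (auto simp: coeff_pp_at)
        then show "degree (pp_at e p) > 0" "degree (pp_at e' p) > 0"
          using le_degree N2 by (metis diff_is_0_eq less_le_trans not_less numeral_2_eq_2 One_nat_def
              Suc_le_eq gr0I)+
      qed
      have dpB: "dp \<in> B" using N2 by (simp add: B_def dp_def)
      have "\<exists>\<psi>. order_iso \<psi> \<and> (\<forall>z\<in>Z. \<psi> z = \<phi> z) \<and>
          (\<forall>x. sgn (poly (pp_at e p) x) = sgn (poly (pp_at e' p) (\<psi> x)))"
      proof (rule order_iso_extend_sgn[OF iso finZ degp])
        show "sgn (poly (pderiv (pp_at e p)) x) = sgn (poly (pderiv (pp_at e' p)) (\<phi> x))" for x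
          using sdp by (simp add: dp)
        show "x \<in> Z" if "poly (pderiv (pp_at e p)) x = 0" for x
          using that dpB unfolding Z_def by (auto simp: dp intro: bexI[of _ dp])
        fix z assume "z \<in> Z"
        then obtain q where q: "q \<in> B" "poly (pp_at e q) z = 0" by (auto simp: Z_def)
        then have q': "poly (pp_at e' q) (\<phi> z) = 0" using sB[OF q(1), of z] by (metis sgn_0 sgn_0_0)
        have "q \<in> insert dp (set L0)" using q(1) by (simp add: B_def)
        then show "sgn (poly (pp_at e p) z) = sgn (poly (pp_at e' p) (\<phi> z))"
          using R(2)[OF B[OF q(1)] Ble(1)[OF q(1)] q(2)] R(2)[OF B[OF q(1)] Ble(2)[OF q(1)] q'] sR by simp
      qed
      then obtain \<psi> where \<psi>: "order_iso \<psi>" "\<forall>z\<in>Z. \<psi> z = \<phi> z"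
        "\<And>x. sgn (poly (pp_at e p) x) = sgn (poly (pp_at e' p) (\<psi> x))" by blast
      have "sgn (poly (pp_at e q) x) = sgn (poly (pp_at e' q) (\<psi> x))" if q: "q \<in> set L0" for q x
      proof (cases "fst q > 0")
        case True
        then have qB: "q \<in> B" using q by (simp add: B_def)
        show ?thesis
        proof (cases "x \<in> Z")
          case True
          then show ?thesis using \<psi>(2) sB[OF qB] by simp
        next
          case False
          have "sgn (poly (pp_at e' q) (\<phi> x)) = sgn (poly (pp_at e' q) (\<psi> x))"
          proof (rule sgn_same_gap[OF iso \<psi>(1,2) False])
            fix y assume y: "poly (pp_at e' q) y = 0"
            obtain t where t: "\<phi> t = y" using iso by (rule order_iso_obtain)
            then have "poly (pp_at e q) t = 0" using sB[OF qB, of t] y by (metis sgn_0 sgn_0_0)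
            then show "y \<in> \<phi> ` Z" using qB t by (auto simp: Z_def)
          qed
          then show ?thesis using sB[OF qB, of x] by simp
        qed
      qed (simp add: pp_at_def)
      then have "sgn_conj L e e' \<psi>" using \<psi> setL by (auto simp: sgn_conj_def)
      then show ?thesis by blast
    qed
    then show ?thesis using Qfin by blast
  qed
qed

subsection \<open>Definable predicates\<close>

text \<open>Quantifier elimination is treated semantically: that signs of finitely many polynomials
  determine the truth value amounts to being a Boolean combination of sign conditions.\<close>

definition definable :: "(('v \<Rightarrow> 'r::linordered_field) \<Rightarrow> bool) \<Rightarrow> bool" where
  "definable P \<longleftrightarrow> (\<exists>Q. finite Q \<and> Q \<subseteq> polfun \<and> (\<forall>e e'. sgn_eq Q e e' \<longrightarrow> P e = P e'))"

lemma definable_gt0: "q \<in> polfun \<Longrightarrow> definable (\<lambda>e. 0 < q e)"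
proof -
  assume "q \<in> polfun"
  moreover have "0 < q e \<longleftrightarrow> 0 < q e'" if "sgn (q e) = sgn (q e')" for e e'
  proof -
    have "0 < q e \<longleftrightarrow> sgn (q e) = 1" by (rule sgn_1_pos[symmetric])
    also have "\<dots> \<longleftrightarrow> 0 < q e'" unfolding that by (rule sgn_1_pos)
    finally show ?thesis .
  qed
  ultimately show ?thesis unfolding definable_def sgn_eq_def
    by (intro exI[of _ "{q}"]) (blast intro: finite.intros)
qed

lemma definable_eq0: "q \<in> polfun \<Longrightarrow> definable (\<lambda>e. q e = 0)"
proof -
  assume "q \<in> polfun"
  moreover have "q e = 0 \<longleftrightarrow> q e' = 0" if "sgn (q e) = sgn (q e')" for e e'
  proof -
    have "q e = 0 \<longleftrightarrow> sgn (q e) = 0" by (rule sgn_0_0[symmetric])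
    also have "\<dots> \<longleftrightarrow> q e' = 0" unfolding that by (rule sgn_0_0)
    finally show ?thesis .
  qed
  ultimately show ?thesis unfolding definable_def sgn_eq_def
    by (intro exI[of _ "{q}"]) (blast intro: finite.intros)
qed

lemma definable_const: "definable (\<lambda>_. P)"
  unfolding definable_def by (intro exI[of _ "{}"]) auto

lemma definable_not: "definable P \<Longrightarrow> definable (\<lambda>e. \<not> P e)"
  unfolding definable_def by (elim exE) (rule_tac x = Q in exI, auto)

lemma definable_conj:
  assumes "definable P" "definable P'"
  shows "definable (\<lambda>e. P e \<and> P' e)"
proof -
  obtain Q Q' where "finite Q" "Q \<subseteq> polfun" "finite Q'" "Q' \<subseteq> polfun"
    "\<forall>e e'. sgn_eq Q e e' \<longrightarrow> P e = P e'" "\<forall>e e'. sgn_eq Q' e e' \<longrightarrow> P' e = P' e'"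
    using assms by (auto simp: definable_def)
  moreover have "sgn_eq Q e e' \<and> sgn_eq Q' e e'" if "sgn_eq (Q \<union> Q') e e'" for e e'
    using that by (auto simp: sgn_eq_def)
  ultimately show ?thesis unfolding definable_def by (metis Un_subset_iff finite_Un)
qed

lemma definable_disj:
  assumes "definable P" "definable P'"
  shows "definable (\<lambda>e. P e \<or> P' e)"
proof -
  have "definable (\<lambda>e. \<not> (\<not> P e \<and> \<not> P' e))"
    by (intro definable_not definable_conj assms)
  then show ?thesis by simp
qed

lemma definable_imp:
  assumes "definable P" "definable P'"
  shows "definable (\<lambda>e. P e \<longrightarrow> P' e)"
  unfolding imp_conv_disj by (intro definable_disj definable_not assms)

lemma definable_less: "p \<in> polfun \<Longrightarrow> q \<in> polfun \<Longrightarrow> definable (\<lambda>e. p e < q e)"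
  by (drule (1) polfun_diff[of q p, rotated]) (drule definable_gt0, simp)

lemma definable_le: "p \<in> polfun \<Longrightarrow> q \<in> polfun \<Longrightarrow> definable (\<lambda>e. p e \<le> q e)"
  unfolding not_less[symmetric] by (intro definable_not definable_less)

lemma definable_eq: "p \<in> polfun \<Longrightarrow> q \<in> polfun \<Longrightarrow> definable (\<lambda>e. p e = q e)"
  by (drule (1) polfun_diff) (drule definable_eq0, simp)

lemma definable_ball: "finite A \<Longrightarrow> (\<And>i. i \<in> A \<Longrightarrow> definable (P i)) \<Longrightarrow> definable (\<lambda>e. \<forall>i\<in>A. P i e)"
  by (induction A rule: finite_induct) (auto intro: definable_const definable_conj)

lemma definable_subst:
  assumes "definable P" "\<And>v. (\<lambda>e. \<sigma> e v) \<in> polfun"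
  shows "definable (\<lambda>e. P (\<sigma> e))"
proof -
  obtain Q where Q: "finite Q" "Q \<subseteq> polfun" "\<And>e e'. sgn_eq Q e e' \<Longrightarrow> P e = P e'"
    using assms(1) by (auto simp: definable_def)
  have "sgn_eq Q (\<sigma> e) (\<sigma> e')" if "sgn_eq ((\<lambda>q e. q (\<sigma> e)) ` Q) e e'" for e e'
    using that by (auto simp: sgn_eq_def)
  moreover have "(\<lambda>e. q (\<sigma> e)) \<in> polfun" if "q \<in> Q" for q
    by (rule polfun_subst) (use that Q(2) assms(2) in auto)
  ultimately show ?thesis unfolding definable_def
    using Q by (intro exI[of _ "(\<lambda>q e. q (\<sigma> e)) ` Q"]) auto
qed

text \<open>A witness x over e is carried to the witness \<phi> x over e', where \<phi> is the order
  isomorphism that matches the signs of the defining polynomials, read as polynomials in the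
  variable v.\<close>

theorem definable_ex:
  fixes P :: "('v \<Rightarrow> 'r::real_closed_field) \<Rightarrow> bool"
  assumes "definable P"
  shows "definable (\<lambda>e. \<exists>x. P (e(v := x)))"
proof -
  obtain Q where Q: "finite Q" "Q \<subseteq> polfun" "\<And>e e'. sgn_eq Q e e' \<Longrightarrow> P e = P e'"
    using assms by (auto simp: definable_def)
  have "\<forall>q\<in>Q. \<exists>p. pp_ok p \<and> (\<forall>e x. q (e(v := x)) = poly (pp_at e p) x)"
  proof
    fix q assume "q \<in> Q"
    then have "q \<in> polfun" using Q(2) by blast
    then show "\<exists>p. pp_ok p \<and> (\<forall>e x. q (e(v := x)) = poly (pp_at e p) x)" by (rule polfun_expand)
  qed
  then obtain pp where pp0: "\<forall>q\<in>Q. pp_ok (pp q) \<and> (\<forall>e x. q (e(v := x)) = poly (pp_at e (pp q)) x)"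
    using bchoice by meson
  have pp: "pp_ok (pp q)" "q (e(v := x)) = poly (pp_at e (pp q)) x" if "q \<in> Q" for q e x
  proof -
    note q = bspec[OF pp0 that]
    show "pp_ok (pp q)" by (rule conjunct1[OF q])
    show "q (e(v := x)) = poly (pp_at e (pp q)) x" by (rule conjunct2[OF q, rule_format])
  qed
  obtain L where L: "set L = pp ` Q" by (rule finite_list[OF finite_imageI[OF Q(1), of pp], THEN exE])
  obtain Q' where Q': "finite Q'" "Q' \<subseteq> polfun" "\<And>e e'. sgn_eq Q' e e' \<Longrightarrow> \<exists>\<phi>. sgn_conj L e e' \<phi>"
    using pp_sgn_patterns[of L] pp(1) L by auto
  have "\<exists>x. P (e'(v := x))" if ee: "sgn_eq Q' e e'" "\<exists>x. P (e(v := x))" for e e'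
  proof -
    obtain \<phi> where "sgn_conj L e e' \<phi>" using Q'(3)[OF ee(1)] by blast
    then have "sgn_eq Q (e(v := x)) (e'(v := \<phi> x))" for x
      using L pp(2) by (auto simp: sgn_eq_def sgn_conj_def)
    then show ?thesis using Q(3) ee(2) by blast
  qed
  moreover have "sgn_eq Q' e e' \<Longrightarrow> sgn_eq Q' e' e" for e e' by (simp add: sgn_eq_def)
  ultimately show ?thesis unfolding definable_def using Q'(1,2) by (intro exI[of _ Q']) blast
qed

section \<open>Definable sets\<close>

subsection \<open>Quantification over finitely many coordinates\<close>

lemma definable_ex_on:
  fixes P :: "('v \<Rightarrow> 'r::real_closed_field) \<Rightarrow> bool"
  assumes "finite F" "definable P"
  shows "definable (\<lambda>e. \<exists>f. (\<forall>v. v \<notin> F \<longrightarrow> f v = e v) \<and> P f)"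
  using assms(1)
proof induction
  case empty
  have "(\<exists>f. (\<forall>v. v \<notin> {} \<longrightarrow> f v = e v) \<and> P f) \<longleftrightarrow> P e" for e
    by (auto simp flip: fun_eq_iff)
  then show ?case using assms(2) by simp
next
  case (insert v F)
  have "(\<exists>f. (\<forall>w. w \<notin> insert v F \<longrightarrow> f w = e w) \<and> P f)
    \<longleftrightarrow> (\<exists>x f. (\<forall>w. w \<notin> F \<longrightarrow> f w = (e(v := x)) w) \<and> P f)" for e
  proof
    assume "\<exists>f. (\<forall>w. w \<notin> insert v F \<longrightarrow> f w = e w) \<and> P f"
    then obtain f where "\<forall>w. w \<notin> insert v F \<longrightarrow> f w = e w" "P f" by blast
    then show "\<exists>x f. (\<forall>w. w \<notin> F \<longrightarrow> f w = (e(v := x)) w) \<and> P f"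
      by (intro exI[of _ "f v"] exI[of _ f]) auto
  next
    assume "\<exists>x f. (\<forall>w. w \<notin> F \<longrightarrow> f w = (e(v := x)) w) \<and> P f"
    then obtain x f where "\<forall>w. w \<notin> F \<longrightarrow> f w = (e(v := x)) w" "P f" by blast
    then show "\<exists>f. (\<forall>w. w \<notin> insert v F \<longrightarrow> f w = e w) \<and> P f"
      by (intro exI[of _ f]) auto
  qed
  then show ?case using definable_ex[OF insert.IH, of v] by presburger
qed

text \<open>Free and bound variables live in the two summands of the variable type. Bound variables
  outside the finite set \<open>F\<close> are pinned to 0, so that only finitely many coordinates
  are quantified even if \<open>'b\<close> is infinite.\<close>

lemma definable_ex_fun:
  fixes P :: "('a + 'b \<Rightarrow> 'r::real_closed_field) \<Rightarrow> bool"
  assumes "finite F" "definable P"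
  shows "definable (\<lambda>e. \<exists>f. (\<forall>b. b \<notin> F \<longrightarrow> f b = 0) \<and> P (case_sum e f))"
proof -
  have eq: "(\<exists>f. (\<forall>b. b \<notin> F \<longrightarrow> f b = 0) \<and> P (case_sum e f)) \<longleftrightarrow>
    (\<exists>f. (\<forall>v. v \<notin> Inr ` F \<longrightarrow> f v = (case_sum e (\<lambda>_. 0)) v) \<and> P f)" for e
  proof
    assume "\<exists>f. (\<forall>b. b \<notin> F \<longrightarrow> f b = 0) \<and> P (case_sum e f)"
    then obtain f where "\<forall>b. b \<notin> F \<longrightarrow> f b = 0" "P (case_sum e f)" by blast
    then show "\<exists>f. (\<forall>v. v \<notin> Inr ` F \<longrightarrow> f v = (case_sum e (\<lambda>_. 0)) v) \<and> P f"
      by (intro exI[of _ "case_sum e f"]) (auto split: sum.splits)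
  next
    assume "\<exists>f. (\<forall>v. v \<notin> Inr ` F \<longrightarrow> f v = (case_sum e (\<lambda>_. 0)) v) \<and> P f"
    then obtain f where f: "\<forall>v. v \<notin> Inr ` F \<longrightarrow> f v = (case_sum e (\<lambda>_. 0)) v" "P f" by blast
    have "f (Inl a) = e a" for a using f(1) by auto
    then have "case_sum e (f \<circ> Inr) = f" by (auto simp: fun_eq_iff split: sum.splits)
    moreover have "b \<notin> F \<Longrightarrow> (f \<circ> Inr) b = 0" for b using f(1) by (auto dest!: spec[of _ "Inr b"])
    ultimately show "\<exists>f. (\<forall>b. b \<notin> F \<longrightarrow> f b = 0) \<and> P (case_sum e f)"
      using f(2) by (intro exI[of _ "f \<circ> Inr"]) simp
  qed
  have "definable (\<lambda>e. \<exists>f. (\<forall>v. v \<notin> Inr ` F \<longrightarrow> f v = e v) \<and> P f)"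
    by (rule definable_ex_on) (use assms in auto)
  moreover have "(\<lambda>e. case_sum e (\<lambda>_. 0) v) \<in> polfun" for v :: "'a + 'b"
    by (cases v) (auto intro: polfun_intros)
  ultimately show ?thesis unfolding eq by (rule definable_subst)
qed

lemma definable_all_fun:
  fixes P :: "('a + 'b \<Rightarrow> 'r::real_closed_field) \<Rightarrow> bool"
  assumes "finite F" "definable P"
  shows "definable (\<lambda>e. \<forall>f. (\<forall>b. b \<notin> F \<longrightarrow> f b = 0) \<longrightarrow> P (case_sum e f))"
proof -
  have "definable (\<lambda>e. \<not> (\<exists>f. (\<forall>b. b \<notin> F \<longrightarrow> f b = 0) \<and> \<not> P (case_sum e f)))"
    by (intro definable_not definable_ex_fun[of F "\<lambda>e. \<not> P e"] assms)
  then show ?thesis by (simp only: not_ex de_Morgan_conj not_not imp_conv_disj)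
qed

subsection \<open>Definable completeness\<close>

text \<open>Membership in D is constant on every interval free of the finitely many roots
  \<open>Z\<close>, so D is a finite union of points and intervals. This is the completeness that
  survives in a real closed field.\<close>

lemma definable_infimum:
  fixes P :: "('v \<Rightarrow> 'r::real_closed_field) \<Rightarrow> bool"
  assumes "definable P" "P (e(v := x0))" "\<And>x. P (e(v := x)) \<Longrightarrow> b \<le> x"
  shows "\<exists>z. (\<forall>x. P (e(v := x)) \<longrightarrow> z \<le> x) \<and> (\<forall>\<epsilon>>0. \<exists>x. P (e(v := x)) \<and> x < z + \<epsilon>)"
proof -
  define D where "D = {x. P (e(v := x))}"
  obtain Q where Q: "finite Q" "Q \<subseteq> polfun" "\<And>e e'. sgn_eq Q e e' \<Longrightarrow> P e = P e'"
    using assms(1) by (auto simp: definable_def)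
  have "\<exists>p. \<forall>x. q (e(v := x)) = poly p x" if "q \<in> Q" for q
    using polfun_expand[of q v] that Q(2) by blast
  then have "\<exists>p. \<forall>q\<in>Q. \<forall>x. q (e(v := x)) = poly (p q) x" by (intro bchoice) blast
  then obtain p where p: "\<forall>q\<in>Q. \<forall>x. q (e(v := x)) = poly (p q) x" by blast
  define Z where "Z = (\<Union>q\<in>{q\<in>Q. p q \<noteq> 0}. {z. poly (p q) z = 0})"
  have finZ: "finite Z" using Q(1) by (auto simp: Z_def poly_roots_finite)
  have same: "x \<in> D \<longleftrightarrow> y \<in> D" if "x \<le> y" "\<And>z. x \<le> z \<Longrightarrow> z \<le> y \<Longrightarrow> z \<notin> Z" for x y
  proof -
    have "sgn (poly (p q) x) = sgn (poly (p q) y)" if "q \<in> Q" for q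
    proof (cases "p q = 0")
      case False
      then have "poly (p q) z = 0 \<Longrightarrow> z \<in> Z" for z using \<open>q \<in> Q\<close> by (auto simp: Z_def)
      then show ?thesis using \<open>x \<le> y\<close> \<open>\<And>z. x \<le> z \<Longrightarrow> z \<le> y \<Longrightarrow> z \<notin> Z\<close>
        by (intro rcf_poly_sgn_const) auto
    qed simp
    then have "sgn_eq Q (e(v := x)) (e(v := y))" using p by (simp add: sgn_eq_def del: fun_upd_apply)
    then show ?thesis using Q(3) by (auto simp: D_def)
  qed
  have "\<exists>x. x \<in> D" using assms(2) by (auto simp: D_def)
  \<comment> \<open>A point of D with the fewest roots at or below it; the last of these roots will
    be the infimum.\<close>
  then obtain x where x: "x \<in> D" "\<And>y. y \<in> D \<Longrightarrow> card {z \<in> Z. z \<le> x} \<le> card {z \<in> Z. z \<le> y}"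
    using ex_has_least_nat[of "\<lambda>x. x \<in> D" _ "\<lambda>x. card {z \<in> Z. z \<le> x}"] by blast
  have "{z \<in> Z. z \<le> x} \<noteq> {}"
  proof
    assume empty: "{z \<in> Z. z \<le> x} = {}"
    \<comment> \<open>Without a root at or below x, membership would extend down past the lower
      bound b.\<close>
    have "min x (b - 1) \<in> D \<longleftrightarrow> x \<in> D" by (rule same) (use empty in auto)
    then show False using x(1) assms(3)[of "min x (b - 1)"] by (simp add: D_def)
  qed
  define z where "z = Max {z \<in> Z. z \<le> x}"
  have z: "z \<in> {z \<in> Z. z \<le> x}" unfolding z_def using finZ \<open>_ \<noteq> {}\<close> by (intro Max_in) auto
  have zmax: "w \<le> z" if "w \<in> Z" "w \<le> x" for w unfolding z_def using finZ that by (intro Max_ge) auto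
  have "z \<le> y" if "y \<in> D" for y
  proof (rule ccontr)
    assume "\<not> z \<le> y"
    then have "{w \<in> Z. w \<le> y} \<subset> {w \<in> Z. w \<le> x}" using z by force
    then have "card {w \<in> Z. w \<le> y} < card {w \<in> Z. w \<le> x}" using finZ by (intro psubset_card_mono) auto
    then show False using x(2)[OF that] by simp
  qed
  moreover have "\<exists>y. y \<in> D \<and> y < z + \<epsilon>" if \<epsilon>: "\<epsilon> > 0" for \<epsilon>
  proof (cases "z = x")
    case True
    then show ?thesis using x \<epsilon> by (intro exI[of _ x]) auto
  next
    case False
    define y where "y = min x (z + \<epsilon> / 2)"
    have y: "z < y" "y \<le> x" "y < z + \<epsilon>" using False z \<epsilon> by (auto simp: y_def min_less_iff_disj)
    have "y \<in> D \<longleftrightarrow> x \<in> D" by (rule same) (use y zmax in force)+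
    then show ?thesis using x y by blast
  qed
  ultimately show ?thesis by (auto simp: D_def)
qed

text \<open>Distances are measured in the coordinates of \<open>F\<close> only. Consequently a
  closed predicate cannot depend on any other coordinate, see \<open>closed_on_cong\<close>.\<close>

definition closed_on :: "'v set \<Rightarrow> (('v \<Rightarrow> 'r::linordered_field) \<Rightarrow> bool) \<Rightarrow> bool" where
  "closed_on F P \<longleftrightarrow> (\<forall>x. (\<forall>\<epsilon>>0. \<exists>y. P y \<and> (\<forall>i\<in>F. \<bar>x i - y i\<bar> < \<epsilon>)) \<longrightarrow> P x)"

lemma closed_on_cong: "closed_on F P \<Longrightarrow> P y \<Longrightarrow> (\<And>i. i \<in> F \<Longrightarrow> x i = y i) \<Longrightarrow> P x"
  unfolding closed_on_def by force

lemma closed_on_ball: "(\<And>j. j \<in> J \<Longrightarrow> closed_on F (P j)) \<Longrightarrow> closed_on F (\<lambda>x. \<forall>j\<in>J. P j x)"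
  unfolding closed_on_def by meson

lemma closed_on_conj: "closed_on F P \<Longrightarrow> closed_on F Q \<Longrightarrow> closed_on F (\<lambda>x. P x \<and> Q x)"
  unfolding closed_on_def by meson

lemma polfun_continuous:
  fixes q :: "('v \<Rightarrow> 'r::linordered_field) \<Rightarrow> 'r"
  assumes "q \<in> polfun"
  shows "\<forall>\<epsilon>>0. \<exists>\<delta>>0. \<forall>y. (\<forall>i. \<bar>x i - y i\<bar> < \<delta>) \<longrightarrow> \<bar>q x - q y\<bar> < \<epsilon>"
  using assms
proof induction
  case (polfun_const c)
  then show ?case by (auto intro: exI[of _ 1])
next
  case (polfun_var v)
  then show ?case by blast
next
  case (polfun_add p q)
  show ?case
  proof (intro allI impI)
    fix \<epsilon> :: 'r assume "\<epsilon> > 0"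
    then have "\<epsilon> / 2 > 0" by simp
    obtain d1 where d1: "d1 > 0" "\<And>y. (\<forall>i. \<bar>x i - y i\<bar> < d1) \<Longrightarrow> \<bar>p x - p y\<bar> < \<epsilon> / 2"
      using polfun_add.IH(1) \<open>\<epsilon> / 2 > 0\<close> by blast
    obtain d2 where d2: "d2 > 0" "\<And>y. (\<forall>i. \<bar>x i - y i\<bar> < d2) \<Longrightarrow> \<bar>q x - q y\<bar> < \<epsilon> / 2"
      using polfun_add.IH(2) \<open>\<epsilon> / 2 > 0\<close> by blast
    have "\<bar>(p x + q x) - (p y + q y)\<bar> < \<epsilon>" if "\<forall>i. \<bar>x i - y i\<bar> < min d1 d2" for y
    proof -
      have "\<bar>p x - p y\<bar> < \<epsilon> / 2" "\<bar>q x - q y\<bar> < \<epsilon> / 2" using d1(2) d2(2) that by simp_all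
      moreover have "\<bar>(p x + q x) - (p y + q y)\<bar> \<le> \<bar>p x - p y\<bar> + \<bar>q x - q y\<bar>"
        using abs_triangle_ineq[of "p x - p y" "q x - q y"] by (simp add: algebra_simps)
      ultimately show ?thesis by (simp add: field_simps)
    qed
    then show "\<exists>\<delta>>0. \<forall>y. (\<forall>i. \<bar>x i - y i\<bar> < \<delta>) \<longrightarrow> \<bar>(p x + q x) - (p y + q y)\<bar> < \<epsilon>"
      using d1(1) d2(1) by (intro exI[of _ "min d1 d2"]) auto
  qed
next
  case (polfun_mult p q)
  show ?case
  proof (intro allI impI)
    fix \<epsilon> :: 'r assume \<epsilon>: "\<epsilon> > 0"
    \<comment> \<open>If both factors move by less than \<eta> \<le> 1, the product moves by less
      than \<eta> times the sum of the two absolute values and 1.\<close>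
    define M where "M = \<bar>p x\<bar> + \<bar>q x\<bar> + 1"
    have M: "M > 0" by (simp add: M_def add_nonneg_pos)
    define \<eta> where "\<eta> = min 1 (\<epsilon> / M)"
    have \<eta>: "\<eta> > 0" "\<eta> \<le> 1" "\<eta> * M \<le> \<epsilon>" using \<epsilon> M by (auto simp: \<eta>_def field_simps min_def)
    obtain d1 where d1: "d1 > 0" "\<And>y. (\<forall>i. \<bar>x i - y i\<bar> < d1) \<Longrightarrow> \<bar>p x - p y\<bar> < \<eta>"
      using polfun_mult.IH(1) \<eta>(1) by blast
    obtain d2 where d2: "d2 > 0" "\<And>y. (\<forall>i. \<bar>x i - y i\<bar> < d2) \<Longrightarrow> \<bar>q x - q y\<bar> < \<eta>"
      using polfun_mult.IH(2) \<eta>(1) by blast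
    have "\<bar>p x * q x - p y * q y\<bar> < \<epsilon>" if "\<forall>i. \<bar>x i - y i\<bar> < min d1 d2" for y
    proof -
      have a: "\<bar>p x - p y\<bar> < \<eta>" and b: "\<bar>q x - q y\<bar> < \<eta>" using d1(2) d2(2) that by simp_all
      have "p x * q x - p y * q y = (p x - p y) * q x + p x * (q x - q y) - (p x - p y) * (q x - q y)"
        by (simp add: algebra_simps)
      then have "\<bar>p x * q x - p y * q y\<bar>
          \<le> \<bar>p x - p y\<bar> * \<bar>q x\<bar> + \<bar>p x\<bar> * \<bar>q x - q y\<bar> + \<bar>p x - p y\<bar> * \<bar>q x - q y\<bar>"
        using abs_triangle_ineq4[of "(p x - p y) * q x + p x * (q x - q y)" "(p x - p y) * (q x - q y)"]
          abs_triangle_ineq[of "(p x - p y) * q x" "p x * (q x - q y)"] by (simp add: abs_mult)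
      also have "\<dots> \<le> \<eta> * \<bar>q x\<bar> + \<bar>p x\<bar> * \<eta> + \<bar>p x - p y\<bar> * 1"
        using a b \<eta> by (intro add_mono mult_mono) auto
      also have "\<dots> < \<eta> * M" using a by (simp add: M_def algebra_simps)
      finally show ?thesis using \<eta>(3) by simp
    qed
    then show "\<exists>\<delta>>0. \<forall>y. (\<forall>i. \<bar>x i - y i\<bar> < \<delta>) \<longrightarrow> \<bar>p x * q x - p y * q y\<bar> < \<epsilon>"
      using d1(1) d2(1) by (intro exI[of _ "min d1 d2"]) auto
  qed
qed

lemma closed_on_nonneg:
  fixes q :: "('v \<Rightarrow> 'r::linordered_field) \<Rightarrow> 'r"
  assumes "q \<in> polfun" and dep: "\<And>x y. (\<And>i. i \<in> F \<Longrightarrow> x i = y i) \<Longrightarrow> q x = q y"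
  shows "closed_on F (\<lambda>x. 0 \<le> q x)"
  unfolding closed_on_def
proof (intro allI impI, rule ccontr)
  fix x assume ap: "\<forall>\<epsilon>>0. \<exists>y. 0 \<le> q y \<and> (\<forall>i\<in>F. \<bar>x i - y i\<bar> < \<epsilon>)" and "\<not> 0 \<le> q x"
  then have "- q x > 0" by simp
  then obtain \<delta> where \<delta>: "\<delta> > 0" "\<And>y. (\<forall>i. \<bar>x i - y i\<bar> < \<delta>) \<Longrightarrow> \<bar>q x - q y\<bar> < - q x"
    using polfun_continuous[OF assms(1), of x] by blast
  obtain y where y: "0 \<le> q y" "\<forall>i\<in>F. \<bar>x i - y i\<bar> < \<delta>" using ap \<delta>(1) by blast
  define y' where "y' i = (if i \<in> F then y i else x i)" for i
  have "q y' = q y" by (rule dep) (simp add: y'_def)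
  moreover have "\<bar>q x - q y'\<bar> < - q x" using y \<delta> by (intro \<delta>(2)) (auto simp: y'_def)
  ultimately show False using y(1) by (simp add: abs_less_iff)
qed

text \<open>Definable substitute for compactness. The coordinates in \<open>K\<close>, on which the
  approximations are unconstrained, receive limits one after another: each gets the limit superior
  of its values over the approximations, an infimum that exists by \<open>definable_infimum\<close>
  and boundedness. When no free coordinate remains, closedness applies.\<close>

lemma definable_projection_closed:
  fixes P :: "('v \<Rightarrow> 'r::real_closed_field) \<Rightarrow> bool"
  assumes fin: "finite F" and def: "definable P" and cl: "closed_on F P"
    and bd: "\<And>y i. P y \<Longrightarrow> i \<in> F \<Longrightarrow> \<bar>y i\<bar> \<le> B"
    and "finite K" and "K \<subseteq> F"
    and "\<And>\<epsilon>. \<epsilon> > 0 \<Longrightarrow> \<exists>y. P y \<and> (\<forall>i\<in>F - K. \<bar>x i - y i\<bar> < \<epsilon>)"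
  shows "\<exists>y. P y \<and> (\<forall>i\<in>F - K. y i = x i)"
  using assms(5-7)
proof (induction K arbitrary: x)
  case empty
  then have "P x" using cl unfolding closed_on_def by auto
  then show ?case by blast
next
  case (insert u K)
  define J where "J = F - insert u K"
  have J: "F - K = insert u J" "finite J" "J \<subseteq> F" "u \<in> F" "u \<notin> J" using insert fin by (auto simp: J_def)
  have ap: "\<exists>y. P y \<and> (\<forall>i\<in>J. \<bar>x i - y i\<bar> < \<epsilon>)" if "\<epsilon> > 0" for \<epsilon>
    using insert.prems(2)[OF that] by (simp add: J_def)
  \<comment> \<open>Here c bounds the coordinate u for all sufficiently good approximations; the
    infimum of such c is the limit superior.\<close>
  define D where "D c \<longleftrightarrow> (\<exists>\<epsilon>>0. \<forall>y. P y \<and> (\<forall>i\<in>J. \<bar>x i - y i\<bar> < \<epsilon>) \<longrightarrow> y u < c)" for c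
  \<comment> \<open>\<open>D\<close> has to be exhibited as definable: of the two
    \<open>bool\<close>-indexed variables, \<open>True\<close> holds the bound c and
    \<open>False\<close> the precision \<epsilon>.\<close>
  define Q :: "(bool + 'v \<Rightarrow> 'r) \<Rightarrow> bool" where
    "Q h \<longleftrightarrow> P (\<lambda>v. h (Inr v)) \<and> (\<forall>i\<in>J. x i - h (Inr i) < h (Inl False) \<and> h (Inr i) - x i < h (Inl False)) \<and>
      h (Inl True) \<le> h (Inr u)" for h
  define R :: "(bool \<Rightarrow> 'r) \<Rightarrow> bool" where
    "R e \<longleftrightarrow> (\<exists>\<epsilon>. 0 < (e(False := \<epsilon>)) False \<and> \<not> (\<exists>f. (\<forall>v. v \<notin> F \<longrightarrow> f v = 0) \<and> Q (case_sum (e(False := \<epsilon>)) f)))"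
        for e
  have "definable Q" unfolding Q_def
    by (intro definable_conj definable_ball definable_subst[OF def]
        definable_less definable_le polfun_intros J(2))
  then have "definable R" unfolding R_def
    by (intro definable_ex[of "\<lambda>e. 0 < e False \<and> \<not> (\<exists>f. (\<forall>v. v \<notin> F \<longrightarrow> f v = 0) \<and> Q (case_sum e f))"]
        definable_conj definable_not definable_ex_fun definable_gt0 polfun_intros fin)
  have RD: "R (e(True := c)) \<longleftrightarrow> D c" for e c
  proof -
    have "(\<exists>f. (\<forall>v. v \<notin> F \<longrightarrow> f v = 0) \<and> Q (case_sum ((e(True := c))(False := \<epsilon>)) f)) \<longleftrightarrow>
       \<not> (\<forall>y. P y \<and> (\<forall>i\<in>J. \<bar>x i - y i\<bar> < \<epsilon>) \<longrightarrow> y u < c)" (is "?l \<longleftrightarrow> ?r") for \<epsilon>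
    proof
      assume ?r
      then obtain y where y: "P y" "\<forall>i\<in>J. \<bar>x i - y i\<bar> < \<epsilon>" "c \<le> y u" by (auto simp: not_less)
      define f where "f v = (if v \<in> F then y v else 0)" for v
      have "P f" by (rule closed_on_cong[OF cl y(1)]) (simp add: f_def)
      moreover have "f i = y i" if "i \<in> F" for i using that by (simp add: f_def)
      moreover have "\<forall>v. v \<notin> F \<longrightarrow> f v = 0" by (simp add: f_def)
      ultimately show ?l using y J by (intro exI[of _ f]) (auto simp: Q_def abs_less_iff subset_eq)
    qed (auto simp: Q_def not_less abs_less_iff)
    then show ?thesis unfolding R_def D_def by (simp only: fun_upd_same not_not)
  qed
  have "D (B + 1)" unfolding D_def
    using bd J(4) by (intro exI[of _ 1]) (fastforce simp: abs_le_iff)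
  moreover have "- B \<le> c" if Dc: "D c" for c
  proof -
    obtain \<epsilon> where e: "\<epsilon> > 0" "\<And>y. P y \<and> (\<forall>i\<in>J. \<bar>x i - y i\<bar> < \<epsilon>) \<Longrightarrow> y u < c" using Dc by (auto simp: D_def)
    obtain y where "P y \<and> (\<forall>i\<in>J. \<bar>x i - y i\<bar> < \<epsilon>)" using ap[OF e(1)] by blast
    then have "y u < c" "\<bar>y u\<bar> \<le> B" using e(2) bd J(4) by blast+
    then show ?thesis by (simp add: abs_le_iff)
  qed
  ultimately obtain z where z: "\<And>c. D c \<Longrightarrow> z \<le> c" "\<And>\<epsilon>. \<epsilon> > 0 \<Longrightarrow> \<exists>c. D c \<and> c < z + \<epsilon>"
    using definable_infimum[OF \<open>definable R\<close>, of "\<lambda>_. 0" True "B + 1" "- B"] unfolding RD by blast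
  have "\<exists>y. P y \<and> (\<forall>i\<in>F - K. \<bar>(x(u := z)) i - y i\<bar> < \<epsilon>)" if \<epsilon>: "\<epsilon> > 0" for \<epsilon>
  proof -
    obtain c where c: "D c" "c < z + \<epsilon>" using z(2)[OF \<epsilon>] by blast
    then obtain \<epsilon>0 where e0: "\<epsilon>0 > 0" "\<And>y. P y \<Longrightarrow> (\<forall>i\<in>J. \<bar>x i - y i\<bar> < \<epsilon>0) \<Longrightarrow> y u < c"
      by (auto simp: D_def)
    have "\<not> D (z - \<epsilon> / 2)" using z(1)[of "z - \<epsilon> / 2"] \<epsilon> by auto
    moreover have "min \<epsilon> \<epsilon>0 > 0" using \<epsilon> e0 by simp
    ultimately obtain y where y: "P y" "\<forall>i\<in>J. \<bar>x i - y i\<bar> < min \<epsilon> \<epsilon>0" "\<not> y u < z - \<epsilon> / 2"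
      unfolding D_def by blast
    have "y u < c" using e0(2)[OF y(1)] y(2) by simp
    then have "\<bar>z - y u\<bar> < \<epsilon>" using y(3) c \<epsilon> by (simp add: abs_less_iff field_simps)
    then show ?thesis using y J by (intro exI[of _ y]) auto
  qed
  then obtain y where y: "P y" "\<forall>i\<in>F - K. y i = (x(u := z)) i"
    using insert.IH[of "x(u := z)"] insert.prems(1) by blast
  have "\<forall>i\<in>F - insert u K. y i = x i" using y(2) by auto
  then show ?case using y(1) by blast
qed

text \<open>The values of the coordinate \<open>u\<close> have an infimum z that they approach;
  \<open>definable_projection_closed\<close>, with all other coordinates free, shows that z is
  itself a value.\<close>

theorem definable_attains_min:
  fixes P :: "('v \<Rightarrow> 'r::real_closed_field) \<Rightarrow> bool"
  assumes fin: "finite F" and def: "definable P" and cl: "closed_on F P"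
    and bd: "\<And>y i. P y \<Longrightarrow> i \<in> F \<Longrightarrow> \<bar>y i\<bar> \<le> B"
    and ne: "P y0" and u: "u \<in> F"
  shows "\<exists>y. P y \<and> (\<forall>y'. P y' \<longrightarrow> y u \<le> y' u)"
proof -
  define Q :: "(unit + 'v \<Rightarrow> 'r) \<Rightarrow> bool" where "Q h \<longleftrightarrow> P (\<lambda>v. h (Inr v)) \<and> h (Inr u) = h (Inl ())" for h
  define R :: "(unit \<Rightarrow> 'r) \<Rightarrow> bool" where
    "R e \<longleftrightarrow> (\<exists>f. (\<forall>v. v \<notin> F \<longrightarrow> f v = 0) \<and> Q (case_sum e f))" for e
  have "definable Q" unfolding Q_def
    by (intro definable_conj definable_subst[OF def] definable_eq polfun_intros)
  then have "definable R" unfolding R_def by (intro definable_ex_fun fin)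
  have R: "R (e(() := c)) \<longleftrightarrow> (\<exists>y. P y \<and> y u = c)" (is "_ = ?r") for e c
  proof
    assume ?r
    then obtain y where y: "P y" "y u = c" by blast
    define f where "f v = (if v \<in> F then y v else 0)" for v
    have "P f" by (rule closed_on_cong[OF cl y(1)]) (simp add: f_def)
    moreover have "f u = c" using y u by (simp add: f_def)
    moreover have "\<forall>v. v \<notin> F \<longrightarrow> f v = 0" by (simp add: f_def)
    ultimately show "R (e(() := c))" unfolding R_def by (intro exI[of _ f]) (auto simp: Q_def)
  qed (auto simp: R_def Q_def)
  have "R ((\<lambda>_. 0)(() := y0 u))" unfolding R using ne by blast
  moreover have "- B \<le> c" if Rc: "R ((\<lambda>_. 0)(() := c))" for c
  proof -
    obtain y where "P y" "y u = c" using Rc unfolding R by blast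
    then show ?thesis using bd[of y u] u by (simp add: abs_le_iff minus_le_iff)
  qed
  ultimately have "\<exists>z. (\<forall>c. R ((\<lambda>_. 0)(() := c)) \<longrightarrow> z \<le> c) \<and> (\<forall>\<epsilon>>0. \<exists>c. R ((\<lambda>_. 0)(() := c)) \<and> c < z + \<epsilon>)"
    by (rule definable_infimum[OF \<open>definable R\<close>])
  then obtain z where z0: "\<forall>c. (\<exists>y. P y \<and> y u = c) \<longrightarrow> z \<le> c"
    "\<forall>\<epsilon>>0. \<exists>c. (\<exists>y. P y \<and> y u = c) \<and> c < z + \<epsilon>" unfolding R by blast
  then have z: "\<And>y. P y \<Longrightarrow> z \<le> y u" "\<And>\<epsilon>. \<epsilon> > 0 \<Longrightarrow> \<exists>y. P y \<and> y u < z + \<epsilon>" by blast+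
  have Fu: "F - (F - {u}) = {u}" using u by auto
  have "\<exists>y. P y \<and> (\<forall>i\<in>F - (F - {u}). \<bar>z - y i\<bar> < \<epsilon>)" if \<epsilon>: "\<epsilon> > 0" for \<epsilon>
  proof -
    obtain y where y: "P y" "y u < z + \<epsilon>" using z(2)[OF \<epsilon>] by blast
    then have "\<bar>z - y u\<bar> < \<epsilon>" using z(1)[OF y(1)] \<epsilon> by (auto simp: abs_if)
    then show ?thesis using y(1) unfolding Fu by blast
  qed
  then have "\<exists>y. P y \<and> (\<forall>i\<in>F - (F - {u}). y i = z)"
    by (intro definable_projection_closed[of F P B "F - {u}" "\<lambda>_. z"] fin def cl bd) (use fin in auto)
  then obtain y where "P y" "y u = z" unfolding Fu by auto
  then show ?thesis using z(1) by blast
qed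

subsection \<open>Fixed points of bounded definable groups\<close>

text \<open>Cauchy-Schwarz against the constant vector 1.\<close>

lemma square_sum_le:
  fixes u :: "'i \<Rightarrow> 'r::linordered_field"
  assumes "finite I"
  shows "(\<Sum>i\<in>I. u i) ^ 2 \<le> of_nat (card I) * (\<Sum>i\<in>I. u i ^ 2)"
proof -
  have "0 \<le> (\<Sum>i\<in>I. \<Sum>j\<in>I. (u i - u j) ^ 2)" by (intro sum_nonneg) auto
  also have "\<dots> = (\<Sum>i\<in>I. \<Sum>j\<in>I. u i ^ 2 + u j ^ 2 - 2 * (u i * u j))"
    by (intro sum.cong refl) (simp add: power2_eq_square algebra_simps)
  also have "\<dots> = 2 * (of_nat (card I) * (\<Sum>i\<in>I. u i ^ 2)) - 2 * (\<Sum>i\<in>I. u i) ^ 2"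
    by (simp add: sum.distrib sum_subtractf sum_distrib_left[symmetric] sum_distrib_right[symmetric]
        power2_eq_square)
  finally show ?thesis by simp
qed

text \<open>Over the closed convex set minimise the largest norm of a point of the orbit.  By the
  parallelogram identity the minimiser is unique, hence fixed.\<close>

theorem definable_group_fixed_point:
  fixes S :: "('g::finite \<Rightarrow> 'r::real_closed_field) set"
    and A :: "'i \<Rightarrow> 'i \<Rightarrow> ('g \<Rightarrow> 'r) \<Rightarrow> 'r" and K :: "('i \<Rightarrow> 'r) \<Rightarrow> bool"
    and act :: "('g \<Rightarrow> 'r) \<Rightarrow> ('i \<Rightarrow> 'r) \<Rightarrow> 'i \<Rightarrow> 'r"
  assumes act: "\<And>g x i. act g x i = (\<Sum>j\<in>I. A i j g * x j)"
    and I: "finite I" and S: "definable (\<lambda>g. g \<in> S)" "S \<noteq> {}" and A: "\<And>i j. A i j \<in> polfun"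
    and K: "definable K" "closed_on I K" "K x0" "\<And>x y. K x \<Longrightarrow> K y \<Longrightarrow> K (\<lambda>i. (x i + y i) / 2)"
    and stable: "\<And>g x. g \<in> S \<Longrightarrow> K x \<Longrightarrow> K (act g x)"
    and bd: "\<And>g i j. g \<in> S \<Longrightarrow> i \<in> I \<Longrightarrow> j \<in> I \<Longrightarrow> \<bar>A i j g\<bar> \<le> B"
    and mult: "\<And>g h. g \<in> S \<Longrightarrow> h \<in> S \<Longrightarrow> \<exists>k\<in>S. \<forall>x. \<forall>i\<in>I. act h (act g x) i = act k x i"
    and inv: "\<And>g. g \<in> S \<Longrightarrow> \<exists>h\<in>S. \<forall>x. \<forall>i\<in>I. act h (act g x) i = x i"
  shows "\<exists>x. K x \<and> (\<forall>g\<in>S. \<forall>i\<in>I. act g x i = x i)"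
proof -
  define N :: "('i \<Rightarrow> 'r) \<Rightarrow> 'r" where "N x = (\<Sum>i\<in>I. x i ^ 2)" for x
  have N0: "0 \<le> N x" for x by (simp add: N_def sum_nonneg)
  have Ncong: "N x = N y" if "\<And>i. i \<in> I \<Longrightarrow> x i = y i" for x y using that by (simp add: N_def)
  define n :: 'r where "n = of_nat (card I)"
  \<comment> \<open>Bounds the squared operator norm: by Cauchy-Schwarz each of the n coordinates of
    \<open>act g x\<close> has square at most n B^2 N(x).\<close>
  define M where "M = n * (n * B ^ 2)"
  have M0: "0 \<le> M" by (simp add: M_def n_def)
  have NM: "N (act g x) \<le> M * N x" if g: "g \<in> S" for g x
  proof -
    have "act g x i ^ 2 \<le> n * B ^ 2 * N x" if i: "i \<in> I" for i
    proof -
      have "act g x i ^ 2 \<le> n * (\<Sum>j\<in>I. (A i j g * x j) ^ 2)"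
        unfolding act n_def by (rule square_sum_le[OF I])
      also have "\<dots> \<le> n * (\<Sum>j\<in>I. B ^ 2 * x j ^ 2)"
      proof (intro mult_left_mono sum_mono)
        fix j assume "j \<in> I"
        then have "A i j g ^ 2 \<le> B ^ 2" using bd[OF g i] by (metis abs_ge_zero power2_abs power_mono)
        then show "(A i j g * x j) ^ 2 \<le> B ^ 2 * x j ^ 2"
          unfolding power_mult_distrib by (intro mult_right_mono) auto
      qed (simp add: n_def)
      finally show ?thesis by (simp add: N_def sum_distrib_left mult.assoc)
    qed
    then have "N (act g x) \<le> (\<Sum>i\<in>I. n * B ^ 2 * N x)" unfolding N_def[of "act g x"] by (rule sum_mono)
    then show ?thesis by (simp add: M_def n_def mult.assoc)
  qed
  obtain one where one: "one \<in> S" "\<And>x i. i \<in> I \<Longrightarrow> act one x i = x i"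
    using S(2) inv mult by (metis ex_in_conv)
  define C where "C = M * N x0"
  have C0: "0 \<le> C" using M0 N0 by (simp add: C_def)
  \<comment> \<open>The largest norm on an orbit becomes a coordinate: \<open>e None\<close> is any
    bound for the norms on the orbit of the point stored under \<open>Some\<close>. Minimising this
    coordinate avoids suprema, and the cap \<open>C\<close>, which admits \<open>x0\<close>, makes
    the set bounded.\<close>
  define D :: "('i option \<Rightarrow> 'r) \<Rightarrow> bool" where
    "D e \<longleftrightarrow> K (\<lambda>i. e (Some i)) \<and> (\<forall>g\<in>S. 0 \<le> e None - N (act g (\<lambda>i. e (Some i)))) \<and> 0 \<le> C - e None" for e
  define F where "F = insert None (Some ` I)"
  have finF: "finite F" using I by (simp add: F_def)
  have "definable D"
  proof -
    define P :: "('i option + 'g \<Rightarrow> 'r) \<Rightarrow> bool" where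
      "P h \<longleftrightarrow> ((\<lambda>v. h (Inr v)) \<in> S \<longrightarrow>
        (\<Sum>i\<in>I. (\<Sum>j\<in>I. A i j (\<lambda>v. h (Inr v)) * h (Inl (Some j))) ^ 2) \<le> h (Inl None))" for h
    have A': "(\<lambda>h. A i j (\<lambda>v. h (Inr v))) \<in> polfun" for i j
      by (rule polfun_subst[OF A]) (rule polfun_var)
    have "definable P" unfolding P_def
      by (intro definable_imp definable_subst[OF S(1)] definable_le polfun_intros A')
    then have "definable (\<lambda>e. \<forall>f. (\<forall>b. b \<notin> UNIV \<longrightarrow> f b = 0) \<longrightarrow> P (case_sum e f))"
      by (intro definable_all_fun) auto
    moreover have "(\<forall>f. (\<forall>b. b \<notin> UNIV \<longrightarrow> f b = 0) \<longrightarrow> P (case_sum e f)) \<longleftrightarrow>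
        (\<forall>g\<in>S. 0 \<le> e None - N (act g (\<lambda>i. e (Some i))))" for e
      by (auto simp: P_def N_def act)
    ultimately have "definable (\<lambda>e. \<forall>g\<in>S. 0 \<le> e None - N (act g (\<lambda>i. e (Some i))))" by simp
    then show ?thesis unfolding D_def
      by (intro definable_conj definable_subst[OF K(1)] definable_le polfun_intros)
  qed
  have "closed_on F D" unfolding D_def
  proof (intro closed_on_conj closed_on_ball closed_on_nonneg)
    show "closed_on F (\<lambda>e. K (\<lambda>i. e (Some i)))"
      unfolding closed_on_def
    proof (intro allI impI)
      fix x assume "\<forall>\<epsilon>>0. \<exists>y. K (\<lambda>i. y (Some i)) \<and> (\<forall>i\<in>F. \<bar>x i - y i\<bar> < \<epsilon>)"
      then have "\<forall>\<epsilon>>0. \<exists>y. K y \<and> (\<forall>i\<in>I. \<bar>x (Some i) - y i\<bar> < \<epsilon>)" unfolding F_def by blast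
      then show "K (\<lambda>i. x (Some i))"
        by (rule K(2)[unfolded closed_on_def, THEN spec, THEN mp])
    qed
    show "(\<lambda>e. C - e None) \<in> polfun" by (intro polfun_intros)
    show "C - x None = C - y None" if "\<And>i. i \<in> F \<Longrightarrow> x i = y i" for x y :: "'i option \<Rightarrow> 'r"
      using that[of None] by (simp add: F_def)
    show "(\<lambda>e. e None - N (act g (\<lambda>i. e (Some i)))) \<in> polfun" for g
      unfolding N_def act by (intro polfun_intros)
    show "x None - N (act g (\<lambda>i. x (Some i))) = y None - N (act g (\<lambda>i. y (Some i)))"
      if "\<And>i. i \<in> F \<Longrightarrow> x i = y i" for x y :: "'i option \<Rightarrow> 'r" and g
      using that by (simp add: F_def N_def act)
  qed
  have bound: "\<bar>e i\<bar> \<le> C + 1" if e: "D e" and i: "i \<in> F" for e i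
  proof -
    have "N (act one (\<lambda>i. e (Some i))) = N (\<lambda>i. e (Some i))" by (rule Ncong) (simp add: one)
    then have c: "N (\<lambda>i. e (Some i)) \<le> e None" "e None \<le> C" using e one(1) by (auto simp: D_def)
    show ?thesis
    proof (cases i)
      case None
      then show ?thesis using c N0[of "\<lambda>i. e (Some i)"] by simp
    next
      case (Some j)
      then have "j \<in> I" using i by (auto simp: F_def)
      then have "e i ^ 2 \<le> N (\<lambda>i. e (Some i))" unfolding N_def Some
        by (intro member_le_sum[of j I "\<lambda>j. e (Some j) ^ 2"] I) auto
      then have "e i ^ 2 \<le> C" using c by simp
      also have "C \<le> (C + 1) ^ 2" using C0 by (simp add: power2_eq_square algebra_simps)
      finally show ?thesis using C0 by (metis abs_le_square_iff abs_of_nonneg add_nonneg_nonneg zero_le_one)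
    qed
  qed
  have "\<exists>e. D e \<and> (\<forall>e'. D e' \<longrightarrow> e None \<le> e' None)"
  proof (rule definable_attains_min[of F D "C + 1"])
    show "D (case_option C x0)" unfolding D_def using K(3) NM by (simp add: C_def)
    show "\<bar>e i\<bar> \<le> C + 1" if "D e" "i \<in> F" for e i by (rule bound[OF that])
  qed (use finF \<open>definable D\<close> \<open>closed_on F D\<close> in \<open>auto simp: F_def\<close>)
  then obtain e where e: "D e" "\<And>e'. D e' \<Longrightarrow> e None \<le> e' None" by blast
  define x where "x = (\<lambda>i. e (Some i))"
  define c where "c = e None"
  have x: "K x" "\<And>g. g \<in> S \<Longrightarrow> N (act g x) \<le> c" "c \<le> C" using e(1) by (auto simp: D_def x_def c_def)
  have unique: "y i = x i" if y: "K y" "\<And>g. g \<in> S \<Longrightarrow> N (act g y) \<le> c" and i: "i \<in> I" for y i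
  proof (rule ccontr)
    assume "y i \<noteq> x i"
    define w where "w j = x j - y j" for j
    have "0 < w i ^ 2" using \<open>y i \<noteq> x i\<close> by (simp add: w_def)
    also have "w i ^ 2 \<le> N w" unfolding N_def by (intro member_le_sum[of i I "\<lambda>j. w j ^ 2"] I i) auto
    finally have Nw: "0 < N w" .
    \<comment> \<open>An inverse element recovers w from \<open>act g w\<close>, so the translates
      of w cannot become arbitrarily small.\<close>
    have wM: "N w \<le> M * N (act g w)" if g: "g \<in> S" for g
    proof -
      obtain h where h: "h \<in> S" "\<And>x i. i \<in> I \<Longrightarrow> act h (act g x) i = x i" using inv[OF g] by blast
      then have "N w = N (act h (act g w))" by (intro Ncong) auto
      then show ?thesis using NM[OF h(1)] by simp
    qed
    have "M \<noteq> 0" using wM[OF one(1)] Nw by auto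
    then have Mpos: "0 < M" using M0 by simp
    \<comment> \<open>By the parallelogram identity the midpoint gains N(g w)/4 \<ge> N(w)/(4M),
      uniformly in g, so the bound could be lowered to \<open>c - \<delta>\<close>.\<close>
    define \<delta> where "\<delta> = N w / (4 * M)"
    have \<delta>: "0 < \<delta>" using Nw Mpos by (simp add: \<delta>_def)
    define m where "m j = (x j + y j) / 2" for j
    have "N (act g m) \<le> c - \<delta>" if g: "g \<in> S" for g
    proof -
      have am: "act g m j = (act g x j + act g y j) / 2" "act g w j = act g x j - act g y j" for j
        unfolding act m_def w_def
        by (simp_all add: sum.distrib sum_subtractf algebra_simps add_divide_distrib sum_divide_distrib)
      have "N (act g m) = (\<Sum>j\<in>I. act g x j ^ 2 / 2 + act g y j ^ 2 / 2 - act g w j ^ 2 / 4)"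
        unfolding N_def am by (intro sum.cong refl) (simp add: power2_eq_square field_simps)
      also have "\<dots> = N (act g x) / 2 + N (act g y) / 2 - N (act g w) / 4"
        by (simp add: N_def sum.distrib sum_subtractf sum_divide_distrib)
      also have "\<dots> \<le> c / 2 + c / 2 - N w / M / 4"
        using x(2)[OF g] y(2)[OF g] wM[OF g] Mpos
          by (intro diff_mono add_mono divide_right_mono) (auto simp: field_simps)
      finally show ?thesis by (simp add: \<delta>_def field_simps)
    qed
    moreover have "K m" using K(4)[OF x(1) y(1)] by (simp add: m_def[abs_def])
    ultimately have "D (case_option (c - \<delta>) m)"
      unfolding D_def using x(3) \<delta> by auto
    then show False using e(2)[of "case_option (c - \<delta>) m"] \<delta> by (simp add: c_def)
  qed
  have "act g x i = x i" if g: "g \<in> S" and i: "i \<in> I" for g i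
  proof (rule unique[OF _ _ i])
    show "K (act g x)" by (rule stable[OF g x(1)])
    fix h assume "h \<in> S"
    then obtain k where "k \<in> S" "\<And>x i. i \<in> I \<Longrightarrow> act h (act g x) i = act k x i" using mult[OF g] by blast
    then show "N (act h (act g x)) \<le> c" using x(2)[of k] Ncong[of "act h (act g x)" "act k x"] by auto
  qed
  then show ?thesis using x(1) by blast
qed

section \<open>Polynomial rings\<close>

subsection \<open>Evaluation homomorphisms\<close>

definition rhom :: "('r::comm_ring_1 \<Rightarrow> 's::comm_ring_1) \<Rightarrow> bool" where
  "rhom h \<longleftrightarrow> h 1 = 1 \<and> (\<forall>a b. h (a + b) = h a + h b) \<and> (\<forall>a b. h (a * b) = h a * h b)"

lemma rhom_0: "rhom h \<Longrightarrow> h 0 = 0"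
  unfolding rhom_def by (metis add.right_neutral add_left_cancel)

definition monom_eval :: "('v \<Rightarrow> 's::comm_ring_1) \<Rightarrow> ('v \<Rightarrow>\<^sub>0 nat) \<Rightarrow> 's" where
  "monom_eval x m = (\<Prod>i\<in>Poly_Mapping.keys m. x i ^ Poly_Mapping.lookup m i)"

lemma monom_eval_superset:
  "finite K \<Longrightarrow> Poly_Mapping.keys m \<subseteq> K \<Longrightarrow> monom_eval x m = (\<Prod>i\<in>K. x i ^ Poly_Mapping.lookup m i)"
  unfolding monom_eval_def by (intro prod.mono_neutral_left) (auto simp: in_keys_iff)

lemma monom_eval_add: "monom_eval x (m + n) = monom_eval x m * monom_eval x n"
proof -
  let ?K = "Poly_Mapping.keys m \<union> Poly_Mapping.keys n"
  have "Poly_Mapping.keys (m + n) \<subseteq> ?K" by (rule keys_add)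
  then show ?thesis
    by (simp add: monom_eval_superset[of ?K] lookup_add power_add prod.distrib)
qed

lemma aeval_superset:
  assumes "rhom h" "finite K" "Poly_Mapping.keys p \<subseteq> K"
  shows "aeval h x p = (\<Sum>m\<in>K. h (Poly_Mapping.lookup p m) * monom_eval x m)"
  unfolding aeval_def monom_eval_def using assms
  by (intro sum.mono_neutral_left) (auto simp: in_keys_iff rhom_0)

lemma aeval_add:
  assumes "rhom h"
  shows "aeval h x (p + q) = aeval h x p + aeval h x q"
proof -
  let ?K = "Poly_Mapping.keys p \<union> Poly_Mapping.keys q"
  have "Poly_Mapping.keys (p + q) \<subseteq> ?K" by (rule keys_add)
  moreover have "h (a + b) = h a + h b" for a b using assms by (simp add: rhom_def)
  ultimately show ?thesis
    by (simp add: aeval_superset[OF assms, of ?K] lookup_add sum.distrib algebra_simps)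
qed

lemma aeval_single:
  assumes "rhom h"
  shows "aeval h x (Poly_Mapping.single m c) = h c * monom_eval x m"
  by (subst aeval_superset[OF assms, of "{m}"]) auto

lemma mpoly_single_induct [case_names single add]:
  assumes "\<And>m c. P (Poly_Mapping.single m c)" "\<And>p q. P p \<Longrightarrow> P q \<Longrightarrow> P (p + q)"
  shows "P (p :: 'a \<Rightarrow>\<^sub>0 'b::comm_monoid_add)"
proof -
  have "P (\<Sum>m\<in>K. Poly_Mapping.single m (Poly_Mapping.lookup p m))" if "finite K" for K
    using that
  proof (induction K)
    case empty
    then show ?case using assms(1)[of undefined 0] by simp
  qed (simp add: assms)
  moreover have "p = (\<Sum>m\<in>Poly_Mapping.keys p. Poly_Mapping.single m (Poly_Mapping.lookup p m))"
    by (rule poly_mapping_eqI) (simp add: lookup_sum lookup_single when_def in_keys_iff)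
  ultimately show ?thesis by (metis finite_keys)
qed

lemma aeval_mult:
  assumes "rhom h"
  shows "aeval h x (p * q) = aeval h x p * aeval h x q"
proof (induction p rule: mpoly_single_induct)
  case (single m c)
  show ?case
  proof (induction q rule: mpoly_single_induct)
    case (single n d)
    then show ?case using assms by (simp add: mult_single aeval_single monom_eval_add rhom_def)
  qed (simp add: distrib_left aeval_add[OF assms])
qed (simp add: distrib_right aeval_add[OF assms])

lemma aeval_Const: "rhom h \<Longrightarrow> aeval h x (Const c) = h c"
  by (simp add: Const_def aeval_single monom_eval_def)

lemma aeval_Var: "rhom h \<Longrightarrow> aeval h x (Var i) = x i"
  by (simp add: Var_def aeval_single monom_eval_def rhom_def)

lemma aeval_minus: "rhom h \<Longrightarrow> aeval h x (- p) = - aeval h x p"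
  by (metis aeval_add aeval_single rhom_0 add_eq_0_iff add.right_inverse mult_zero_left single_zero)

lemma Const_simps:
  "Const 0 = 0" "Const 1 = 1" "Const (a + b) = Const a + Const b" "Const (a * b) = Const a * Const b"
  "Const (- a) = - Const a" "Const (a - b) = Const a - Const b"
  by (simp_all add: Const_def single_add mult_single single_uminus single_diff)

lemma rhom_Const: "rhom Const" and rhom_id: "rhom (\<lambda>c. c)"
  by (simp_all add: rhom_def Const_simps)

lemma single_eq_prod_Var:
  "Poly_Mapping.single m c = Const c * (\<Prod>i\<in>Poly_Mapping.keys m. Var i ^ Poly_Mapping.lookup m i)"
proof -
  have pow: "Var i ^ k = Poly_Mapping.single (Poly_Mapping.single i k) (1::'b)" for i :: 'a and k
    by (induction k) (simp_all add: Var_def mult_single single_add[symmetric])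
  have "(\<Prod>i\<in>K. Poly_Mapping.single (Poly_Mapping.single i (Poly_Mapping.lookup m i)) (1::'b))
      = Poly_Mapping.single (\<Sum>i\<in>K. Poly_Mapping.single i (Poly_Mapping.lookup m i)) 1" if "finite K" for K
    using that by (induction K) (simp_all add: mult_single)
  moreover have "(\<Sum>i\<in>Poly_Mapping.keys m. Poly_Mapping.single i (Poly_Mapping.lookup m i)) = m"
    by (rule poly_mapping_eqI) (simp add: lookup_sum lookup_single when_def in_keys_iff)
  ultimately show ?thesis by (simp add: pow Const_def mult_single)
qed

lemma mpoly_induct [case_names Const add mult_Var]:
  assumes C: "\<And>c. P (Const c)" and add: "\<And>p q. P p \<Longrightarrow> P q \<Longrightarrow> P (p + q)"
    and V: "\<And>p i. P p \<Longrightarrow> P (p * Var i)"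
  shows "P (p :: ('v, 'r::comm_ring_1) mpoly)"
proof (induction p rule: mpoly_single_induct)
  case (single m c)
  have pow: "P q \<Longrightarrow> P (q * Var i ^ k)" for q i k
    by (induction k arbitrary: q) (simp_all add: V mult.assoc[symmetric])
  have "P q \<Longrightarrow> P (q * (\<Prod>i\<in>K. Var i ^ Poly_Mapping.lookup m i))" if "finite K" for K q
    using that by (induction K arbitrary: q) (simp_all add: pow mult.assoc[symmetric])
  then show ?case by (simp add: single_eq_prod_Var C)
qed (rule add)

lemma peval_simps:
  "peval x (p + q) = peval x p + peval x q" "peval x (p * q) = peval x p * peval x q"
  "peval x (- p) = - peval x p" "peval x (Const c) = c" "peval x (Var i) = x i" "peval x 0 = 0" "peval x 1 = 1"
  "peval x (p - q) = peval x p - peval x q"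
proof -
  show 1: "peval x (p + q) = peval x p + peval x q" and 2: "peval x (- p) = - peval x p" for p q
    by (simp_all add: peval_def aeval_add aeval_minus rhom_id)
  show C: "peval x (Const c) = c" for c by (simp add: peval_def aeval_Const rhom_id)
  show "peval x 0 = 0" "peval x 1 = 1" using C[of 0] C[of 1] by (simp_all add: Const_simps)
  show "peval x (p - q) = peval x p - peval x q" using 1[of p "- q"] 2[of q] by simp
qed (simp_all add: peval_def aeval_mult aeval_Var rhom_id)

lemma peval_sum: "peval x (sum f A) = (\<Sum>i\<in>A. peval x (f i))"
  by (induction A rule: infinite_finite_induct) (simp_all add: peval_simps)

lemma subst_simps:
  "subst \<phi> (p + q) = subst \<phi> p + subst \<phi> q" "subst \<phi> (p * q) = subst \<phi> p * subst \<phi> q"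
  "subst \<phi> (- p) = - subst \<phi> p" "subst \<phi> (Const c) = Const c" "subst \<phi> (Var i) = \<phi> i"
  "subst \<phi> 0 = 0" "subst \<phi> 1 = 1" "subst \<phi> (p - q) = subst \<phi> p - subst \<phi> q"
proof -
  show 1: "subst \<phi> (p + q) = subst \<phi> p + subst \<phi> q" and 2: "subst \<phi> (- p) = - subst \<phi> p" for p q
    by (simp_all add: subst_def aeval_add aeval_minus rhom_Const)
  show C: "subst \<phi> (Const c) = Const c" for c by (simp add: subst_def aeval_Const rhom_Const)
  show "subst \<phi> 0 = 0" "subst \<phi> 1 = 1" using C[of 0] C[of 1] by (simp_all add: Const_simps)
  show "subst \<phi> (p - q) = subst \<phi> p - subst \<phi> q" using 1[of p "- q"] 2[of q] by simp
qed (simp_all add: subst_def aeval_mult aeval_Var rhom_Const)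

lemma subst_sum: "subst \<phi> (sum f A) = (\<Sum>i\<in>A. subst \<phi> (f i))"
  by (induction A rule: infinite_finite_induct) (simp_all add: subst_simps)

lemma peval_subst: "peval x (subst \<phi> p) = peval (\<lambda>i. peval x (\<phi> i)) p"
  by (induction p rule: mpoly_induct) (simp_all add: peval_simps subst_simps)

lemma subst_subst: "subst \<psi> (subst \<phi> p) = subst (\<lambda>i. subst \<psi> (\<phi> i)) p"
  by (induction p rule: mpoly_induct) (simp_all add: subst_simps)

lemma subst_Var: "subst Var p = p"
  by (induction p rule: mpoly_induct) (simp_all add: subst_simps)

lemma peval_polfun: "(\<lambda>x. peval x p) \<in> polfun"
  by (induction p rule: mpoly_induct) (simp_all add: peval_simps polfun_intros)

subsection \<open>Ideals\<close>

text \<open>Elementwise form of \<open>ideal I poly_ring\<close>, see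
  \<open>poly_ring_ideal_iff\<close>; closure under negation comes from multiplication by
  -1.\<close>

definition mideal :: "('v, 'r::comm_ring_1) mpoly set \<Rightarrow> bool" where
  "mideal I \<longleftrightarrow> 0 \<in> I \<and> (\<forall>a\<in>I. \<forall>b\<in>I. a + b \<in> I) \<and> (\<forall>a\<in>I. \<forall>p. p * a \<in> I)"

lemma mideal_0: "mideal I \<Longrightarrow> 0 \<in> I"
  and mideal_add: "mideal I \<Longrightarrow> a \<in> I \<Longrightarrow> b \<in> I \<Longrightarrow> a + b \<in> I"
  and mideal_mult: "mideal I \<Longrightarrow> a \<in> I \<Longrightarrow> p * a \<in> I"
  by (simp_all add: mideal_def)

lemma mideal_mult_right: "mideal I \<Longrightarrow> a \<in> I \<Longrightarrow> a * p \<in> I"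
  by (subst mult.commute) (rule mideal_mult)

lemma mideal_minus: "mideal I \<Longrightarrow> a \<in> I \<Longrightarrow> - a \<in> I"
  using mideal_mult[of I a "-1"] by simp

lemma mideal_diff: "mideal I \<Longrightarrow> a \<in> I \<Longrightarrow> b \<in> I \<Longrightarrow> a - b \<in> I"
  using mideal_add[of I a "- b"] by (simp add: mideal_minus)

lemma mideal_sum: "mideal I \<Longrightarrow> (\<And>i. i \<in> A \<Longrightarrow> f i \<in> I) \<Longrightarrow> sum f A \<in> I"
  by (induction A rule: infinite_finite_induct) (auto intro: mideal_0 mideal_add)

lemma poly_ring_simps:
  "carrier poly_ring = UNIV" "p \<oplus>\<^bsub>poly_ring\<^esub> q = p + q" "p \<otimes>\<^bsub>poly_ring\<^esub> q = p * q"
  "\<zero>\<^bsub>poly_ring\<^esub> = 0" "\<one>\<^bsub>poly_ring\<^esub> = 1"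
  by (simp_all add: poly_ring_def ring_of_type_algebra_def)

lemma poly_ring_ring: "ring (poly_ring :: ('v, 'r::comm_ring_1) mpoly ring)"
  unfolding poly_ring_def by (rule ring_from_type_algebra)

lemma poly_ring_ideal_iff: "ideal I (poly_ring :: ('v, 'r::comm_ring_1) mpoly ring) \<longleftrightarrow> mideal I"
proof
  assume I: "ideal I (poly_ring :: ('v, 'r) mpoly ring)"
  then interpret ideal I "poly_ring :: ('v, 'r) mpoly ring" .
  show "mideal I"
    unfolding mideal_def
    using additive_subgroup.zero_closed[OF ideal.axioms(1)[OF I]]
      additive_subgroup.a_closed[OF ideal.axioms(1)[OF I]] I_l_closed
    by (simp add: poly_ring_simps)
next
  assume I: "mideal I"
  show "ideal I (poly_ring :: ('v, 'r) mpoly ring)"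
  proof (rule idealI[OF poly_ring_ring])
    interpret R: ring "poly_ring :: ('v, 'r) mpoly ring" by (rule poly_ring_ring)
    have inv: "inv\<^bsub>add_monoid poly_ring\<^esub> p = - p" for p :: "('v, 'r) mpoly"
      using R.minus_equality[of "- p" p] unfolding a_inv_def by (simp add: poly_ring_simps)
    show "subgroup I (add_monoid (poly_ring :: ('v, 'r) mpoly ring))"
    proof (rule subgroup.intro)
      show "\<And>x. x \<in> I \<Longrightarrow> inv\<^bsub>add_monoid poly_ring\<^esub> x \<in> I"
        unfolding inv by (rule mideal_minus[OF I])
    qed (use I in \<open>auto simp: poly_ring_simps mideal_def\<close>)
  qed (use I in \<open>auto simp: poly_ring_simps mideal_mult mideal_mult_right\<close>)
qed

lemma mideal_vimage_subst: "mideal L \<Longrightarrow> mideal {p. subst \<sigma> p \<in> L}"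
  by (simp add: mideal_def subst_simps)

lemma mideal_scheme_prod: "mideal (scheme_prod I J)"
proof -
  interpret R: ring poly_ring by (rule poly_ring_ring)
  show ?thesis unfolding scheme_prod_def poly_ring_ideal_iff[symmetric]
    by (rule R.genideal_ideal) (simp add: poly_ring_simps)
qed

lemma scheme_prod_generators:
  "p \<in> I \<Longrightarrow> subst (\<lambda>i. Var (Inl i)) p \<in> scheme_prod I J"
  "q \<in> J \<Longrightarrow> subst (\<lambda>j. Var (Inr j)) q \<in> scheme_prod I J"
  unfolding scheme_prod_def genideal_def by auto

text \<open>Universal property of the fibre product: the preimage of an ideal under
  \<open>subst \<sigma>\<close> is an ideal, so checking the two families of generators
  suffices.\<close>

lemma subst_scheme_prod:
  assumes "mideal L" "\<And>p. p \<in> I \<Longrightarrow> subst (\<lambda>i. \<sigma> (Inl i)) p \<in> L" "\<And>q. q \<in> J \<Longrightarrow> subst (\<lambda>j. \<sigma> (Inr j)) q \<in> L"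
    and "p \<in> scheme_prod I J"
  shows "subst \<sigma> p \<in> L"
proof -
  have "ideal {p. subst \<sigma> p \<in> L} poly_ring"
    unfolding poly_ring_ideal_iff by (rule mideal_vimage_subst[OF assms(1)])
  moreover have "subst (\<lambda>i. Var (Inl i)) ` I \<union> subst (\<lambda>j. Var (Inr j)) ` J \<subseteq> {p. subst \<sigma> p \<in> L}"
    using assms(2,3) by (auto simp: subst_subst subst_simps)
  ultimately have "scheme_prod I J \<subseteq> {p. subst \<sigma> p \<in> L}"
    unfolding scheme_prod_def genideal_def by blast
  then show ?thesis using assms(4) by blast
qed

text \<open>The ring in the disjoint union of the variables is the tensor product of the two
  polynomial rings. For an action this is the source of local finiteness, as the second factors do
  not depend on the group element.\<close>

lemma mpoly_sum_of_products:
  fixes p :: "('v + 'w, 'r::comm_ring_1) mpoly"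
  shows "\<exists>n a b. p = (\<Sum>k<(n::nat). subst (\<lambda>i. Var (Inl i)) (a k) * subst (\<lambda>j. Var (Inr j)) (b k))"
proof (induction p rule: mpoly_induct)
  case (Const c)
  show ?case by (intro exI[of _ 1] exI[of _ "\<lambda>_. Const c"] exI[of _ "\<lambda>_. 1"]) (simp add: subst_simps)
next
  case (add p q)
  then obtain n a b n' a' b' where
    p: "p = (\<Sum>k<(n::nat). subst (\<lambda>i. Var (Inl i)) (a k) * subst (\<lambda>j. Var (Inr j)) (b k))" and
    q: "q = (\<Sum>k<(n'::nat). subst (\<lambda>i. Var (Inl i)) (a' k) * subst (\<lambda>j. Var (Inr j)) (b' k))" by blast
  have concat: "(\<Sum>k<n + m. if k < n then u k else v (k - n)) = (\<Sum>k<n. u k) + (\<Sum>k<m. v k)"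
    for m :: nat and u v :: "nat \<Rightarrow> ('v + 'w, 'r) mpoly"
    by (induction m) (simp_all add: add.assoc)
  let ?a = "\<lambda>k. if k < n then a k else a' (k - n)" and ?b = "\<lambda>k. if k < n then b k else b' (k - n)"
  have "(\<Sum>k<n + n'. subst (\<lambda>i. Var (Inl i)) (?a k) * subst (\<lambda>j. Var (Inr j)) (?b k)) = p + q"
    unfolding p q concat[symmetric] by (intro sum.cong refl) simp
  then show ?case by (intro exI) (rule sym)
next
  case (mult_Var p v)
  then obtain n a b where
    p: "p = (\<Sum>k<(n::nat). subst (\<lambda>i. Var (Inl i)) (a k) * subst (\<lambda>j. Var (Inr j)) (b k))" by blast
  show ?case
  proof (cases v)
    case (Inl i)
    show ?thesis
      by (intro exI[of _ n] exI[of _ "\<lambda>k. a k * Var i"] exI[of _ b])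
        (simp add: p Inl subst_simps sum_distrib_left mult_ac)
  next
    case (Inr j)
    show ?thesis
      by (intro exI[of _ n] exI[of _ a] exI[of _ "\<lambda>k. b k * Var j"])
        (simp add: p Inr subst_simps sum_distrib_left mult_ac)
  qed
qed

text \<open>If the second factors are independent modulo \<open>J\<close>, density of \<open>T\<close> and then of \<open>S\<close> forces the first
  factors into \<open>I\<close>; otherwise one summand can be eliminated.\<close>

lemma zariski_dense_prod:
  fixes I :: "('v, 'r::field) mpoly set" and J :: "('w, 'r) mpoly set"
  assumes S: "zariski_dense S I" and T: "zariski_dense T J" and J: "mideal J"
    and vanish: "\<And>x y. x \<in> S \<Longrightarrow> y \<in> T \<Longrightarrow> peval (case_sum x y) p = 0"
  shows "p \<in> scheme_prod I J"
proof -
  let ?l = "subst (\<lambda>i. Var (Inl i)) :: ('v, 'r) mpoly \<Rightarrow> ('v + 'w, 'r) mpoly"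
  let ?r = "subst (\<lambda>j. Var (Inr j)) :: ('w, 'r) mpoly \<Rightarrow> ('v + 'w, 'r) mpoly"
  have ev: "peval (case_sum x y) (?l a) = peval x a" "peval (case_sum x y) (?r b) = peval y b" for x y a b
    by (simp_all add: peval_subst peval_simps)
  note SP = mideal_scheme_prod[of I J]
  have main: "(\<Sum>k\<in>K. ?l (a k) * ?r (b k)) \<in> scheme_prod I J"
    if "finite K" "\<And>x y. x \<in> S \<Longrightarrow> y \<in> T \<Longrightarrow> peval (case_sum x y) (\<Sum>k\<in>K. ?l (a k) * ?r (b k)) = 0"
    for K :: "nat set" and a b
    using that
  proof (induction "card K" arbitrary: K a)
    case 0
    then show ?case using mideal_0[OF SP] by simp
  next
    case (Suc n)
    show ?case
    proof (cases "\<exists>c. (\<Sum>k\<in>K. Const (c k) * b k) \<in> J \<and> (\<exists>j\<in>K. c j \<noteq> 0)")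
      case False
      have "a k \<in> I" if k: "k \<in> K" for k
      proof -
        have "peval x (a k) = 0" if x: "x \<in> S" for x
        proof -
          have "peval y (\<Sum>k\<in>K. Const (peval x (a k)) * b k) = 0" if "y \<in> T" for y
            using Suc.prems(2)[OF x that] by (simp add: peval_sum peval_simps ev)
          then have "(\<Sum>k\<in>K. Const (peval x (a k)) * b k) \<in> J"
            using T unfolding zariski_dense_def by blast
          then show ?thesis using False k by (auto dest: spec[of _ "\<lambda>k. peval x (a k)"])
        qed
        then show ?thesis using S unfolding zariski_dense_def by blast
      qed
      then show ?thesis
        by (intro mideal_sum[OF SP] mideal_mult_right[OF SP] scheme_prod_generators)
    next
      case True
      then obtain c j where c: "(\<Sum>k\<in>K. Const (c k) * b k) \<in> J" "j \<in> K" "c j \<noteq> 0" by blast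
      \<comment> \<open>Normalised so that \<open>d j = 1\<close>: then \<open>a' j = 0\<close>, and
        the summand at j disappears.\<close>
      define d where "d k = c k / c j" for k
      define a' where "a' k = a k - Const (d k) * a j" for k
      define rel where "rel = (\<Sum>k\<in>K. Const (d k) * b k)"
      have "Const (1 / c j) * (\<Sum>k\<in>K. Const (c k) * b k) \<in> J" by (rule mideal_mult[OF J c(1)])
      also have "Const (1 / c j) * (\<Sum>k\<in>K. Const (c k) * b k) = rel"
        unfolding rel_def sum_distrib_left
        by (intro sum.cong refl) (simp add: d_def mult.assoc[symmetric] Const_simps(4)[symmetric])
      finally have rel: "?l (a j) * ?r rel \<in> scheme_prod I J"
        by (intro mideal_mult[OF SP] scheme_prod_generators)
      have eq: "(\<Sum>k\<in>K. ?l (a k) * ?r (b k)) = (\<Sum>k\<in>K - {j}. ?l (a' k) * ?r (b k)) + ?l (a j) * ?r rel"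
      proof -
        have "(\<Sum>k\<in>K. ?l (a' k) * ?r (b k)) = (\<Sum>k\<in>K. ?l (a k) * ?r (b k)) - ?l (a j) * ?r rel"
          unfolding a'_def rel_def
          by (simp add: subst_simps subst_sum sum_subtractf sum_distrib_left algebra_simps)
        moreover have "a' j = 0" using c(3) by (simp add: a'_def d_def Const_simps)
        then have "(\<Sum>k\<in>K. ?l (a' k) * ?r (b k)) = (\<Sum>k\<in>K - {j}. ?l (a' k) * ?r (b k))"
          using Suc.prems(1) c(2) by (subst sum.remove[of K j]) (auto simp: subst_simps)
        ultimately show ?thesis by simp
      qed
      have "(\<Sum>k\<in>K - {j}. ?l (a' k) * ?r (b k)) \<in> scheme_prod I J"
      proof (rule Suc.hyps(1))
        show "n = card (K - {j})" using Suc.hyps(2) c(2) by simp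
        fix x y assume xy: "x \<in> S" "y \<in> T"
        have "rel \<in> J" using \<open>Const (1 / c j) * (\<Sum>k\<in>K. Const (c k) * b k) \<in> J\<close>
          \<open>Const (1 / c j) * (\<Sum>k\<in>K. Const (c k) * b k) = rel\<close> by simp
        then have "peval y rel = 0" using T xy unfolding zariski_dense_def rational_points_def by blast
        then show "peval (case_sum x y) (\<Sum>k\<in>K - {j}. ?l (a' k) * ?r (b k)) = 0"
          using Suc.prems(2)[OF xy] unfolding eq by (simp add: peval_simps ev)
      qed (use Suc.prems(1) in simp)
      then show ?thesis unfolding eq using rel by (rule mideal_add[OF SP])
    qed
  qed
  obtain n a b where p: "p = (\<Sum>k<(n::nat). ?l (a k) * ?r (b k))" using mpoly_sum_of_products by blast
  show ?thesis unfolding p by (rule main) (use vanish p in auto)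
qed

subsection \<open>Hilbert's basis theorem\<close>

definition is_subring :: "'b::comm_ring_1 set \<Rightarrow> bool" where
  "is_subring A \<longleftrightarrow> 1 \<in> A \<and> (\<forall>a\<in>A. \<forall>b\<in>A. a - b \<in> A \<and> a * b \<in> A)"

lemma is_subringD:
  assumes "is_subring A"
  shows "1 \<in> A" "0 \<in> A" "a \<in> A \<Longrightarrow> b \<in> A \<Longrightarrow> a + b \<in> A" "a \<in> A \<Longrightarrow> b \<in> A \<Longrightarrow> a - b \<in> A"
    "a \<in> A \<Longrightarrow> b \<in> A \<Longrightarrow> a * b \<in> A"
proof -
  show "1 \<in> A" "a \<in> A \<Longrightarrow> b \<in> A \<Longrightarrow> a - b \<in> A" "a \<in> A \<Longrightarrow> b \<in> A \<Longrightarrow> a * b \<in> A"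
    using assms by (simp_all add: is_subring_def)
  then show 0: "0 \<in> A" using assms unfolding is_subring_def by (metis diff_self)
  show "a \<in> A \<Longrightarrow> b \<in> A \<Longrightarrow> a + b \<in> A" using assms 0 unfolding is_subring_def
    by (metis diff_0 diff_minus_eq_add)
qed

definition ideal_in :: "'b::comm_ring_1 set \<Rightarrow> 'b set \<Rightarrow> bool" where
  "ideal_in A I \<longleftrightarrow> I \<subseteq> A \<and> 0 \<in> I \<and> (\<forall>x\<in>I. \<forall>y\<in>I. x + y \<in> I) \<and> (\<forall>a\<in>A. \<forall>x\<in>I. a * x \<in> I)"

definition lin_combs :: "'b::comm_ring_1 set \<Rightarrow> 'b set \<Rightarrow> 'b set" where
  "lin_combs A G = {\<Sum>g\<in>G. c g * g | c. \<forall>g. c g \<in> A}"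

definition noetherian_in :: "'b::comm_ring_1 set \<Rightarrow> bool" where
  "noetherian_in A \<longleftrightarrow> (\<forall>I. ideal_in A I \<longrightarrow> (\<exists>G. finite G \<and> G \<subseteq> I \<and> I \<subseteq> lin_combs A G))"

text \<open>Here \<open>x\<close> is an element of the ambient ring and may satisfy relations over
  \<open>A\<close>. The representation need not be unique, so \<open>n\<close> is a formal bound
  rather than a degree.\<close>

definition poly_upto :: "'b::comm_ring_1 set \<Rightarrow> 'b \<Rightarrow> nat \<Rightarrow> 'b set" where
  "poly_upto A x n = {\<Sum>i<n. c i * x ^ i | c. \<forall>i. c i \<in> A}"

lemma lin_combs_closed:
  assumes "is_subring A"
  shows "0 \<in> lin_combs A G" "p \<in> lin_combs A G \<Longrightarrow> q \<in> lin_combs A G \<Longrightarrow> p + q \<in> lin_combs A G"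
    "a \<in> A \<Longrightarrow> p \<in> lin_combs A G \<Longrightarrow> a * p \<in> lin_combs A G" "finite G \<Longrightarrow> g \<in> G \<Longrightarrow> g \<in> lin_combs A G"
proof -
  note A = is_subringD[OF assms]
  show "0 \<in> lin_combs A G" unfolding lin_combs_def using A(2) by (intro CollectI exI[of _ "\<lambda>_. 0"]) simp
  show "p + q \<in> lin_combs A G" if pq: "p \<in> lin_combs A G" "q \<in> lin_combs A G"
  proof -
    obtain c d where "p = (\<Sum>g\<in>G. c g * g)" "\<forall>g. c g \<in> A" "q = (\<Sum>g\<in>G. d g * g)" "\<forall>g. d g \<in> A"
      using pq unfolding lin_combs_def by blast
    then show ?thesis unfolding lin_combs_def
      by (intro CollectI exI[of _ "\<lambda>g. c g + d g"]) (simp add: sum.distrib distrib_right A)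
  qed
  show "a * p \<in> lin_combs A G" if ap: "a \<in> A" "p \<in> lin_combs A G"
  proof -
    obtain c where "p = (\<Sum>g\<in>G. c g * g)" "\<forall>g. c g \<in> A" using ap unfolding lin_combs_def by blast
    then show ?thesis unfolding lin_combs_def using ap(1)
      by (intro CollectI exI[of _ "\<lambda>g. a * c g"]) (simp add: sum_distrib_left mult.assoc A)
  qed
  show "g \<in> lin_combs A G" if "finite G" "g \<in> G"
    unfolding lin_combs_def using that A
    by (intro CollectI exI[of _ "\<lambda>h. if h = g then 1 else 0"]) (simp add: if_distrib[of "\<lambda>c. c * _"]
        cong: if_cong)
qed

lemma ideal_in_lin_combs:
  assumes "ideal_in A I" "G \<subseteq> I" "finite G"
  shows "lin_combs A G \<subseteq> I"
proof -
  have "(\<Sum>g\<in>K. c g * g) \<in> I" if "finite K" "K \<subseteq> G" "\<forall>g. c g \<in> A" for K c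
    using that assms by (induction K) (auto simp: ideal_in_def)
  then show ?thesis unfolding lin_combs_def using assms(3) by auto
qed

lemma poly_upto_0: "poly_upto A x 0 = {0}" if "is_subring A"
  using is_subringD(2)[OF that] by (auto simp: poly_upto_def)

lemma poly_upto_Suc: "poly_upto A x (Suc n) = {f + a * x ^ n | f a. f \<in> poly_upto A x n \<and> a \<in> A}"
proof (intro equalityI subsetI)
  fix p assume "p \<in> {f + a * x ^ n | f a. f \<in> poly_upto A x n \<and> a \<in> A}"
  then obtain c a where c: "p = (\<Sum>i<n. c i * x ^ i) + a * x ^ n" "\<forall>i. c i \<in> A" "a \<in> A"
    unfolding poly_upto_def by blast
  then show "p \<in> poly_upto A x (Suc n)" unfolding poly_upto_def
    by (intro CollectI exI[of _ "c(n := a)"]) simp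
qed (auto simp: poly_upto_def)

lemma poly_upto_closed:
  assumes "is_subring A"
  shows "0 \<in> poly_upto A x n" "p \<in> poly_upto A x n \<Longrightarrow> q \<in> poly_upto A x n \<Longrightarrow> p + q \<in> poly_upto A x n"
    "p \<in> poly_upto A x n \<Longrightarrow> q \<in> poly_upto A x n \<Longrightarrow> p - q \<in> poly_upto A x n"
    "a \<in> A \<Longrightarrow> p \<in> poly_upto A x n \<Longrightarrow> a * p \<in> poly_upto A x n"
    "p \<in> poly_upto A x n \<Longrightarrow> x * p \<in> poly_upto A x (Suc n)"
    "p \<in> poly_upto A x n \<Longrightarrow> p \<in> poly_upto A x (Suc n)"
proof -
  note A = is_subringD[OF assms]
  show zero: "0 \<in> poly_upto A x n" for n unfolding poly_upto_def using A(2)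
    by (intro CollectI exI[of _ "\<lambda>_. 0"]) simp
  show "p + q \<in> poly_upto A x n" "p - q \<in> poly_upto A x n" if pq: "p \<in> poly_upto A x n" "q \<in> poly_upto A x n"
  proof -
    obtain c d where cd: "p = (\<Sum>i<n. c i * x ^ i)" "\<forall>i. c i \<in> A" "q = (\<Sum>i<n. d i * x ^ i)" "\<forall>i. d i \<in> A"
      using pq unfolding poly_upto_def by blast
    then show "p + q \<in> poly_upto A x n" unfolding poly_upto_def
      by (intro CollectI exI[of _ "\<lambda>g. c g + d g"]) (simp add: sum.distrib distrib_right A)
    show "p - q \<in> poly_upto A x n" unfolding poly_upto_def using cd
      by (intro CollectI exI[of _ "\<lambda>g. c g - d g"]) (simp add: sum_subtractf left_diff_distrib A)
  qed
  show "a * p \<in> poly_upto A x n" if ap: "a \<in> A" "p \<in> poly_upto A x n"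
  proof -
    obtain c where "p = (\<Sum>i<n. c i * x ^ i)" "\<forall>g. c g \<in> A" using ap unfolding poly_upto_def by blast
    then show ?thesis unfolding poly_upto_def using ap(1)
      by (intro CollectI exI[of _ "\<lambda>g. a * c g"]) (simp add: sum_distrib_left mult.assoc A)
  qed
  show "p \<in> poly_upto A x n \<Longrightarrow> x * p \<in> poly_upto A x (Suc n)"
  proof (induction n arbitrary: p)
    case 0
    then show ?case using zero by (simp add: poly_upto_0[OF assms])
  next
    case (Suc n)
    then obtain f a where "p = f + a * x ^ n" "f \<in> poly_upto A x n" "a \<in> A" unfolding poly_upto_Suc by blast
    moreover from this have "x * p = x * f + a * x ^ Suc n" by (simp add: algebra_simps)
    ultimately show ?case using Suc.IH[of f] by (subst poly_upto_Suc) blast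
  qed
  show "p \<in> poly_upto A x n \<Longrightarrow> p \<in> poly_upto A x (Suc n)"
    unfolding poly_upto_Suc using A(2) by force
qed

definition adjoin :: "'b::comm_ring_1 set \<Rightarrow> 'b \<Rightarrow> 'b set" where
  "adjoin A x = (\<Union>n. poly_upto A x n)"

lemma poly_upto_mono:
  assumes "is_subring A" "m \<le> n" "p \<in> poly_upto A x m"
  shows "p \<in> poly_upto A x n"
  using assms(2) by (induction rule: dec_induct) (auto intro: assms poly_upto_closed(6))

lemma poly_upto_pow: "is_subring A \<Longrightarrow> p \<in> poly_upto A x n \<Longrightarrow> x ^ k * p \<in> poly_upto A x (n + k)"
  by (induction k) (auto simp: mult.assoc intro: poly_upto_closed(5))

lemma is_subring_adjoin:
  assumes A: "is_subring A"
  shows "is_subring (adjoin A x)" "A \<subseteq> adjoin A x" "x \<in> adjoin A x"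
proof -
  note A' = is_subringD[OF A]
  have A1: "a \<in> poly_upto A x 1" if "a \<in> A" for a
    using that poly_upto_closed(1)[OF A, of x 0] unfolding One_nat_def poly_upto_Suc by force
  then show sub: "A \<subseteq> adjoin A x" unfolding adjoin_def by blast
  have "x * 1 \<in> poly_upto A x (Suc 1)" by (intro poly_upto_closed(5) A A1 A'(1))
  then show "x \<in> adjoin A x" unfolding adjoin_def by auto
  have mult: "\<exists>k. p * q \<in> poly_upto A x k" if pq: "p \<in> poly_upto A x n" "q \<in> poly_upto A x m" for p q n m
    using pq(1)
  proof (induction n arbitrary: p)
    case 0
    then show ?case using poly_upto_closed(1)[OF A] by (auto simp: poly_upto_0[OF A])
  next
    case (Suc n)
    then obtain f a where f: "p = f + a * x ^ n" "f \<in> poly_upto A x n" "a \<in> A" unfolding poly_upto_Suc by blast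
    obtain k where k: "f * q \<in> poly_upto A x k" using Suc.IH[OF f(2)] by blast
    have "a * (x ^ n * q) \<in> poly_upto A x (m + n)"
      by (intro poly_upto_closed(4)[OF A] f poly_upto_pow[OF A] pq)
    then have "f * q + a * (x ^ n * q) \<in> poly_upto A x (max k (m + n))"
      by (intro poly_upto_closed(2)[OF A] poly_upto_mono[OF A max.cobounded1 k]
          poly_upto_mono[OF A max.cobounded2])
    then show ?case unfolding f(1) by (auto simp: distrib_right mult.assoc)
  qed
  show "is_subring (adjoin A x)"
    unfolding is_subring_def
  proof (intro conjI ballI)
    show "1 \<in> adjoin A x" using sub A'(1) by blast
    fix p q assume "p \<in> adjoin A x" "q \<in> adjoin A x"
    then obtain n m where nm: "p \<in> poly_upto A x n" "q \<in> poly_upto A x m" by (auto simp: adjoin_def)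
    then have "p - q \<in> poly_upto A x (max n m)"
      by (intro poly_upto_closed(3)[OF A] poly_upto_mono[OF A max.cobounded1 nm(1)]
          poly_upto_mono[OF A max.cobounded2 nm(2)])
    then show "p - q \<in> adjoin A x" by (auto simp: adjoin_def)
    show "p * q \<in> adjoin A x" using mult[OF nm] by (auto simp: adjoin_def)
  qed
qed

text \<open>Hilbert's argument with formal leading coefficients: those of formal degree k form
  ideals \<open>L k\<close> of \<open>A\<close>, which increase with k (multiply by x) and become
  stationary at some K. Lifts of generators of \<open>L 0\<close>, ..., \<open>L K\<close> generate
  I, by descent on the formal degree.\<close>

theorem noetherian_adjoin:
  assumes A: "is_subring A" and noeth: "noetherian_in A"
  shows "noetherian_in (adjoin A x)"
  unfolding noetherian_in_def
proof (intro allI impI)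
  fix I assume I: "ideal_in (adjoin A x) I"
  note B = is_subring_adjoin[OF A, of x]
  note A' = is_subringD[OF A] and B' = is_subringD[OF B(1)]
  have Iadd: "p + q \<in> I" if "p \<in> I" "q \<in> I" for p q using I that by (simp add: ideal_in_def)
  have Imult: "a * p \<in> I" if "p \<in> I" "a \<in> adjoin A x" for a p using I that by (simp add: ideal_in_def)
  have I0: "0 \<in> I" using I by (simp add: ideal_in_def)
  define L where "L k = {a \<in> A. \<exists>f\<in>poly_upto A x k. f + a * x ^ k \<in> I}" for k
  have L: "ideal_in A (L k)" for k
    unfolding ideal_in_def
  proof (intro conjI ballI)
    show "L k \<subseteq> A" by (auto simp: L_def)
    show "0 \<in> L k" using A'(2) I0 poly_upto_closed(1)[OF A] by (auto simp: L_def intro: bexI[of _ 0])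
    fix a assume "a \<in> L k"
    then obtain f where a: "a \<in> A" "f \<in> poly_upto A x k" "f + a * x ^ k \<in> I" by (auto simp: L_def)
    { fix b assume "b \<in> L k"
      then obtain g where b: "b \<in> A" "g \<in> poly_upto A x k" "g + b * x ^ k \<in> I" by (auto simp: L_def)
      have "(f + g) + (a + b) * x ^ k \<in> I" using Iadd[OF a(3) b(3)] by (simp add: algebra_simps)
      then show "a + b \<in> L k" unfolding L_def using a b A' poly_upto_closed(2)[OF A a(2) b(2)] by blast }
    { fix b assume "b \<in> A"
      then have "b * f + (b * a) * x ^ k \<in> I" using Imult[OF a(3), of b] B(2) by (auto simp: algebra_simps)
      then show "b * a \<in> L k" unfolding L_def using a A' \<open>b \<in> A\<close> poly_upto_closed(4)[OF A \<open>b \<in> A\<close> a(2)]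
        by blast }
  qed
  have LSuc: "L k \<subseteq> L (Suc k)" for k
  proof
    fix a assume "a \<in> L k"
    then obtain f where a: "a \<in> A" "f \<in> poly_upto A x k" "f + a * x ^ k \<in> I" by (auto simp: L_def)
    have "x * f + a * x ^ Suc k \<in> I" using Imult[OF a(3) B(3)] by (simp add: algebra_simps)
    then show "a \<in> L (Suc k)" unfolding L_def using a poly_upto_closed(5)[OF A a(2)] by blast
  qed
  then have Lmono: "L k \<subseteq> L m" if "k \<le> m" for k m using that by (rule lift_Suc_mono_le)
  define U where "U = (\<Union>k. L k)"
  have "ideal_in A U" unfolding ideal_in_def
  proof (intro conjI ballI)
    show "U \<subseteq> A" "0 \<in> U" using L unfolding U_def ideal_in_def by blast+
    fix a assume "a \<in> U"
    then obtain k where k: "a \<in> L k" by (auto simp: U_def)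
    { fix b assume "b \<in> U"
      then obtain m where "b \<in> L m" by (auto simp: U_def)
      then have "a \<in> L (max k m)" "b \<in> L (max k m)" using k Lmono[of k "max k m"] Lmono[of m "max k m"] by auto
      then have "a + b \<in> L (max k m)" using L[of "max k m"] by (simp add: ideal_in_def)
      then show "a + b \<in> U" by (auto simp: U_def) }
    { fix b assume "b \<in> A"
      then have "b * a \<in> L k" using L[of k] k by (simp add: ideal_in_def)
      then show "b * a \<in> U" by (auto simp: U_def) }
  qed
  then obtain G where G: "finite G" "G \<subseteq> U" "U \<subseteq> lin_combs A G" using noeth unfolding noetherian_in_def by blast
  have "\<exists>K. G \<subseteq> L K" using G(1,2)
  proof (induction G)
    case (insert g G)
    then obtain K k where "G \<subseteq> L K" "g \<in> L k" by (auto simp: U_def)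
    then show ?case using Lmono[of K "max K k"] Lmono[of k "max K k"] by (intro exI[of _ "max K k"]) auto
  qed simp
  then obtain K where K: "G \<subseteq> L K" by blast
  \<comment> \<open>The finitely many generators of the union lie in one \<open>L K\<close>, so the
    chain is stationary from there on.\<close>
  have UK: "U \<subseteq> L K" using G(3) ideal_in_lin_combs[OF L K G(1)] by blast
  have "\<exists>G. finite G \<and> G \<subseteq> L k \<and> L k \<subseteq> lin_combs A G" for k using noeth L unfolding noetherian_in_def by blast
  then obtain Gk where Gk: "\<And>k. finite (Gk k)" "\<And>k. Gk k \<subseteq> L k" "\<And>k. L k \<subseteq> lin_combs A (Gk k)" by metis
  have "\<exists>p. p \<in> I \<and> (\<exists>f\<in>poly_upto A x k. p = f + g * x ^ k)" if "g \<in> L k" for k g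
    using that by (auto simp: L_def)
  then have "\<exists>p. \<forall>k. \<forall>g\<in>L k. p k g \<in> I \<and> (\<exists>f\<in>poly_upto A x k. p k g = f + g * x ^ k)"
    by (intro choice allI bchoice) blast
  then obtain p where "\<forall>k. \<forall>g\<in>L k. p k g \<in> I \<and> (\<exists>f\<in>poly_upto A x k. p k g = f + g * x ^ k)" ..
  then have p: "\<And>k g. g \<in> L k \<Longrightarrow> p k g \<in> I" "\<And>k g. g \<in> L k \<Longrightarrow> \<exists>f\<in>poly_upto A x k. p k g = f + g * x ^ k"
    by blast+
  define H where "H = (\<Union>k\<in>{..K}. p k ` Gk k)"
  have H: "finite H" using Gk(1) by (simp add: H_def)
  have HI: "H \<subseteq> I" unfolding H_def using Gk(2) p(1) by blast
  have "f \<in> lin_combs (adjoin A x) H" if "f \<in> I" "f \<in> poly_upto A x n" for f n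
    using that
  proof (induction n arbitrary: f)
    case 0
    then show ?case using lin_combs_closed(1)[OF B(1)] by (simp add: poly_upto_0[OF A])
  next
    case (Suc n)
    then obtain f0 a where f: "f = f0 + a * x ^ n" "f0 \<in> poly_upto A x n" "a \<in> A" unfolding poly_upto_Suc
      by blast
    then have "a \<in> L n" using Suc.prems(1) by (auto simp: L_def)
    \<comment> \<open>Above K the generators of \<open>L K\<close> are reused and shifted by x^(n -
      k).\<close>
    define k where "k = min n K"
    have "a \<in> L k"
    proof (cases "n \<le> K")
      case True
      then show ?thesis using \<open>a \<in> L n\<close> by (simp add: k_def)
    next
      case False
      then show ?thesis using \<open>a \<in> L n\<close> UK by (auto simp: k_def U_def)
    qed
    then obtain d where d: "a = (\<Sum>g\<in>Gk k. d g * g)" "\<forall>g. d g \<in> A" using Gk(3)[of k] unfolding lin_combs_def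
      by blast
    define s where "s = (\<Sum>g\<in>Gk k. d g * p k g)"
    have pH: "p k g \<in> lin_combs (adjoin A x) H" if "g \<in> Gk k" for g
      using that by (intro lin_combs_closed(4)[OF B(1) H]) (auto simp: H_def k_def)
    have xB: "x ^ j \<in> adjoin A x" for j by (induction j) (auto intro: B' B)
    \<comment> \<open>The third claim says that the lift of a combination has leading term
      (combination) x^k up to smaller formal degree; all three are carried through the same
      induction on subsets of the generators.\<close>
    have sums: "(\<Sum>g\<in>T. d g * p k g) \<in> lin_combs (adjoin A x) H \<and> (\<Sum>g\<in>T. d g * p k g) \<in> I \<and>
        (\<Sum>g\<in>T. d g * p k g) - (\<Sum>g\<in>T. d g * g) * x ^ k \<in> poly_upto A x k" if "finite T" "T \<subseteq> Gk k" for T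
      using that
    proof (induction T)
      case empty
      then show ?case using I0 by (simp add: lin_combs_closed[OF B(1)] poly_upto_closed[OF A])
    next
      case (insert g T)
      have g: "g \<in> L k" using insert.prems Gk(2) by auto
      obtain h where h: "h \<in> poly_upto A x k" "p k g = h + g * x ^ k" using p(2)[OF g] by blast
      have dB: "d g \<in> adjoin A x" using d(2) B(2) by blast
      have "d g * h + ((\<Sum>g\<in>T. d g * p k g) - (\<Sum>g\<in>T. d g * g) * x ^ k) \<in> poly_upto A x k"
        using insert d(2) h by (intro poly_upto_closed(2)[OF A] poly_upto_closed(4)[OF A]) auto
      moreover have "d g * p k g + (\<Sum>g\<in>T. d g * p k g) \<in> lin_combs (adjoin A x) H"
        using insert pH dB by (intro lin_combs_closed(2,3)[OF B(1)]) auto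
      moreover have "d g * p k g + (\<Sum>g\<in>T. d g * p k g) \<in> I"
        using insert p(1)[OF g] dB by (intro Iadd Imult) auto
      ultimately show ?case using insert.hyps h(2) by (simp add: algebra_simps)
    qed
    from sums[OF Gk(1) order_refl] have s: "s \<in> lin_combs (adjoin A x) H" "s \<in> I"
        "s - a * x ^ k \<in> poly_upto A x k"
      unfolding s_def d(1)[symmetric] by auto
    have nk: "n = k + (n - k)" by (simp add: k_def)
    have xs: "x ^ (n - k) * s \<in> lin_combs (adjoin A x) H" "x ^ (n - k) * s \<in> I"
      using s xB by (auto intro: lin_combs_closed(3)[OF B(1)] Imult)
    have "f - x ^ (n - k) * s = f0 - x ^ (n - k) * (s - a * x ^ k)"
      unfolding f(1) by (subst (1) nk) (simp add: power_add algebra_simps)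
    also have "\<dots> \<in> poly_upto A x n"
      using poly_upto_pow[OF A s(3), of "n - k"] f(2) nk by (intro poly_upto_closed(3)[OF A]) auto
    finally have "f - x ^ (n - k) * s \<in> poly_upto A x n" .
    moreover have "f + (- 1) * (x ^ (n - k) * s) \<in> I"
      using B'(4)[OF B'(2) B'(1)] by (intro Iadd Suc.prems Imult xs) simp
    ultimately have "f - x ^ (n - k) * s \<in> lin_combs (adjoin A x) H" by (intro Suc.IH) auto
    from lin_combs_closed(2)[OF B(1) this xs(1)] show ?case by simp
  qed
  then have "I \<subseteq> lin_combs (adjoin A x) H" using I unfolding ideal_in_def adjoin_def by blast
  then show "\<exists>G. finite G \<and> G \<subseteq> I \<and> I \<subseteq> lin_combs (adjoin A x) G" using H HI by blast
qed

lemma noetherian_mpoly: "noetherian_in (UNIV :: ('v::finite, 'r::field) mpoly set)"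
proof -
  \<comment> \<open>The ring is built up inside its own type: the constants form a field, hence are
    noetherian, and the variables are adjoined one at a time.\<close>
  have "\<exists>A :: ('v, 'r) mpoly set. is_subring A \<and> noetherian_in A \<and> range Const \<subseteq> A \<and> Var ` F \<subseteq> A"
      if "finite F" for F
    using that
  proof (induction F)
    case empty
    let ?A = "range Const :: ('v, 'r) mpoly set"
    have "is_subring ?A"
      unfolding is_subring_def by (auto simp flip: Const_simps)
    moreover have "noetherian_in ?A"
      unfolding noetherian_in_def
    proof (intro allI impI)
      fix I assume I: "ideal_in ?A I"
      show "\<exists>G. finite G \<and> G \<subseteq> I \<and> I \<subseteq> lin_combs ?A G"
      proof (cases "I \<subseteq> {0}")
        case True
        then show ?thesis by (intro exI[of _ "{}"]) (auto simp: lin_combs_def)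
      next
        case False
        then obtain c where c: "Const c \<in> I" "Const c \<noteq> (0 :: ('v, 'r) mpoly)"
            using I unfolding ideal_in_def by blast
        then have "c \<noteq> 0" by (auto simp: Const_simps)
        then have "Const d = Const (d / c) * Const c" for d by (simp flip: Const_simps)
        then have "Const d \<in> lin_combs ?A {Const c}" for d
          unfolding lin_combs_def by (intro CollectI exI[of _ "\<lambda>_. Const (d / c)"]) simp
        then show ?thesis using I c by (intro exI[of _ "{Const c}"]) (auto simp: ideal_in_def)
      qed
    qed
    ultimately show ?case by blast
  next
    case (insert v F)
    then obtain A :: "('v, 'r) mpoly set" where A: "is_subring A" "noetherian_in A" "range Const \<subseteq> A"
        "Var ` F \<subseteq> A" by blast
    then show ?case using noetherian_adjoin[OF A(1,2), of "Var v"] is_subring_adjoin[OF A(1), of "Var v"]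
      by (intro exI[of _ "adjoin A (Var v)"]) auto
  qed
  then obtain A :: "('v, 'r) mpoly set" where A: "is_subring A" "noetherian_in A" "range Const \<subseteq> A"
      "range Var \<subseteq> A"
    by (metis finite)
  have "p \<in> A" for p
  proof (induction p rule: mpoly_induct)
    case (mult_Var p i)
    then show ?case using A(4) by (intro is_subringD(5)[OF A(1)]) auto
  qed (use A(3) in \<open>auto intro: is_subringD(3)[OF A(1)]\<close>)
  then show ?thesis using A(2) by (metis UNIV_eq_I)
qed

text \<open>Definability permits finitely many conditions only, so the basis theorem is used to
  replace the ideal by finitely many equations.\<close>

lemma definable_rational_points:
  fixes I :: "('v::finite, 'r::real_closed_field) mpoly set"
  assumes "mideal I"
  shows "definable (\<lambda>x. x \<in> rational_points I)"
proof -
  have "ideal_in UNIV I" using assms by (auto simp: ideal_in_def mideal_def)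
  then obtain G where G: "finite G" "G \<subseteq> I" "I \<subseteq> lin_combs UNIV G"
    using noetherian_mpoly unfolding noetherian_in_def by blast
  have "x \<in> rational_points I \<longleftrightarrow> (\<forall>g\<in>G. peval x g = 0)" for x
  proof
    assume G0: "\<forall>g\<in>G. peval x g = 0"
    have "peval x p = 0" if "p \<in> I" for p
      using that G(3) G0 by (auto simp: lin_combs_def peval_sum peval_simps)
    then show "x \<in> rational_points I" by (simp add: rational_points_def)
  qed (use G(2) in \<open>auto simp: rational_points_def\<close>)
  then show ?thesis using G(1) by (simp add: definable_ball definable_eq0 peval_polfun)
qed

section \<open>Orthogonal decomposition\<close>

text \<open>The form \<beta> is constrained on \<open>U\<close> only, because the inner product of a
  tensor makes sense only on its image. The finite set \<open>B0\<close> bounds the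
  dimension.\<close>

locale orthogonal_action = vector_space scale
  for scale :: "'r::real_closed_field \<Rightarrow> 'x::ab_group_add \<Rightarrow> 'x" (infixr \<open>*s\<close> 75) +
  fixes S :: "'p set" and T :: "'p \<Rightarrow> 'x \<Rightarrow> 'x" and U :: "'x set" and \<beta> :: "'x \<Rightarrow> 'x \<Rightarrow> 'r"
    and B0 :: "'x set"
  assumes T_add: "g \<in> S \<Longrightarrow> T g (x + y) = T g x + T g y"
    and T_scale: "g \<in> S \<Longrightarrow> T g (c *s x) = c *s T g x"
    and U: "subspace U" and finB0: "finite B0" and UB0: "U \<subseteq> span B0"
    and T_U: "g \<in> S \<Longrightarrow> x \<in> U \<Longrightarrow> T g x \<in> U"
    and \<beta>_add: "x \<in> U \<Longrightarrow> y \<in> U \<Longrightarrow> z \<in> U \<Longrightarrow> \<beta> (x + y) z = \<beta> x z + \<beta> y z"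
    and \<beta>_scale: "x \<in> U \<Longrightarrow> z \<in> U \<Longrightarrow> \<beta> (c *s x) z = c * \<beta> x z"
    and \<beta>_sym: "x \<in> U \<Longrightarrow> z \<in> U \<Longrightarrow> \<beta> x z = \<beta> z x"
    and \<beta>_pos: "x \<in> U \<Longrightarrow> x \<noteq> 0 \<Longrightarrow> 0 < \<beta> x x"
    and T_inv: "g \<in> S \<Longrightarrow> \<exists>h\<in>S. \<forall>x\<in>U. T g (T h x) = x"
    and T_\<beta>: "g \<in> S \<Longrightarrow> x \<in> U \<Longrightarrow> y \<in> U \<Longrightarrow> \<beta> (T g x) (T g y) = \<beta> x y"
begin

definition invariant :: "'x set \<Rightarrow> bool" where
  "invariant W \<longleftrightarrow> subspace W \<and> W \<subseteq> U \<and> (\<forall>g\<in>S. \<forall>x\<in>W. T g x \<in> W)"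

definition orthonormal :: "'x set \<Rightarrow> bool" where
  "orthonormal C \<longleftrightarrow> finite C \<and> C \<subseteq> U \<and> (\<forall>x\<in>C. \<forall>y\<in>C. \<beta> x y = (if x = y then 1 else 0))"

definition irreducible_subspace :: "'x set \<Rightarrow> bool" where
  "irreducible_subspace W \<longleftrightarrow> invariant W \<and> W \<noteq> {0} \<and>
     (\<forall>W'. invariant W' \<longrightarrow> W' \<subseteq> W \<longrightarrow> W' = {0} \<or> W' = W)"

lemma span_U: "C \<subseteq> U \<Longrightarrow> span C \<subseteq> U"
  using U by (rule span_minimal[rotated])

lemma \<beta>_0: "z \<in> U \<Longrightarrow> \<beta> 0 z = 0"
  using \<beta>_scale[of 0 z 0] subspace_0[OF U] by simp

lemma \<beta>_sum:
  assumes "finite A" "\<And>i. i \<in> A \<Longrightarrow> f i \<in> U" "z \<in> U"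
  shows "\<beta> (\<Sum>i\<in>A. c i *s f i) z = (\<Sum>i\<in>A. c i * \<beta> (f i) z)"
  using assms
  by (induction A) (auto simp: \<beta>_0 \<beta>_add \<beta>_scale subspace_scale[OF U] subspace_sum[OF U])

lemma orthonormal_coeff:
  assumes "orthonormal C" "y \<in> C"
  shows "\<beta> (\<Sum>x\<in>C. c x *s x) y = c y"
proof -
  have C: "finite C" "C \<subseteq> U" "\<And>x. x \<in> C \<Longrightarrow> \<beta> x y = (if x = y then 1 else 0)"
    using assms by (auto simp: orthonormal_def)
  have "\<beta> (\<Sum>x\<in>C. c x *s x) y = (\<Sum>x\<in>C. c x * \<beta> x y)" by (rule \<beta>_sum) (use C assms in auto)
  also have "\<dots> = (\<Sum>x\<in>C. if x = y then c x else 0)" by (intro sum.cong refl) (simp add: C(3))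
  finally show ?thesis using assms(2) C(1) by simp
qed

lemma orthonormal_expand:
  assumes "orthonormal C" "x \<in> span C"
  shows "x = (\<Sum>y\<in>C. \<beta> x y *s y)"
proof -
  have "finite C" using assms(1) by (simp add: orthonormal_def)
  then obtain c where c: "x = (\<Sum>y\<in>C. c y *s y)" using assms(2) by (auto simp: span_finite)
  then have "\<beta> x y = c y" if "y \<in> C" for y using orthonormal_coeff[OF assms(1) that, of c] by simp
  then have "(\<Sum>y\<in>C. \<beta> x y *s y) = (\<Sum>y\<in>C. c y *s y)" by simp
  then show ?thesis using c by simp
qed

lemma orthonormal_independent:
  assumes "orthonormal C"
  shows "independent C"
proof
  have fin: "finite C" and CU: "C \<subseteq> U" using assms by (auto simp: orthonormal_def)
  assume "dependent C"
  then obtain u y where u: "y \<in> C" "u y \<noteq> 0" "(\<Sum>x\<in>C. u x *s x) = 0" using dependent_finite[OF fin] by blast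
  then have "u y = \<beta> 0 y" using orthonormal_coeff[OF assms u(1), of u] by simp
  then show False using u \<beta>_0 CU by auto
qed

lemma orthonormal_card: "orthonormal C \<Longrightarrow> card C \<le> card B0"
proof -
  assume C: "orthonormal C"
  then have "C \<subseteq> span B0" using UB0 by (auto simp: orthonormal_def)
  then show ?thesis using independent_span_bound[OF finB0 orthonormal_independent[OF C]] by blast
qed

text \<open>Gram-Schmidt as a maximality argument: sizes of orthonormal sets are bounded by
  independence, so one of greatest size between \<open>C\<close> and \<open>W\<close> exists. If its
  span missed a vector, the component orthogonal to it could be normalised, by a square root in the
  field, and added.\<close>

lemma orthonormal_extend:
  assumes C: "orthonormal C" "C \<subseteq> W" and W: "subspace W" "W \<subseteq> U"
  obtains D where "orthonormal D" "C \<subseteq> D" "span D = W"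
proof -
  define P where "P D \<longleftrightarrow> orthonormal D \<and> C \<subseteq> D \<and> D \<subseteq> W" for D
  have "P C" using C by (simp add: P_def)
  moreover have "\<forall>D. P D \<longrightarrow> card D \<le> card B0" using orthonormal_card by (simp add: P_def)
  ultimately obtain D where D: "P D" "\<And>D'. P D' \<Longrightarrow> card D' \<le> card D"
    using ex_has_greatest_nat[of P C card "Suc (card B0)"] by (auto simp: less_Suc_eq_le)
  have o: "orthonormal D" and DW: "D \<subseteq> W" and fin: "finite D" and DU: "D \<subseteq> U"
    using D(1) by (auto simp: P_def orthonormal_def)
  have "W \<subseteq> span D"
  proof
    fix x assume x: "x \<in> W"
    define y where "y = x - (\<Sum>z\<in>D. \<beta> x z *s z)"
    have yW: "y \<in> W" unfolding y_def
      using x DW by (intro subspace_diff[OF W(1)] subspace_sum[OF W(1)] subspace_scale[OF W(1)]) auto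
    then have yU: "y \<in> U" using W by blast
    have xU: "x \<in> U" using x W by blast
    have orth: "\<beta> y z = 0" if "z \<in> D" for z
    proof -
      have sU: "(\<Sum>z\<in>D. \<beta> x z *s z) \<in> U" using DU by (intro subspace_sum[OF U] subspace_scale[OF U]) auto
      have "\<beta> (y + (\<Sum>z\<in>D. \<beta> x z *s z)) z = \<beta> y z + \<beta> (\<Sum>z\<in>D. \<beta> x z *s z) z"
        by (rule \<beta>_add[OF yU sU]) (use DU that in auto)
      then show ?thesis using orthonormal_coeff[OF o that, of "\<beta> x"] by (simp add: y_def)
    qed
    have "y = 0"
    proof (rule ccontr)
      assume "y \<noteq> 0"
      then have pos: "0 < \<beta> y y" using \<beta>_pos yU by blast
      then obtain s where s: "0 \<le> s" "s ^ 2 = \<beta> y y" using rcf_sqrt[of "\<beta> y y"] by auto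
      then have "s \<noteq> 0" using pos by auto
      define n where "n = (1 / s) *s y"
      have nU: "n \<in> U" "n \<in> W" unfolding n_def using yU yW by (auto intro: subspace_scale U W)
      have "\<beta> n n = (1 / s) * \<beta> y n" using \<beta>_scale[OF yU nU(1), of "1 / s"] by (simp add: n_def)
      also have "\<beta> y n = \<beta> n y" by (rule \<beta>_sym[OF yU nU(1)])
      also have "\<beta> n y = (1 / s) * s ^ 2" using \<beta>_scale[OF yU yU, of "1 / s"] by (simp add: n_def s(2))
      finally have nn: "\<beta> n n = 1" using \<open>s \<noteq> 0\<close> by (simp add: power2_eq_square)
      have nz: "\<beta> n z = 0" "\<beta> z n = 0" if "z \<in> D" for z
      proof -
        have zU: "z \<in> U" using that DU by blast
        show "\<beta> n z = 0" unfolding n_def using orth[OF that] \<beta>_scale[OF yU zU] by simp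
        then show "\<beta> z n = 0" using \<beta>_sym[OF nU(1) zU] by simp
      qed
      have "n \<notin> D" using nz nn by force
      moreover have "P (insert n D)"
        using D(1) nU nn nz unfolding P_def orthonormal_def by auto
      ultimately show False using D(2)[of "insert n D"] fin by simp
    qed
    then have eq: "(\<Sum>z\<in>D. \<beta> x z *s z) = x" by (simp add: y_def)
    have "(\<Sum>z\<in>D. \<beta> x z *s z) \<in> span D" by (intro span_sum span_scale span_base)
    then show "x \<in> span D" unfolding eq .
  qed
  moreover have "span D \<subseteq> W" using DW W(1) by (rule span_minimal)
  ultimately show ?thesis using that o D(1) by (auto simp: P_def)
qed

lemma orthonormal_empty: "orthonormal {}"
  by (simp add: orthonormal_def)

lemma orthonormal_same_span_card:
  assumes "orthonormal C" "orthonormal D" "span C = span D"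
  shows "card C = card D"
proof -
  have "finite C" "finite D" using assms by (auto simp: orthonormal_def)
  then show ?thesis
    using independent_span_bound[of C D] independent_span_bound[of D C] orthonormal_independent assms
    by (metis order_antisym span_superset)
qed

text \<open>An invariant subspace of least positive dimension is irreducible; dimensions are
  compared as sizes of orthonormal bases.\<close>

lemma invariant_contains_irreducible:
  assumes "orthonormal D" "invariant (span D)" "D \<noteq> {}"
  obtains C where "orthonormal C" "C \<subseteq> span D" "C \<noteq> {}" "irreducible_subspace (span C)"
proof -
  define P where "P C \<longleftrightarrow> orthonormal C \<and> C \<subseteq> span D \<and> C \<noteq> {} \<and> invariant (span C)" for C
  have "P D" using assms span_superset by (auto simp: P_def)
  then obtain C where C: "P C" "\<And>C'. P C' \<Longrightarrow> card C \<le> card C'"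
    using ex_has_least_nat[of P D card] by blast
  have o: "orthonormal C" and CD: "C \<subseteq> span D" and ne: "C \<noteq> {}" and inv: "invariant (span C)"
    using C(1) by (auto simp: P_def)
  have "W = {0} \<or> W = span C" if W: "invariant W" "W \<subseteq> span C" for W
  proof -
    have sub: "subspace W" "W \<subseteq> U" using W by (auto simp: invariant_def)
    obtain E where E: "orthonormal E" "span E = W"
      by (rule orthonormal_extend[OF orthonormal_empty _ sub]) auto
    show ?thesis
    proof (cases "E = {}")
      case True
      then show ?thesis using E by auto
    next
      case False
      have EC: "E \<subseteq> span C" using E W(2) span_superset[of E] by blast
      have "span C \<subseteq> span D" using CD by (simp add: span_minimal)
      then have "P E" using E False W EC by (auto simp: P_def)
      then have le: "card C \<le> card E" by (rule C(2))
      have sC: "subspace (span C)" "span C \<subseteq> U" using inv by (auto simp: invariant_def)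
      obtain F where F: "orthonormal F" "E \<subseteq> F" "span F = span C"
        by (rule orthonormal_extend[OF E(1) EC sC])
      have "card F = card C" by (rule orthonormal_same_span_card[OF F(1) o F(3)])
      moreover have "finite F" using F by (simp add: orthonormal_def)
      ultimately have "E = F" using F(2) le by (metis card_seteq)
      then show ?thesis using E F by auto
    qed
  qed
  moreover have "span C \<noteq> {0}"
  proof
    assume "span C = {0}"
    then have "C \<subseteq> {0}" using span_superset by blast
    then show False using ne o \<beta>_0 orthonormal_independent[OF o] dependent_zero by auto
  qed
  ultimately show ?thesis using that o CD ne inv by (auto simp: irreducible_subspace_def)
qed

text \<open>Induction on the dimension: an irreducible subspace is split off, and its orthogonal
  complement is again invariant because \<open>S\<close> acts by isometries.\<close>

theorem orthogonal_decomposition: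
  assumes "invariant W"
  obtains C where "orthonormal C" "span C = W"
    "\<And>x. x \<in> C \<Longrightarrow> \<exists>D. orthonormal D \<and> x \<in> D \<and> irreducible_subspace (span D)"
proof -
  have "\<exists>C. orthonormal C \<and> span C = span D \<and> (\<forall>x\<in>C. \<exists>D. orthonormal D \<and> x \<in> D \<and> irreducible_subspace (span D))"
    if "orthonormal D" "invariant (span D)" for D
    using that
  proof (induction "card D" arbitrary: D rule: less_induct)
    case less
    show ?case
    proof (cases "D = {}")
      case True
      then show ?thesis by (intro exI[of _ "{}"]) (simp add: orthonormal_empty)
    next
      case False
      obtain C1 where C1: "orthonormal C1" "C1 \<subseteq> span D" "C1 \<noteq> {}" "irreducible_subspace (span C1)"
        by (rule invariant_contains_irreducible[OF less.prems False])
      have W: "subspace (span D)" "span D \<subseteq> U" using less.prems by (auto simp: invariant_def)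
      obtain C where C: "orthonormal C" "C1 \<subseteq> C" "span C = span D"
        by (rule orthonormal_extend[OF C1(1,2) W])
      define C2 where "C2 = C - C1"
      have finC: "finite C" "C \<subseteq> U" using C by (auto simp: orthonormal_def)
      have o2: "orthonormal C2" using C by (auto simp: orthonormal_def C2_def)
      have C1U: "span C1 \<subseteq> U" using C1 by (intro span_U) (simp add: orthonormal_def)
      have C2U: "span C2 \<subseteq> U" using o2 by (intro span_U) (simp add: orthonormal_def)
      have orth: "\<beta> x y = 0" if x: "x \<in> span C1" and y: "y \<in> span C2" for x y
      proof -
        have 1: "\<beta> z w = 0" if "z \<in> C1" "w \<in> C2" for z w
          using C(1,2) that by (auto simp: orthonormal_def C2_def)
        have 2: "\<beta> x w = 0" if w: "w \<in> C2" for w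
        proof -
          have wU: "w \<in> U" using w C2U span_base by blast
          have "\<beta> (\<Sum>z\<in>C1. \<beta> x z *s z) w = (\<Sum>z\<in>C1. \<beta> x z * \<beta> z w)"
            by (rule \<beta>_sum) (use C1 wU in \<open>auto simp: orthonormal_def\<close>)
          then show ?thesis using 1 w orthonormal_expand[OF C1(1) x] by simp
        qed
        have xU: "x \<in> U" using x C1U by blast
        have yU: "y \<in> U" using y C2U by blast
        have "\<beta> (\<Sum>w\<in>C2. \<beta> y w *s w) x = (\<Sum>w\<in>C2. \<beta> y w * \<beta> w x)"
          by (rule \<beta>_sum) (use o2 xU in \<open>auto simp: orthonormal_def\<close>)
        also have "\<dots> = 0"
        proof (rule sum.neutral, rule)
          fix w assume w: "w \<in> C2"
          then have "w \<in> U" using C2U span_base by blast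
          then show "\<beta> y w * \<beta> w x = 0" using 2[OF w] \<beta>_sym[OF _ xU, of w] by simp
        qed
        finally show ?thesis using orthonormal_expand[OF o2 y] \<beta>_sym[OF xU yU] by simp
      qed
      have inv1: "invariant (span C1)" using C1(4) by (simp add: irreducible_subspace_def)
      have inv2: "invariant (span C2)"
        unfolding invariant_def
      proof (intro conjI ballI)
        fix g x assume g: "g \<in> S" and x: "x \<in> span C2"
        obtain h where h: "h \<in> S" "\<And>x. x \<in> U \<Longrightarrow> T g (T h x) = x" using T_inv[OF g] by blast
        have xD: "x \<in> span C" using x span_mono[of C2 C] by (auto simp: C2_def)
        then have TgxC: "T g x \<in> span C" using less.prems(2) g C(3) by (auto simp: invariant_def)
        have xU: "x \<in> U" using x C2U by blast
        have "\<beta> (T g x) y = 0" if y: "y \<in> C1" for y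
        proof -
          have yU: "y \<in> U" and y1: "y \<in> span C1" using y C1U span_base by blast+
          have hy: "T h y \<in> span C1" using inv1 h(1) y1 by (auto simp: invariant_def)
          then have hyU: "T h y \<in> U" using C1U by blast
          \<comment> \<open>y is the image under g of \<open>T h y\<close>, which again lies in the
            irreducible part and so is orthogonal to x.\<close>
          have "\<beta> (T g x) y = \<beta> (T g x) (T g (T h y))" using h(2)[OF yU] by simp
          also have "\<dots> = \<beta> x (T h y)" by (rule T_\<beta>[OF g xU hyU])
          also have "\<dots> = 0" using orth[OF hy x] \<beta>_sym[OF xU hyU] by simp
          finally show ?thesis .
        qed
        then have "(\<Sum>y\<in>C. \<beta> (T g x) y *s y) = (\<Sum>y\<in>C2. \<beta> (T g x) y *s y)"
          using finC by (intro sum.mono_neutral_right) (auto simp: C2_def)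
        then have eq: "(\<Sum>y\<in>C2. \<beta> (T g x) y *s y) = T g x" using orthonormal_expand[OF C(1) TgxC] by simp
        have "(\<Sum>y\<in>C2. \<beta> (T g x) y *s y) \<in> span C2" by (intro span_sum span_scale span_base)
        then show "T g x \<in> span C2" unfolding eq .
      qed (use C2U in auto)
      have "card C2 < card C"
        unfolding C2_def using finC C(2) C1(3) by (intro psubset_card_mono) auto
      also have "card C = card D" by (rule orthonormal_same_span_card[OF C(1) less.prems(1) C(3)])
      finally obtain E where E: "orthonormal E" "span E = span C2"
        "\<forall>x\<in>E. \<exists>D. orthonormal D \<and> x \<in> D \<and> irreducible_subspace (span D)"
        using less.hyps[OF _ o2 inv2] by blast
      have "orthonormal (C1 \<union> E)"
      proof -
        have 0: "\<beta> x y = 0" "\<beta> y x = 0" if xy: "x \<in> C1" "y \<in> E" for x y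
        proof -
          have "x \<in> span C1" "y \<in> span C2" using xy E(2) span_base by blast+
          moreover from this have "x \<in> U" "y \<in> U" using C1U C2U by blast+
          ultimately show "\<beta> x y = 0" "\<beta> y x = 0" using orth[of x y] \<beta>_sym[of x y] by simp_all
        qed
        then have "x \<noteq> y" if "x \<in> C1" "y \<in> E" for x y
          using that C1(1) unfolding orthonormal_def by force
        then have "\<beta> x y = (if x = y then 1 else 0)" if xy: "x \<in> C1 \<union> E" "y \<in> C1 \<union> E" for x y
        proof -
          have o: "\<And>x y. x \<in> C1 \<Longrightarrow> y \<in> C1 \<Longrightarrow> \<beta> x y = (if x = y then 1 else 0)"
            "\<And>x y. x \<in> E \<Longrightarrow> y \<in> E \<Longrightarrow> \<beta> x y = (if x = y then 1 else 0)"
            using C1(1) E(1) by (auto simp: orthonormal_def)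
          consider "x \<in> C1" "y \<in> C1" | "x \<in> C1" "y \<in> E" | "x \<in> E" "y \<in> C1" | "x \<in> E" "y \<in> E"
            using xy by blast
          then show ?thesis
          proof cases
            case 2
            then show ?thesis using 0(1)[OF 2] \<open>\<And>y x. x \<in> C1 \<Longrightarrow> y \<in> E \<Longrightarrow> x \<noteq> y\<close>[OF 2] by simp
          next
            case 3
            then show ?thesis using 0(2)[OF 3(2,1)] \<open>\<And>y x. x \<in> C1 \<Longrightarrow> y \<in> E \<Longrightarrow> x \<noteq> y\<close>[OF 3(2,1)] by simp
          qed (use o in auto)
        qed
        then show ?thesis using C1(1) E(1) unfolding orthonormal_def by blast
      qed
      moreover have "span (C1 \<union> E) = span D"
      proof -
        have "span (C1 \<union> E) = span (C1 \<union> C2)" using E(2) by (simp add: span_Un)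
        also have "C1 \<union> C2 = C" using C(2) by (auto simp: C2_def)
        finally show ?thesis using C(3) by simp
      qed
      ultimately show ?thesis using C1 E(3) by (intro exI[of _ "C1 \<union> E"]) blast
    qed
  qed
  moreover obtain D where "orthonormal D" "span D = W"
    by (rule orthonormal_extend[OF orthonormal_empty, of W]) (use assms in \<open>auto simp: invariant_def\<close>)
  ultimately show ?thesis using assms that by metis
qed

end

section \<open>Actions on affine varieties\<close>

subsection \<open>Normal forms modulo an ideal\<close>

definition cmul :: "'r::field \<Rightarrow> ('v, 'r) mpoly \<Rightarrow> ('v, 'r) mpoly" where
  "cmul c p = Const c * p"

global_interpretation MP: vector_space "cmul :: 'r::field \<Rightarrow> ('v, 'r) mpoly \<Rightarrow> ('v, 'r) mpoly"
  by unfold_locales (simp_all add: cmul_def Const_simps algebra_simps)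

global_interpretation MPP: vector_space_pair
  "cmul :: 'r::field \<Rightarrow> ('v, 'r) mpoly \<Rightarrow> ('v, 'r) mpoly" "cmul :: 'r \<Rightarrow> ('v, 'r) mpoly \<Rightarrow> ('v, 'r) mpoly" ..

lemma vector_space_field: "vector_space ((*) :: 'r::field \<Rightarrow> 'r \<Rightarrow> 'r)"
  by unfold_locales (simp_all add: algebra_simps)

lemma dual_functionals:
  fixes B :: "('v, 'r::field) mpoly set"
  assumes "MP.independent B"
  obtains l :: "('v, 'r) mpoly \<Rightarrow> ('v, 'r) mpoly \<Rightarrow> 'r"
  where "\<And>b x y. l b (x + y) = l b x + l b y" "\<And>b c x. l b (cmul c x) = c * l b x"
    "\<And>b c. c \<in> B \<Longrightarrow> l b c = (if b = c then 1 else 0)"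
proof -
  interpret F: vector_space "(*) :: 'r \<Rightarrow> 'r \<Rightarrow> 'r" by (rule vector_space_field)
  interpret P: vector_space_pair "cmul :: 'r \<Rightarrow> ('v, 'r) mpoly \<Rightarrow> ('v, 'r) mpoly" "(*) :: 'r \<Rightarrow> 'r \<Rightarrow> 'r" ..
  have "\<exists>f. (\<forall>x y. f (x + y) = f x + f y) \<and> (\<forall>c x. f (cmul c x) = c * f x)
      \<and> (\<forall>c\<in>B. f c = (if b = c then 1 else 0))" for b
  proof -
    obtain f where f: "Vector_Spaces.linear cmul (*) f" "\<forall>c\<in>B. f c = (if b = c then 1 else 0)"
      using P.linear_independent_extend[OF assms, of "\<lambda>c. if b = c then 1 else 0"] by blast
    interpret f: Vector_Spaces.linear cmul "(*)" f by (rule f(1))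
    show ?thesis using f(2) f.add f.scale by blast
  qed
  then have "\<exists>l. \<forall>b. (\<forall>x y. l b (x + y) = l b x + l b y) \<and> (\<forall>c x. l b (cmul c x) = c * l b x) \<and>
      (\<forall>c\<in>B. l b c = (if b = c then 1 else 0))"
    by (intro choice allI)
  then obtain l :: "('v, 'r) mpoly \<Rightarrow> ('v, 'r) mpoly \<Rightarrow> 'r" where
    "\<forall>b. (\<forall>x y. l b (x + y) = l b x + l b y) \<and> (\<forall>c x. l b (cmul c x) = c * l b x) \<and>
      (\<forall>c\<in>B. l b c = (if b = c then 1 else 0))" ..
  then show ?thesis by (intro that[of l]) simp_all
qed

lemma mideal_subspace: "mideal V \<Longrightarrow> MP.subspace V"
  by (auto simp: MP.subspace_def cmul_def mideal_def)

text \<open>A linear section of the quotient map onto R[V]: projection along \<open>V\<close> onto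
  some vector space complement, obtained by extending a basis of \<open>V\<close>. It need not be
  multiplicative, but it moves the linear algebra of R[V] into the polynomial ring.\<close>

definition nf :: "('v, 'r::field) mpoly set \<Rightarrow> ('v, 'r) mpoly \<Rightarrow> ('v, 'r) mpoly" where
  "nf V = (SOME f. (\<forall>x y. f (x + y) = f x + f y) \<and> (\<forall>c x. f (cmul c x) = cmul c (f x)) \<and>
     (\<forall>x. f x - x \<in> V) \<and> (\<forall>x\<in>V. f x = 0))"

lemma nf_exists:
  fixes V :: "('v, 'r::field) mpoly set"
  assumes "mideal V"
  shows "\<exists>f. (\<forall>x y. f (x + y) = f x + f y) \<and> (\<forall>c x. f (cmul c x) = cmul c (f x)) \<and>
     (\<forall>x. f x - x \<in> V) \<and> (\<forall>x\<in>V. f x = 0)"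
proof -
  note V = mideal_subspace[OF assms]
  obtain B where B: "B \<subseteq> V" "MP.independent B" "V \<subseteq> MP.span B" by (rule MP.maximal_independent_subset)
  obtain E where E: "B \<subseteq> E" "MP.independent E" "UNIV \<subseteq> MP.span E"
    by (rule MP.maximal_independent_subset_extend[of B UNIV]) (use B(2) in auto)
  obtain f where f: "Vector_Spaces.linear cmul cmul f" "\<forall>b\<in>E. f b = (if b \<in> B then 0 else b)"
    using MPP.linear_independent_extend[OF E(2), of "\<lambda>b. if b \<in> B then 0 else b"] by blast
  interpret f: Vector_Spaces.linear cmul cmul f by (rule f(1))
  have "f x = 0" if "x \<in> V" for x
  proof -
    have "x \<in> MP.span B" using that B by blast
    then show ?thesis
      by (induction rule: MP.span_induct_alt) (use f(2) E(1) in \<open>auto simp: f.add f.scale f.zero\<close>)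
  qed
  moreover have "f x - x \<in> V" for x
  proof -
    have "x \<in> MP.span E" using E by blast
    then show ?thesis
    proof (induction rule: MP.span_induct_alt)
      case base
      then show ?case using MP.subspace_0[OF V] by (simp add: f.zero)
    next
      case (step c x y)
      have "f x - x \<in> V" using step(1) f(2) B(1) MP.subspace_0[OF V] MP.subspace_neg[OF V, of x] by auto
      then have "cmul c (f x - x) + (f y - y) \<in> V" using step
        by (intro MP.subspace_add[OF V] MP.subspace_scale[OF V])
      moreover have "f (cmul c x + y) - (cmul c x + y) = cmul c (f x - x) + (f y - y)"
        by (simp add: f.add f.scale MP.scale_right_diff_distrib)
      ultimately show ?case by (simp only:)
    qed
  qed
  ultimately show ?thesis using f.add f.scale by blast
qed

context
  fixes V :: "('v, 'r::field) mpoly set"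
  assumes V: "mideal V"
begin

lemma nf_add: "nf V (x + y) = nf V x + nf V y"
  and nf_cmul: "nf V (cmul c x) = cmul c (nf V x)"
  and nf_minus_self: "nf V x - x \<in> V"
  and nf_ideal: "x \<in> V \<Longrightarrow> nf V x = 0"
proof -
  note * = someI_ex[OF nf_exists[OF V], folded nf_def]
  show "nf V (x + y) = nf V x + nf V y" by (rule *[THEN conjunct1, rule_format])
  show "nf V (cmul c x) = cmul c (nf V x)" by (rule *[THEN conjunct2, THEN conjunct1, rule_format])
  show "nf V x - x \<in> V" by (rule *[THEN conjunct2, THEN conjunct2, THEN conjunct1, rule_format])
  show "x \<in> V \<Longrightarrow> nf V x = 0" by (rule *[THEN conjunct2, THEN conjunct2, THEN conjunct2, rule_format])
qed

lemma nf_0: "nf V 0 = 0"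
  by (rule nf_ideal[OF mideal_0[OF V]])

lemma nf_diff: "nf V (x - y) = nf V x - nf V y"
  using nf_add[of "x - y" y] by simp

lemma nf_sum: "nf V (sum f A) = (\<Sum>i\<in>A. nf V (f i))"
  by (induction A rule: infinite_finite_induct) (simp_all add: nf_0 nf_add)

lemma nf_eq_iff: "nf V x = nf V y \<longleftrightarrow> x - y \<in> V"
proof
  assume *: "nf V x = nf V y"
  have "(nf V y - y) - (nf V x - x) \<in> V" by (intro mideal_diff[OF V] nf_minus_self)
  then show "x - y \<in> V" using * by simp
next
  assume "x - y \<in> V"
  then show "nf V x = nf V y" using nf_ideal[of "x - y"] by (simp add: nf_diff)
qed

lemma nf_nf: "nf V (nf V x) = nf V x"
  unfolding nf_eq_iff by (rule nf_minus_self)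

lemma nf_mult: "nf V (nf V x * nf V y) = nf V (x * y)"
  unfolding nf_eq_iff
proof -
  have "nf V x * nf V y - x * y = nf V x * (nf V y - y) + (nf V x - x) * y" by (simp add: algebra_simps)
  also have "\<dots> \<in> V" by (intro mideal_add[OF V] mideal_mult[OF V] mideal_mult_right[OF V] nf_minus_self)
  finally show "nf V x * nf V y - x * y \<in> V" .
qed

lemma subspace_range_nf: "MP.subspace (range (nf V))"
proof (rule MP.subspaceI)
  show "0 \<in> range (nf V)" by (metis nf_0 rangeI)
  show "\<And>x y. x \<in> range (nf V) \<Longrightarrow> y \<in> range (nf V) \<Longrightarrow> x + y \<in> range (nf V)"
    by (metis (mono_tags, lifting) image_iff nf_add rangeI)
  show "\<And>c x. x \<in> range (nf V) \<Longrightarrow> cmul c x \<in> range (nf V)"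
    by (metis (mono_tags, lifting) image_iff nf_cmul rangeI)
qed

end

lemma lookup_cmul: "Poly_Mapping.lookup (cmul c p) m = c * Poly_Mapping.lookup p m"
proof -
  have "cmul c p = Poly_Mapping.map ((*) c) p"
    by (simp add: cmul_def Const_def mult_map_scale_conv_mult)
  then show ?thesis by (simp add: map.rep_eq when_def)
qed

lemma polfun_bounded:
  fixes q :: "('v \<Rightarrow> 'r::linordered_field) \<Rightarrow> 'r"
  assumes "q \<in> polfun" "\<And>x i. x \<in> S \<Longrightarrow> \<bar>x i\<bar> \<le> B"
  shows "\<exists>C. \<forall>x\<in>S. \<bar>q x\<bar> \<le> C"
  using assms(1)
proof induction
  case (polfun_add p q)
  then obtain C D where "\<forall>x\<in>S. \<bar>p x\<bar> \<le> C" "\<forall>x\<in>S. \<bar>q x\<bar> \<le> D" by blast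
  then show ?case by (intro exI[of _ "C + D"]) (meson abs_triangle_ineq add_mono order_trans)
next
  case (polfun_mult p q)
  then obtain C D where CD: "\<forall>x\<in>S. \<bar>p x\<bar> \<le> C" "\<forall>x\<in>S. \<bar>q x\<bar> \<le> D" by blast
  have "\<bar>p x * q x\<bar> \<le> C * D" if "x \<in> S" for x
    unfolding abs_mult using CD that by (intro mult_mono) (auto intro: order_trans[OF abs_ge_zero])
  then show ?case by blast
qed (use assms(2) in auto)

subsection \<open>The group of rational points and its action on polynomials\<close>

lemma subst_Const: "subst (\<lambda>i. Const (x i)) p = Const (peval x p)"
  by (induction p rule: mpoly_induct) (simp_all add: subst_simps peval_simps Const_simps)

lemma peval_scheme_prod:
  assumes "p \<in> scheme_prod I J" "x \<in> rational_points I" "y \<in> rational_points J"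
  shows "peval (case_sum x y) p = 0"
proof -
  have "subst (\<lambda>v. Const (case_sum x y v)) p \<in> {0}"
    by (rule subst_scheme_prod[OF _ _ _ assms(1)])
      (use assms(2,3) in \<open>auto simp: mideal_def subst_Const rational_points_def Const_simps\<close>)
  then have "Const (peval (case_sum x y) p) = Const 0" by (simp add: subst_Const Const_simps)
  then show ?thesis by (metis peval_simps(4))
qed

lemma subst_congruent:
  assumes "mideal V" "\<And>j. \<phi> j - \<psi> j \<in> V"
  shows "subst \<phi> p - subst \<psi> p \<in> V"
proof (induction p rule: mpoly_induct)
  case (Const c)
  then show ?case using mideal_0[OF assms(1)] by (simp add: subst_simps)
next
  case (add p q)
  have "(subst \<phi> p - subst \<psi> p) + (subst \<phi> q - subst \<psi> q) \<in> V" by (rule mideal_add[OF assms(1) add])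
  then show ?case by (simp add: subst_simps algebra_simps)
next
  case (mult_Var p i)
  have "(subst \<phi> p - subst \<psi> p) * \<phi> i + subst \<psi> p * (\<phi> i - \<psi> i) \<in> V"
    by (intro mideal_add mideal_mult_right mideal_mult assms mult_Var)
  then show ?case by (simp add: subst_simps algebra_simps)
qed

locale compact_G_variety =
  fixes G :: "('g::finite, 'r::real_closed_field) group_scheme"
    and V :: "('n::finite, 'r) mpoly set"
    and \<alpha> :: "'n \<Rightarrow> ('g + 'n, 'r) mpoly"
  assumes lag: "linear_algebraic_group G"
    and dense: "zariski_dense (group_points G) (gideal G)"
    and compact: "semialg_compact (group_points G)"
    and GV: "affine_G_variety G V \<alpha>"
begin

definition gm :: "('g \<Rightarrow> 'r) \<Rightarrow> ('g \<Rightarrow> 'r) \<Rightarrow> 'g \<Rightarrow> 'r" where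
  "gm g h = (\<lambda>i. peval (case_sum g h) (gmult G i))"

definition trans :: "('g \<Rightarrow> 'r) \<Rightarrow> ('n, 'r) mpoly \<Rightarrow> ('n, 'r) mpoly" where
  "trans g p = subst (mcomp \<alpha> (case_sum (\<lambda>i. Const (g i)) Var)) p"

abbreviation "S \<equiv> group_points G"

lemma ideal_G: "mideal (gideal G)" and ideal_V: "mideal V"
  using lag GV by (simp_all add: linear_algebraic_group_def affine_G_variety_def affine_variety_def
      poly_ring_ideal_iff)

lemma S_iff: "x \<in> S \<longleftrightarrow> (\<forall>p\<in>gideal G. peval x p = 0)"
  by (simp add: rational_points_def)

lemma gunit_S: "gunit G \<in> S"
  using lag by (simp add: linear_algebraic_group_def)

lemma gm_S:
  assumes "g \<in> S" "h \<in> S"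
  shows "gm g h \<in> S"
  unfolding S_iff
proof
  fix q assume "q \<in> gideal G"
  then have "subst (gmult G) q \<in> scheme_prod (gideal G) (gideal G)"
    using lag by (simp add: linear_algebraic_group_def scheme_morphism_def)
  from peval_scheme_prod[OF this assms] show "peval (gm g h) q = 0" by (simp add: peval_subst gm_def)
qed

lemma inv_S:
  assumes "g \<in> S"
  shows "inv_point G g \<in> S"
  unfolding S_iff
proof
  fix q assume "q \<in> gideal G"
  then have "subst (ginv G) q \<in> gideal G"
    using lag by (simp add: linear_algebraic_group_def scheme_morphism_def)
  then have "peval g (subst (ginv G) q) = 0" using assms by (simp add: S_iff)
  then show "peval (inv_point G g) q = 0" by (simp add: peval_subst inv_point_def[abs_def])
qed

lemma peval_case_sum: "(\<lambda>i. peval x (case_sum \<phi> \<psi> i)) = case_sum (\<lambda>i. peval x (\<phi> i)) (\<lambda>i. peval x (\<psi> i))"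
  by (auto split: sum.splits)

lemma gm_inv:
  assumes "g \<in> S"
  shows "gm (inv_point G g) g = gunit G" "gm g (inv_point G g) = gunit G"
proof -
  have "mcomp (gmult G) (case_sum (ginv G) Var) k - Const (gunit G k) \<in> gideal G"
    "mcomp (gmult G) (case_sum Var (ginv G)) k - Const (gunit G k) \<in> gideal G" for k
    using lag by (simp_all add: linear_algebraic_group_def same_morphism_def)
  then have "peval g (mcomp (gmult G) (case_sum (ginv G) Var) k - Const (gunit G k)) = 0"
    "peval g (mcomp (gmult G) (case_sum Var (ginv G)) k - Const (gunit G k)) = 0" for k
    using assms unfolding S_iff by blast+
  then have "peval g (mcomp (gmult G) (case_sum (ginv G) Var) k) = gunit G k"
    "peval g (mcomp (gmult G) (case_sum Var (ginv G)) k) = gunit G k" for k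
    by (simp_all add: peval_simps)
  then show "gm (inv_point G g) g = gunit G" "gm g (inv_point G g) = gunit G"
    by (simp_all add: fun_eq_iff mcomp_def peval_subst peval_case_sum gm_def inv_point_def peval_simps)
qed

section \<open>Translations of polynomials\<close>

lemma trans_simps:
  "trans g (p + q) = trans g p + trans g q" "trans g (p * q) = trans g p * trans g q"
  "trans g (Const c) = Const c" "trans g (p - q) = trans g p - trans g q" "trans g 0 = 0"
  by (simp_all add: trans_def subst_simps)

lemma trans_cmul: "trans g (cmul c p) = cmul c (trans g p)"
  by (simp add: cmul_def trans_simps)

lemma trans_sum: "trans g (sum f A) = (\<Sum>i\<in>A. trans g (f i))"
  by (simp add: trans_def subst_sum)

lemma subst_case_sum: "(\<lambda>i. subst \<tau> (case_sum \<phi> \<psi> i)) = case_sum (\<lambda>i. subst \<tau> (\<phi> i)) (\<lambda>i. subst \<tau> (\<psi> i))"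
  by (auto split: sum.splits)

lemma subst_point_V:
  assumes "g \<in> S" "q \<in> scheme_prod (gideal G) V"
  shows "subst (case_sum (\<lambda>i. Const (g i)) Var) q \<in> V"
proof (rule subst_scheme_prod[OF ideal_V _ _ assms(2)])
  show "subst (\<lambda>i. case_sum (\<lambda>i. Const (g i)) Var (Inl i)) p \<in> V" if "p \<in> gideal G" for p
    using assms(1) that mideal_0[OF ideal_V] by (simp add: subst_Const S_iff Const_simps)
qed (simp add: subst_Var)

lemma trans_V:
  assumes "g \<in> S" "p \<in> V"
  shows "trans g p \<in> V"
proof -
  have "subst \<alpha> p \<in> scheme_prod (gideal G) V"
    using GV assms(2) by (simp add: affine_G_variety_def scheme_morphism_def)
  from subst_point_V[OF assms(1) this] show ?thesis by (simp add: subst_subst trans_def mcomp_def)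
qed

lemma trans_cong:
  assumes "g \<in> S" "p - q \<in> V"
  shows "trans g p - trans g q \<in> V"
  using trans_V[OF assms] by (simp add: trans_simps)

text \<open>Translation is a right action, hence the order in \<open>gm g h\<close>. The
  substitution \<tau> specialises the associativity diagram of the action at g and h, and
  \<open>subst_congruent\<close> passes from coordinates to all polynomials.\<close>

lemma trans_gm:
  assumes "g \<in> S" "h \<in> S"
  shows "trans h (trans g p) - trans (gm g h) p \<in> V"
proof -
  define \<tau> :: "'g + 'g + 'n \<Rightarrow> ('n, 'r) mpoly" where "\<tau> = case_sum (\<lambda>i. Const (g i))
      (case_sum (\<lambda>i. Const (h i)) Var)"
  have \<tau>: "subst \<tau> q \<in> V" if "q \<in> scheme_prod (gideal G) (scheme_prod (gideal G) V)" for q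
  proof (rule subst_scheme_prod[OF ideal_V _ _ that])
    show "subst (\<lambda>i. \<tau> (Inl i)) p \<in> V" if "p \<in> gideal G" for p
      using assms(1) that mideal_0[OF ideal_V] by (simp add: \<tau>_def subst_Const S_iff Const_simps)
    show "subst (\<lambda>j. \<tau> (Inr j)) q \<in> V" if "q \<in> scheme_prod (gideal G) V" for q
      using subst_point_V[OF assms(2) that] by (simp add: \<tau>_def)
  qed
  let ?s = "\<lambda>g. mcomp \<alpha> (case_sum (\<lambda>i. Const (g i)) Var)"
  have "subst (?s h) (?s g j) - ?s (gm g h) j \<in> V" for j
  proof -
    have "mcomp \<alpha> (case_sum (\<lambda>i. Var (Inl i)) (mcomp \<alpha> (\<lambda>i. Var (Inr i)))) j
      - mcomp \<alpha> (case_sum (mcomp (gmult G) (case_sum (\<lambda>i. Var (Inl i)) (\<lambda>i. Var (Inr (Inl i)))))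
          (\<lambda>j. Var (Inr (Inr j)))) j
      \<in> scheme_prod (gideal G) (scheme_prod (gideal G) V)"
      using GV by (simp add: affine_G_variety_def same_morphism_def)
    note in_V = \<tau>[OF this]
    have c: "(\<lambda>i. Const (case_sum g h i) :: ('n, 'r) mpoly) = case_sum (\<lambda>i. Const (g i)) (\<lambda>i. Const (h i))"
      by (auto split: sum.splits)
    have "(Const (gm g h i) :: ('n, 'r) mpoly) = subst (case_sum (\<lambda>i. Const (g i)) (\<lambda>i. Const (h i)))
        (gmult G i)" for i
      unfolding gm_def c[symmetric] subst_Const ..
    then have "subst \<tau> (mcomp \<alpha> (case_sum (mcomp (gmult G) (case_sum (\<lambda>i. Var (Inl i))
        (\<lambda>i. Var (Inr (Inl i))))) (\<lambda>j. Var (Inr (Inr j)))) j)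
        = ?s (gm g h) j"
      by (simp only: mcomp_def subst_subst subst_case_sum subst_simps \<tau>_def sum.case)
    moreover have "subst \<tau> (mcomp \<alpha> (case_sum (\<lambda>i. Var (Inl i)) (mcomp \<alpha> (\<lambda>i. Var (Inr i)))) j)
        = subst (?s h) (?s g j)"
      by (simp only: mcomp_def subst_subst subst_case_sum subst_simps \<tau>_def sum.case)
    ultimately show ?thesis using in_V by (simp only: subst_simps)
  qed
  from subst_congruent[OF ideal_V, of "\<lambda>j. subst (?s h) (?s g j)" "?s (gm g h)" p, OF this]
  show ?thesis by (simp add: trans_def subst_subst)
qed

lemma trans_unit: "trans (gunit G) p - p \<in> V"
proof -
  have "mcomp \<alpha> (case_sum (\<lambda>i. Const (gunit G i)) Var) j - Var j \<in> V" for j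
    using GV by (simp add: affine_G_variety_def same_morphism_def)
  from subst_congruent[OF ideal_V, of "mcomp \<alpha> (case_sum (\<lambda>i. Const (gunit G i)) Var)" Var p, OF this]
  show ?thesis by (simp add: trans_def subst_Var)
qed

text \<open>Local finiteness: the pullback of p to G \<times> V is a finite sum of products, so all
  translates lie in the span of polynomials independent of g, with coefficients polynomial in
  g.\<close>

lemma trans_expand: "\<exists>n a b. \<forall>g. trans g p = (\<Sum>k<(n::nat). cmul (peval g (a k)) (b k))"
proof -
  obtain n a b where "subst \<alpha> p = (\<Sum>k<(n::nat). subst (\<lambda>i. Var (Inl i)) (a k) * subst (\<lambda>j. Var (Inr j)) (b k))"
    using mpoly_sum_of_products by blast
  then have "trans g p = (\<Sum>k<n. cmul (peval g (a k)) (b k))" for g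
    using arg_cong[of "subst \<alpha> p" _ "subst (case_sum (\<lambda>i. Const (g i)) Var)"]
    by (simp add: trans_def mcomp_def subst_subst[symmetric])
      (simp add: subst_sum subst_simps subst_subst subst_Const subst_Var cmul_def)
  then show ?thesis by blast
qed

text \<open>The translation action on R[V] carried over to normal forms, where the composition laws
  hold as equations and not only modulo \<open>V\<close>.\<close>

definition T :: "('g \<Rightarrow> 'r) \<Rightarrow> ('n, 'r) mpoly \<Rightarrow> ('n, 'r) mpoly" where
  "T g p = nf V (trans g p)"

lemma T_add: "T g (x + y) = T g x + T g y"
  and T_cmul: "T g (cmul c x) = cmul c (T g x)"
  and T_sum: "T g (sum f A) = (\<Sum>i\<in>A. T g (f i))"
  by (simp_all add: T_def trans_simps trans_cmul trans_sum nf_add[OF ideal_V] nf_cmul[OF ideal_V]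
      nf_sum[OF ideal_V])

lemma T_nf: "g \<in> S \<Longrightarrow> T g (nf V x) = T g x"
  unfolding T_def nf_eq_iff[OF ideal_V] by (intro trans_cong nf_minus_self[OF ideal_V])

lemma T_gm:
  assumes "g \<in> S" "h \<in> S"
  shows "T h (T g p) = T (gm g h) p"
proof -
  have "T h (T g p) = T h (trans g p)" using T_nf[OF assms(2)] by (simp add: T_def[of g])
  also have "\<dots> = T (gm g h) p" unfolding T_def nf_eq_iff[OF ideal_V] by (rule trans_gm[OF assms])
  finally show ?thesis .
qed

lemma T_unit: "x \<in> range (nf V) \<Longrightarrow> T (gunit G) x = x"
proof -
  assume "x \<in> range (nf V)"
  then have "nf V x = x" using nf_nf[OF ideal_V] by auto
  moreover have "T (gunit G) x = nf V x" unfolding T_def nf_eq_iff[OF ideal_V] by (rule trans_unit)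
  ultimately show ?thesis by simp
qed

lemma T_range: "T g x \<in> range (nf V)"
  by (simp add: T_def)

text \<open>The basis is chosen inside the orbit \<open>Y\<close>, so a translate of a basis element
  is again in the orbit. It is finite because \<open>trans_expand\<close> puts the orbit of each
  element into a finite-dimensional space.\<close>

lemma orbit_span:
  assumes "finite H" "H \<subseteq> range (nf V)"
  obtains B where "finite B" "MP.independent B" "B \<subseteq> range (nf V)" "H \<subseteq> MP.span B"
    "\<And>g b. g \<in> S \<Longrightarrow> b \<in> B \<Longrightarrow> T g b \<in> MP.span B"
proof -
  define Y where "Y = {T g h | g h. g \<in> S \<and> h \<in> H}"
  have "\<exists>F. finite F \<and> (\<forall>g. T g p \<in> MP.span F)" for p
  proof -
    obtain n a b where e: "\<forall>g. trans g p = (\<Sum>k<(n::nat). cmul (peval g (a k)) (b k))"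
      using trans_expand by blast
    have "T g p \<in> MP.span ((\<lambda>k. nf V (b k)) ` {..<n})" for g
      unfolding T_def e[rule_format] nf_sum[OF ideal_V] nf_cmul[OF ideal_V]
      by (intro MP.span_sum MP.span_scale MP.span_base) auto
    then show ?thesis by blast
  qed
  then obtain F where F: "\<And>p. finite (F p)" "\<And>p g. T g p \<in> MP.span (F p)" by metis
  have YF: "Y \<subseteq> MP.span (\<Union>h\<in>H. F h)"
    unfolding Y_def using F(2) MP.span_mono by (smt (verit) UN_upper mem_Collect_eq subset_eq)
  have finF: "finite (\<Union>h\<in>H. F h)" using assms(1) F(1) by blast
  obtain B where B: "B \<subseteq> Y" "MP.independent B" "Y \<subseteq> MP.span B" by (rule MP.maximal_independent_subset)
  have "finite B" using MP.independent_span_bound[OF finF B(2)] B(1) YF by blast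
  moreover have "B \<subseteq> range (nf V)" using B(1) T_range unfolding Y_def by blast
  moreover have "H \<subseteq> MP.span B"
  proof
    fix h assume "h \<in> H"
    then have "T (gunit G) h \<in> Y" unfolding Y_def using gunit_S by blast
    moreover have "T (gunit G) h = h" by (rule T_unit) (use \<open>h \<in> H\<close> assms(2) in blast)
    ultimately show "h \<in> MP.span B" using B(3) by auto
  qed
  moreover have "T g b \<in> MP.span B" if gb: "g \<in> S" "b \<in> B" for g b
  proof -
    obtain k h where "k \<in> S" "h \<in> H" "b = T k h" using gb(2) B(1) unfolding Y_def by blast
    then have "T g b = T (gm k g) h" "gm k g \<in> S" using T_gm gb(1) gm_S by auto
    then have "T g b \<in> Y" unfolding Y_def using \<open>h \<in> H\<close> by blast
    then show ?thesis using B(3) by blast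
  qed
  ultimately show ?thesis using B(2) that by blast
qed

text \<open>Coordinate functionals applied to \<open>trans_expand\<close> show that the matrix
  entries are polynomial in g; this makes the action definable and its entries bounded on
  \<open>S\<close>.\<close>

lemma matrix_coefficients:
  assumes B: "finite B" "MP.independent B" and st: "\<And>g b. g \<in> S \<Longrightarrow> b \<in> B \<Longrightarrow> T g b \<in> MP.span B"
  obtains M where "\<And>g b. g \<in> S \<Longrightarrow> b \<in> B \<Longrightarrow> T g b = (\<Sum>c\<in>B. cmul (peval g (M c b)) c)"
proof -
  obtain l where l: "\<And>b x y. l b (x + y) = l b x + l b y" "\<And>b c x. l b (cmul c x) = c * l b x"
    "\<And>b c. c \<in> B \<Longrightarrow> l b c = (if b = c then 1 else 0)"
    using dual_functionals[OF B(2)] by blast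
  have l0: "l b 0 = 0" for b using l(2)[of b 0 0] by (simp add: cmul_def Const_simps)
  have lsum2: "l b (sum f A) = (\<Sum>i\<in>A. l b (f i))" for b f and A :: "('n, 'r) mpoly set"
    by (induction A rule: infinite_finite_induct) (simp_all add: l0 l)
  have lsum3: "l b (sum f A) = (\<Sum>i\<in>A. l b (f i))" for b f and A :: "nat set"
    by (induction A rule: infinite_finite_induct) (simp_all add: l0 l)
  have "\<exists>m. \<forall>g. l c (T g b) = peval g m" for b c
  proof -
    obtain n a d where e: "\<forall>g. trans g b = (\<Sum>k<(n::nat). cmul (peval g (a k)) (d k))"
      using trans_expand by blast
    have "l c (T g b) = peval g (\<Sum>k<n. Const (l c (nf V (d k))) * a k)" for g
      unfolding T_def e[rule_format] nf_sum[OF ideal_V] nf_cmul[OF ideal_V]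
      by (simp add: lsum3 l peval_sum peval_simps mult.commute)
    then show ?thesis by blast
  qed
  then obtain M where M: "\<And>b c g. l c (T g b) = peval g (M c b)" by metis
  show ?thesis
  proof (rule that)
    fix g b assume "g \<in> S" "b \<in> B"
    then obtain u where u: "T g b = (\<Sum>c\<in>B. cmul (u c) c)" using st B(1) by (auto simp: MP.span_finite)
    have "u c = peval g (M c b)" if "c \<in> B" for c
    proof -
      have "l c (T g b) = (\<Sum>c'\<in>B. if c = c' then u c' else 0)"
        unfolding u lsum2 l(2) by (intro sum.cong refl) (simp add: l(3))
      then show ?thesis using that B(1) M by simp
    qed
    then show "T g b = (\<Sum>c\<in>B. cmul (peval g (M c b)) c)" using u by simp
  qed
qed

end

subsection \<open>An invariant positive semidefinite tensor\<close>

lemma sum_pairs_product: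
  fixes f g :: "'a \<Rightarrow> 'b::comm_semiring_1"
  shows "(\<Sum>p\<in>B \<times> B. f (fst p) * g (snd p)) = sum f B * sum g B"
  by (simp add: sum_product sum.cartesian_product case_prod_unfold)

lemma quadratic_nonneg_imp_linear_0:
  fixes a b :: "'r::linordered_field"
  assumes "\<And>s. 0 \<le> 2 * s * a + s ^ 2 * b" "0 \<le> b"
  shows "a = 0"
proof (rule ccontr)
  assume "a \<noteq> 0"
  \<comment> \<open>The inequality is tested at s = -a/c; taking b + 1 for b keeps the denominator
    positive when b = 0.\<close>
  define c where "c = b + 1"
  have c: "0 < c" "b = c - 1" using assms(2) by (simp_all add: c_def)
  have "2 * (- a / c) * a + (- a / c) ^ 2 * b = - (a ^ 2 * (c + 1)) / c ^ 2"
    unfolding c(2) using c(1) by (simp add: field_simps power2_eq_square)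
  also have "\<dots> < 0" using \<open>a \<noteq> 0\<close> c by (auto intro!: divide_neg_pos mult_pos_pos add_pos_pos)
  finally show False using assms(1)[of "- a / c"] by simp
qed

context compact_G_variety
begin

text \<open>A function \<open>t\<close> on pairs of basis elements is a tensor \<open>\<Sum> t\<^sub>i\<^sub>j i \<otimes> j\<close>; \<open>tensor_value\<close> is its image under
  multiplication, \<open>tensor_form\<close> the corresponding quadratic form on the dual space.\<close>

definition tensor_value :: "('n, 'r) mpoly set \<Rightarrow> (('n, 'r) mpoly \<times> ('n, 'r) mpoly \<Rightarrow> 'r) \<Rightarrow> ('n, 'r) mpoly" where
  "tensor_value B t = (\<Sum>p\<in>B \<times> B. cmul (t p) (fst p * snd p))"

definition tensor_form :: "('n, 'r) mpoly set \<Rightarrow> (('n, 'r) mpoly \<times> ('n, 'r) mpoly \<Rightarrow> 'r) \<Rightarrow>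
    (('n, 'r) mpoly \<Rightarrow> 'r) \<Rightarrow> 'r" where
  "tensor_form B t v = (\<Sum>p\<in>B \<times> B. t p * (v (fst p) * v (snd p)))"

text \<open>The Gram tensors of p modulo \<open>V\<close>. Symmetry is written as inequalities over
  all ordered pairs, which together give equality, so that the criterion
  \<open>closed_on_nonneg\<close> applies directly.\<close>

definition sos_tensor :: "('n, 'r) mpoly set \<Rightarrow> ('n, 'r) mpoly \<Rightarrow> (('n, 'r) mpoly \<times> ('n, 'r) mpoly \<Rightarrow> 'r)
    \<Rightarrow> bool" where
  "sos_tensor B p t \<longleftrightarrow> (\<forall>ij\<in>B \<times> B. 0 \<le> t ij - t (snd ij, fst ij)) \<and> (\<forall>v. 0 \<le> tensor_form B t v) \<and>
     nf V (tensor_value B t) = nf V p"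

lemma sos_tensor_sym:
  assumes "sos_tensor B p t" "i \<in> B" "j \<in> B"
  shows "t (i, j) = t (j, i)"
proof -
  have "0 \<le> t (i, j) - t (j, i)" "0 \<le> t (j, i) - t (i, j)"
    using assms unfolding sos_tensor_def by (auto dest!: bspec[of _ _ "(i, j)"] bspec[of _ _ "(j, i)"])
  then show ?thesis by simp
qed

lemma nf_tensor_value:
  "nf V (tensor_value B t) = (\<Sum>q\<in>B \<times> B. cmul (t q) (nf V (fst q * snd q)))"
  by (simp add: tensor_value_def nf_sum[OF ideal_V] nf_cmul[OF ideal_V])

lemma tensor_value_iff:
  "nf V (tensor_value B t) = nf V p \<longleftrightarrow>
    (\<forall>m. (\<Sum>q\<in>B \<times> B. t q * Poly_Mapping.lookup (nf V (fst q * snd q)) m) - Poly_Mapping.lookup (nf V p) m = 0)"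
  unfolding poly_mapping_eq_iff fun_eq_iff nf_tensor_value by (simp add: lookup_sum lookup_cmul)

lemma definable_sos_tensor:
  assumes "finite B"
  shows "definable (sos_tensor B p)"
proof -
  \<comment> \<open>Equality of normal forms is compared monomial by monomial; only the finitely
    many monomials in \<open>Ms\<close> impose a condition.\<close>
  define Ms where "Ms = (\<Union>q\<in>B \<times> B. Poly_Mapping.keys (nf V (fst q * snd q))) \<union> Poly_Mapping.keys (nf V p)"
  have "finite Ms" using assms by (simp add: Ms_def)
  have "Poly_Mapping.lookup (nf V p) m = 0" "q \<in> B \<times> B \<Longrightarrow> Poly_Mapping.lookup (nf V (fst q * snd q)) m = 0"
    if "m \<notin> Ms" for m q
    using that by (auto simp: Ms_def in_keys_iff)
  then have val: "nf V (tensor_value B t) = nf V p \<longleftrightarrow>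
    (\<forall>m\<in>Ms. (\<Sum>q\<in>B \<times> B. t q * Poly_Mapping.lookup (nf V (fst q * snd q)) m) - Poly_Mapping.lookup (nf V p)
        m = 0)" for t
    unfolding tensor_value_iff by (metis (no_types, lifting) diff_zero mult_zero_right sum.neutral)
  \<comment> \<open>The form sees v only on \<open>B\<close>, so v may be set to 0 elsewhere and
    quantified over finitely many coordinates.\<close>
  have form: "(\<forall>v. 0 \<le> tensor_form B t v) \<longleftrightarrow> (\<forall>v. (\<forall>b. b \<notin> B \<longrightarrow> v b = 0) \<longrightarrow>
      0 \<le> (\<Sum>q\<in>B \<times> B. case_sum t v (Inl q) * (case_sum t v (Inr (fst q)) * case_sum t v (Inr (snd q)))))" for t
  proof
    assume *: "\<forall>v. (\<forall>b. b \<notin> B \<longrightarrow> v b = 0) \<longrightarrow>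
      0 \<le> (\<Sum>q\<in>B \<times> B. case_sum t v (Inl q) * (case_sum t v (Inr (fst q)) * case_sum t v (Inr (snd q))))"
    show "\<forall>v. 0 \<le> tensor_form B t v"
    proof
      fix v
      have "tensor_form B t v = tensor_form B t (\<lambda>b. if b \<in> B then v b else 0)"
        unfolding tensor_form_def by (intro sum.cong refl) auto
      then show "0 \<le> tensor_form B t v" using *[rule_format, of "\<lambda>b. if b \<in> B then v b else 0"]
        by (simp add: tensor_form_def)
    qed
  qed (simp add: tensor_form_def)
  have "definable (\<lambda>h. 0 \<le> (\<Sum>q\<in>B \<times> B. h (Inl q) * (h (Inr (fst q)) * h (Inr (snd q)))))"
    by (intro definable_le polfun_intros)
  then have "definable (\<lambda>t. \<forall>v. 0 \<le> tensor_form B t v)"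
    unfolding form by (rule definable_all_fun[OF assms])
  then show ?thesis
    unfolding sos_tensor_def[abs_def] val
    by (intro definable_conj definable_ball definable_le definable_eq0 polfun_intros \<open>finite Ms\<close>
        finite_cartesian_product assms)
qed

text \<open>The equation for the value is split into two inequalities per monomial. Infinitely many
  conditions do no harm here, since closedness, unlike definability, passes to arbitrary
  intersections.\<close>

lemma closed_sos_tensor: "closed_on (B \<times> B) (sos_tensor B p)"
proof -
  have "sos_tensor B p = (\<lambda>t. (\<forall>ij\<in>B \<times> B. 0 \<le> t ij - t (snd ij, fst ij)) \<and> ((\<forall>v\<in>UNIV. 0 \<le> tensor_form B t v) \<and>
     ((\<forall>m\<in>UNIV. 0 \<le> (\<Sum>q\<in>B \<times> B. t q * Poly_Mapping.lookup (nf V (fst q * snd q)) m)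
         - Poly_Mapping.lookup (nf V p) m) \<and>
     (\<forall>m\<in>UNIV. 0 \<le> - ((\<Sum>q\<in>B \<times> B. t q * Poly_Mapping.lookup (nf V (fst q * snd q)) m)
         - Poly_Mapping.lookup (nf V p) m)))))"
    unfolding sos_tensor_def[abs_def] tensor_value_iff by (intro ext) (auto intro: order_antisym)
  then show ?thesis
    unfolding tensor_form_def
    by (elim ssubst) (intro closed_on_conj closed_on_ball closed_on_nonneg polfun_intros;
        force intro!: sum.cong arg_cong2[of _ _ _ _ minus])
qed

lemma sos_tensor_midpoint:
  assumes "sos_tensor B p s" "sos_tensor B p t"
  shows "sos_tensor B p (\<lambda>i. (s i + t i) / 2)"
  unfolding sos_tensor_def
proof (intro conjI ballI allI)
  fix ij assume "ij \<in> B \<times> B"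
  then have "0 \<le> (s ij - s (snd ij, fst ij)) + (t ij - t (snd ij, fst ij))"
    using assms unfolding sos_tensor_def by (intro add_nonneg_nonneg) blast+
  then show "0 \<le> (s ij + t ij) / 2 - (s (snd ij, fst ij) + t (snd ij, fst ij)) / 2" by (simp add: field_simps)
next
  fix v
  have "tensor_form B (\<lambda>i. (s i + t i) / 2) v = (tensor_form B s v + tensor_form B t v) / 2"
    by (simp add: tensor_form_def sum.distrib[symmetric] sum_divide_distrib field_simps)
  moreover have "0 \<le> tensor_form B s v" "0 \<le> tensor_form B t v"
    using assms unfolding sos_tensor_def by blast+
  ultimately show "0 \<le> tensor_form B (\<lambda>i. (s i + t i) / 2) v" by simp
next
  have "tensor_value B (\<lambda>i. (s i + t i) / 2) = cmul (1 / 2) (tensor_value B s + tensor_value B t)"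
    unfolding tensor_value_def sum.distrib[symmetric] MP.scale_sum_right
    by (intro sum.cong refl) (simp add: MP.scale_left_distrib[symmetric])
  then have "nf V (tensor_value B (\<lambda>i. (s i + t i) / 2)) = cmul (1 / 2) (nf V p + nf V p)"
    using assms by (simp add: sos_tensor_def nf_cmul[OF ideal_V] nf_add[OF ideal_V])
  also have "\<dots> = cmul (1 / 2 + 1 / 2) (nf V p)" by (simp only: MP.scale_right_distrib MP.scale_left_distrib)
  also have "\<dots> = nf V p" by simp
  finally show "nf V (tensor_value B (\<lambda>i. (s i + t i) / 2)) = nf V p" .
qed

context
  fixes B :: "('n, 'r) mpoly set" and M :: "('n, 'r) mpoly \<Rightarrow> ('n, 'r) mpoly \<Rightarrow> ('g, 'r) mpoly"
  assumes finB: "finite B" and indB: "MP.independent B" and Bnf: "B \<subseteq> range (nf V)"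
    and M: "\<And>g b. g \<in> S \<Longrightarrow> b \<in> B \<Longrightarrow> T g b = (\<Sum>c\<in>B. cmul (peval g (M c b)) c)"
begin

abbreviation "m g c b \<equiv> peval g (M c b)"

section \<open>Matrix entries and the action on tensors\<close>

lemma coeffs_eq:
  assumes "(\<Sum>c\<in>B. cmul (u c) c) = (\<Sum>c\<in>B. cmul (w c) c)" "c \<in> B"
  shows "u c = w c"
proof -
  have "(\<Sum>c\<in>B. cmul (u c - w c) c) = 0"
    using assms(1) by (simp add: MP.scale_left_diff_distrib sum_subtractf)
  then have "u c - w c = 0" by (rule MP.independentD[OF indB finB order_refl _ assms(2)])
  then show ?thesis by simp
qed

lemma T_comb:
  assumes "g \<in> S"
  shows "T g (\<Sum>b\<in>B. cmul (v b) b) = (\<Sum>c\<in>B. cmul (\<Sum>b\<in>B. m g c b * v b) c)"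
proof -
  have "T g (\<Sum>b\<in>B. cmul (v b) b) = (\<Sum>b\<in>B. \<Sum>c\<in>B. cmul (m g c b * v b) c)"
    by (simp add: T_sum T_cmul M[OF assms] MP.scale_sum_right mult.commute)
  also have "\<dots> = (\<Sum>c\<in>B. \<Sum>b\<in>B. cmul (m g c b * v b) c)" by (rule sum.swap)
  finally show ?thesis by (simp add: MP.scale_sum_left)
qed

text \<open>The order of the factors is reversed because \<open>T\<close> is a right action.\<close>

lemma m_gm:
  assumes "g \<in> S" "h \<in> S" "c \<in> B" "b \<in> B"
  shows "m (gm g h) c b = (\<Sum>a\<in>B. m h c a * m g a b)"
proof (rule coeffs_eq[OF _ assms(3)])
  have "(\<Sum>c\<in>B. cmul (m (gm g h) c b) c) = T h (T g b)"
    using M[OF gm_S[OF assms(1,2)] assms(4)] T_gm[OF assms(1,2)] by simp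
  also have "\<dots> = (\<Sum>c\<in>B. cmul (\<Sum>a\<in>B. m h c a * m g a b) c)"
    unfolding M[OF assms(1,4)] by (rule T_comb[OF assms(2)])
  finally show "(\<Sum>c\<in>B. cmul (m (gm g h) c b) c) = (\<Sum>c\<in>B. cmul (\<Sum>a\<in>B. m h c a * m g a b) c)" .
qed

lemma m_unit:
  assumes "c \<in> B" "b \<in> B"
  shows "m (gunit G) c b = (if c = b then 1 else 0)"
proof (rule coeffs_eq[OF _ assms(1)])
  have "(\<Sum>c\<in>B. cmul (m (gunit G) c b) c) = b"
    using M[OF gunit_S assms(2)] T_unit[of b] Bnf assms(2) by auto
  also have "b = (\<Sum>c\<in>B. cmul (if c = b then 1 else 0) c)"
    using assms(2) finB by (simp add: if_distrib[of "\<lambda>c. cmul c _"] cong: if_cong)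
  finally show "(\<Sum>c\<in>B. cmul (m (gunit G) c b) c) = (\<Sum>c\<in>B. cmul (if c = b then 1 else 0) c)" .
qed

definition tact :: "('g \<Rightarrow> 'r) \<Rightarrow> (('n, 'r) mpoly \<times> ('n, 'r) mpoly \<Rightarrow> 'r) \<Rightarrow>
    ('n, 'r) mpoly \<times> ('n, 'r) mpoly \<Rightarrow> 'r" where
  "tact g t i = (\<Sum>j\<in>B \<times> B. (m g (fst i) (fst j) * m g (snd i) (snd j)) * t j)"

lemma tact_tact:
  assumes "g \<in> S" "h \<in> S" "i \<in> B \<times> B"
  shows "tact h (tact g t) i = tact (gm g h) t i"
proof -
  have "tact h (tact g t) i = (\<Sum>j\<in>B \<times> B. \<Sum>k\<in>B \<times> B.
      (m h (fst i) (fst j) * m h (snd i) (snd j)) * (m g (fst j) (fst k) * m g (snd j) (snd k)) * t k)"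
    by (simp add: tact_def sum_distrib_left mult.assoc)
  also have "\<dots> = (\<Sum>k\<in>B \<times> B. (\<Sum>j\<in>B \<times> B.
      (m h (fst i) (fst j) * m g (fst j) (fst k)) * (m h (snd i) (snd j) * m g (snd j) (snd k))) * t k)"
    by (subst sum.swap) (simp add: sum_distrib_right sum_distrib_left mult_ac)
  also have "\<dots> = tact (gm g h) t i"
    unfolding tact_def
  proof (intro sum.cong refl arg_cong2[of _ _ _ _ "(*)"])
    fix k assume k: "k \<in> B \<times> B"
    have "(\<Sum>j\<in>B \<times> B. (m h (fst i) (fst j) * m g (fst j) (fst k)) * (m h (snd i) (snd j) * m g (snd j) (snd k)))
      = (\<Sum>a\<in>B. m h (fst i) a * m g a (fst k)) * (\<Sum>a\<in>B. m h (snd i) a * m g a (snd k))"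
      by (rule sum_pairs_product)
    then show "(\<Sum>j\<in>B \<times> B. (m h (fst i) (fst j) * m g (fst j) (fst k)) * (m h (snd i) (snd j) * m g (snd j)
        (snd k)))
      = m (gm g h) (fst i) (fst k) * m (gm g h) (snd i) (snd k)"
      using assms(3) k by (simp add: m_gm[OF assms(1,2)] mem_Times_iff)
  qed
  finally show ?thesis .
qed

lemma tact_unit:
  assumes "i \<in> B \<times> B"
  shows "tact (gunit G) t i = t i"
proof -
  have "tact (gunit G) t i = (\<Sum>j\<in>B \<times> B. if i = j then t j else 0)"
    unfolding tact_def by (intro sum.cong refl) (use assms in \<open>auto simp: m_unit mem_Times_iff prod_eq_iff\<close>)
  then show ?thesis using assms finB by simp
qed

text \<open>On the dual space the transposed matrix acts; hence the action preserves positive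
  semidefiniteness.\<close>

lemma tensor_form_tact:
  "tensor_form B (tact g t) v = tensor_form B t (\<lambda>k. \<Sum>i\<in>B. m g i k * v i)"
proof -
  have "tensor_form B (tact g t) v = (\<Sum>i\<in>B \<times> B. \<Sum>j\<in>B \<times> B.
      (m g (fst i) (fst j) * m g (snd i) (snd j)) * t j * (v (fst i) * v (snd i)))"
    by (simp add: tensor_form_def tact_def sum_distrib_right)
  also have "\<dots> = (\<Sum>j\<in>B \<times> B. t j * (\<Sum>i\<in>B \<times> B. (m g (fst i) (fst j) * v (fst i)) * (m g (snd i) (snd j)
      * v (snd i))))"
    by (subst sum.swap) (simp add: sum_distrib_left mult_ac)
  also have "\<dots> = (\<Sum>j\<in>B \<times> B. t j * ((\<Sum>i\<in>B. m g i (fst j) * v i) * (\<Sum>i\<in>B. m g i (snd j) * v i)))"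
    by (simp only: sum_pairs_product[of "\<lambda>a. m g a (fst _) * v a" "\<lambda>a. m g a (snd _) * v a"])
  finally show ?thesis by (simp add: tensor_form_def)
qed

text \<open>Multiplication from the tensor square to R[V] is equivariant because translations are
  ring homomorphisms; \<open>nf_mult\<close> reconciles this with the normal forms.\<close>

lemma nf_tensor_value_tact:
  assumes "g \<in> S"
  shows "nf V (tensor_value B (tact g t)) = nf V (trans g (tensor_value B t))"
proof -
  have prod: "nf V (trans g b * trans g c) = (\<Sum>i\<in>B \<times> B. cmul (m g (fst i) b * m g (snd i) c)
      (nf V (fst i * snd i)))"
    if "b \<in> B" "c \<in> B" for b c
  proof -
    have "nf V (trans g b * trans g c) = nf V (T g b * T g c)"
      unfolding T_def by (rule nf_mult[OF ideal_V, symmetric])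
    also have "T g b * T g c = (\<Sum>i\<in>B \<times> B. cmul (m g (fst i) b) (fst i) * cmul (m g (snd i) c) (snd i))"
      unfolding M[OF assms that(1)] M[OF assms that(2)] by (rule sum_pairs_product[symmetric])
    also have "\<dots> = (\<Sum>i\<in>B \<times> B. cmul (m g (fst i) b * m g (snd i) c) (fst i * snd i))"
      by (simp add: cmul_def Const_simps mult_ac)
    finally show ?thesis by (simp add: nf_sum[OF ideal_V] nf_cmul[OF ideal_V])
  qed
  have "nf V (trans g (tensor_value B t)) = (\<Sum>j\<in>B \<times> B. cmul (t j) (nf V (trans g (fst j) * trans g (snd j))))"
    by (simp add: tensor_value_def trans_sum trans_cmul trans_simps nf_sum[OF ideal_V] nf_cmul[OF ideal_V])
  also have "\<dots> = (\<Sum>j\<in>B \<times> B. \<Sum>i\<in>B \<times> B.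
      cmul (m g (fst i) (fst j) * m g (snd i) (snd j) * t j) (nf V (fst i * snd i)))"
    by (intro sum.cong refl) (simp add: prod mem_Times_iff MP.scale_sum_right mult.commute)
  also have "\<dots> = (\<Sum>i\<in>B \<times> B. \<Sum>j\<in>B \<times> B.
      cmul (m g (fst i) (fst j) * m g (snd i) (snd j) * t j) (nf V (fst i * snd i)))"
    by (rule sum.swap)
  also have "\<dots> = nf V (tensor_value B (tact g t))"
    by (simp add: nf_tensor_value tact_def MP.scale_sum_left)
  finally show ?thesis ..
qed

lemma sos_tensor_tact:
  assumes t: "sos_tensor B p t" and g: "g \<in> S" and p: "trans g p - p \<in> V"
  shows "sos_tensor B p (tact g t)"
  unfolding sos_tensor_def
proof (intro conjI ballI allI)
  fix i assume i: "i \<in> B \<times> B"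
  have "tact g t (snd i, fst i) = (\<Sum>j\<in>(\<lambda>j. (snd j, fst j)) ` (B \<times> B). (m g (snd i) (fst j) * m g (fst i)
      (snd j)) * t j)"
  proof -
    have "(\<lambda>j. (snd j, fst j)) ` (B \<times> B) = B \<times> B" by force
    then show ?thesis by (simp add: tact_def)
  qed
  also have "\<dots> = (\<Sum>j\<in>B \<times> B. (m g (snd i) (snd j) * m g (fst i) (fst j)) * t (snd j, fst j))"
    by (subst sum.reindex) (auto simp: inj_on_def)
  also have "\<dots> = tact g t i"
    unfolding tact_def using sos_tensor_sym[OF t] by (intro sum.cong refl) (auto simp: mult.commute)
  finally show "0 \<le> tact g t i - tact g t (snd i, fst i)" by simp
next
  fix v
  show "0 \<le> tensor_form B (tact g t) v" unfolding tensor_form_tact using t by (simp add: sos_tensor_def)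
next
  have "tensor_value B t - p \<in> V" using t by (simp add: sos_tensor_def nf_eq_iff[OF ideal_V])
  then have "trans g (tensor_value B t) - trans g p \<in> V" by (rule trans_cong[OF g])
  from mideal_add[OF ideal_V this p] have "trans g (tensor_value B t) - p \<in> V" by simp
  then show "nf V (tensor_value B (tact g t)) = nf V p"
    unfolding nf_tensor_value_tact[OF g] nf_eq_iff[OF ideal_V] .
qed

lemma invariant_sos_tensor:
  assumes t0: "sos_tensor B p t0" and p: "\<And>g. g \<in> S \<Longrightarrow> trans g p - p \<in> V"
  obtains t where "sos_tensor B p t" "\<And>g i. g \<in> S \<Longrightarrow> i \<in> B \<times> B \<Longrightarrow> tact g t i = t i"
proof -
  let ?A = "\<lambda>i j g. m g (fst i) (fst j) * m g (snd i) (snd j)"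
  have A: "?A i j \<in> polfun" for i j by (intro polfun_mult peval_polfun)
  obtain R where R: "\<And>x i. x \<in> S \<Longrightarrow> \<bar>x i\<bar> \<le> R" using compact unfolding semialg_compact_def by blast
  have "\<exists>C. \<forall>g\<in>S. \<bar>?A i j g\<bar> \<le> C" for i j by (rule polfun_bounded[OF A, of S R]) (rule R)
  then have "\<exists>C. \<forall>i j. \<forall>g\<in>S. \<bar>?A i j g\<bar> \<le> C i j" by (intro choice allI)
  then obtain C where C: "\<And>i j g. g \<in> S \<Longrightarrow> \<bar>?A i j g\<bar> \<le> C i j" by blast
  \<comment> \<open>The bounds for the single entries are added up to one constant that serves all
    pairs of indices.\<close>
  define D where "D = (\<Sum>i\<in>B \<times> B. \<Sum>j\<in>B \<times> B. \<bar>C i j\<bar>)"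
  have D: "\<bar>?A i j g\<bar> \<le> D" if "g \<in> S" "i \<in> B \<times> B" "j \<in> B \<times> B" for i j g
  proof -
    have "\<bar>?A i j g\<bar> \<le> \<bar>C i j\<bar>" using C[OF that(1), of i j] by simp
    also have "\<dots> \<le> (\<Sum>j\<in>B \<times> B. \<bar>C i j\<bar>)" using that finB by (intro member_le_sum) auto
    also have "\<dots> \<le> D" unfolding D_def
      using that finB by (intro member_le_sum[of i _ "\<lambda>i. \<Sum>j\<in>B \<times> B. \<bar>C i j\<bar>"] sum_nonneg) auto
    finally show ?thesis .
  qed
  have "\<exists>t. sos_tensor B p t \<and> (\<forall>g\<in>S. \<forall>i\<in>B \<times> B. tact g t i = t i)"
  proof (rule definable_group_fixed_point[where A = ?A and B = D and I = "B \<times> B" and K = "sos_tensor B p"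
      and act = tact and S = S])
    show "definable (\<lambda>g. g \<in> S)" by (rule definable_rational_points[OF ideal_G])
    show "S \<noteq> {}" using gunit_S by blast
    show "\<exists>k\<in>S. \<forall>x. \<forall>i\<in>B \<times> B. tact h (tact g x) i = tact k x i" if "g \<in> S" "h \<in> S" for g h
      using tact_tact[OF that] gm_S[OF that] by blast
    show "\<exists>h\<in>S. \<forall>x. \<forall>i\<in>B \<times> B. tact h (tact g x) i = x i" if g: "g \<in> S" for g
    proof (intro bexI[of _ "inv_point G g"] allI ballI)
      fix x i assume i: "i \<in> B \<times> B"
      show "tact (inv_point G g) (tact g x) i = x i"
        by (simp only: tact_tact[OF g inv_S[OF g] i] gm_inv[OF g] tact_unit[OF i])
    qed (rule inv_S[OF g])
    show "sos_tensor B p (tact g x)" if "g \<in> S" "sos_tensor B p x" for g x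
      by (rule sos_tensor_tact[OF that(2,1) p[OF that(1)]])
    show "\<bar>?A i j g\<bar> \<le> D" if "g \<in> S" "i \<in> B \<times> B" "j \<in> B \<times> B" for i j g by (rule D[OF that])
    show "tact g x i = (\<Sum>j\<in>B \<times> B. ?A i j g * x j)" for g x i by (rule tact_def)
    show "finite (B \<times> B)" using finB by simp
    show "?A i j \<in> polfun" for i j by (rule A)
    show "definable (sos_tensor B p)" by (rule definable_sos_tensor[OF finB])
    show "closed_on (B \<times> B) (sos_tensor B p)" by (rule closed_sos_tensor)
    show "sos_tensor B p t0" by (rule t0)
    show "sos_tensor B p (\<lambda>i. (x i + y i) / 2)" if "sos_tensor B p x" "sos_tensor B p y" for x y
      by (rule sos_tensor_midpoint[OF that])
  qed
  then show ?thesis using that by blast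
qed

text \<open>An invariant positive semidefinite tensor \<open>t\<close> is the same as an invariant inner product on its
  image: \<open>t v\<close> and \<open>t w\<close> have inner product \<open>v\<^sup>T t w\<close>, and \<open>t\<close> is the sum of the squares of any
  orthonormal basis.\<close>

context
  fixes t :: "('n, 'r) mpoly \<times> ('n, 'r) mpoly \<Rightarrow> 'r" and p :: "('n, 'r) mpoly"
  assumes t: "sos_tensor B p t" and t_inv: "\<And>g i. g \<in> S \<Longrightarrow> i \<in> B \<times> B \<Longrightarrow> tact g t i = t i"
begin

definition tapp :: "(('n, 'r) mpoly \<Rightarrow> 'r) \<Rightarrow> ('n, 'r) mpoly \<Rightarrow> 'r" where
  "tapp v i = (\<Sum>j\<in>B. t (i, j) * v j)"

definition timg :: "(('n, 'r) mpoly \<Rightarrow> 'r) \<Rightarrow> ('n, 'r) mpoly" where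
  "timg v = (\<Sum>i\<in>B. cmul (tapp v i) i)"

definition tbil :: "(('n, 'r) mpoly \<Rightarrow> 'r) \<Rightarrow> (('n, 'r) mpoly \<Rightarrow> 'r) \<Rightarrow> 'r" where
  "tbil v w = (\<Sum>i\<in>B. v i * tapp w i)"

text \<open>The preimages are arbitrary choices: by \<open>timg_eq\<close> and symmetry,
  \<open>tbil\<close> depends only on the images, see \<open>inner_timg\<close>.\<close>

definition inner :: "('n, 'r) mpoly \<Rightarrow> ('n, 'r) mpoly \<Rightarrow> 'r" where
  "inner x y = tbil (SOME v. timg v = x) (SOME w. timg w = y)"

lemma tapp_add: "tapp (\<lambda>i. v i + w i) i = tapp v i + tapp w i"
  and tapp_scale: "tapp (\<lambda>i. c * v i) i = c * tapp v i"
  by (simp_all add: tapp_def sum.distrib distrib_left sum_distrib_left mult_ac)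

lemma timg_add: "timg (\<lambda>i. v i + w i) = timg v + timg w"
  and timg_scale: "timg (\<lambda>i. c * v i) = cmul c (timg v)"
  by (simp_all add: timg_def tapp_add tapp_scale MP.scale_left_distrib sum.distrib MP.scale_sum_right)

lemma timg_eq: "timg v = timg w \<Longrightarrow> i \<in> B \<Longrightarrow> tapp v i = tapp w i"
  unfolding timg_def by (rule coeffs_eq)

lemma tbil_sym: "tbil v w = tbil w v"
proof -
  have "tbil v w = (\<Sum>i\<in>B. \<Sum>j\<in>B. v i * t (i, j) * w j)"
    by (simp add: tbil_def tapp_def sum_distrib_left mult.assoc)
  also have "\<dots> = (\<Sum>j\<in>B. \<Sum>i\<in>B. v i * t (i, j) * w j)" by (rule sum.swap)
  also have "\<dots> = tbil w v"
    unfolding tbil_def tapp_def sum_distrib_left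
    by (intro sum.cong refl) (simp add: sos_tensor_sym[OF t] mult_ac)
  finally show ?thesis .
qed

lemma tbil_add: "tbil (\<lambda>i. v i + v' i) w = tbil v w + tbil v' w"
  and tbil_scale: "tbil (\<lambda>i. c * v i) w = c * tbil v w"
  by (simp_all add: tbil_def distrib_right sum.distrib sum_distrib_left mult.assoc)

lemma tbil_form: "tbil v v = tensor_form B t v"
  unfolding tbil_def tapp_def tensor_form_def sum_distrib_left sum.cartesian_product
  by (intro sum.cong refl) (simp add: mult_ac split: prod.splits)

lemma inner_timg: "inner (timg v) (timg w) = tbil v w"
proof -
  have cong: "tbil a b = tbil a b'" if "timg b = timg b'" for a b b'
    using timg_eq[OF that] by (simp add: tbil_def)
  have "inner (timg v) (timg w) = tbil (SOME v'. timg v' = timg v) w"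
    unfolding inner_def by (rule cong) (rule someI[of "\<lambda>w'. timg w' = timg w" w], simp)
  also have "\<dots> = tbil w (SOME v'. timg v' = timg v)" by (rule tbil_sym)
  also have "\<dots> = tbil w v"
    by (rule cong) (rule someI[of "\<lambda>v'. timg v' = timg v" v], simp)
  finally show ?thesis by (simp add: tbil_sym)
qed

text \<open>A vector on which a semidefinite form vanishes lies in its radical. Pairing it with w =
  t v shows that the squares of the coordinates of t v sum to zero.\<close>

lemma tbil_pos:
  assumes "timg v \<noteq> 0"
  shows "0 < tbil v v"
proof (rule ccontr)
  assume "\<not> 0 < tbil v v"
  have nonneg: "0 \<le> tbil u u" for u using t by (simp add: tbil_form sos_tensor_def)
  then have v0: "tbil v v = 0" using \<open>\<not> 0 < tbil v v\<close> by (metis order_le_less)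
  define w where "w = tapp v"
  have "tbil w v = 0"
  proof (rule quadratic_nonneg_imp_linear_0)
    show "0 \<le> tbil w w" by (rule nonneg)
    fix s
    have "tbil (\<lambda>i. v i + s * w i) (\<lambda>i. v i + s * w i) = tbil v v + 2 * s * tbil w v + s ^ 2 * tbil w w"
      by (simp add: tbil_add tbil_scale tbil_sym[of _ "\<lambda>i. v i + s * w i"] tbil_sym[of v w]
          power2_eq_square algebra_simps)
    then show "0 \<le> 2 * s * tbil w v + s ^ 2 * tbil w w" using nonneg[of "\<lambda>i. v i + s * w i"] v0 by simp
  qed
  then have "(\<Sum>i\<in>B. tapp v i * tapp v i) = 0" by (simp add: tbil_def w_def)
  then have "\<forall>i\<in>B. tapp v i * tapp v i = 0"
    by (subst (asm) sum_nonneg_eq_0_iff[OF finB]) auto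
  then have "timg v = 0" by (simp add: timg_def)
  then show False using assms by simp
qed

text \<open>In matrix terms, invariance under the inverse h of g reads t = h t h^T. Multiplying by g
  gives g t = t h^T, so g maps t v to t (h^T v).\<close>

lemma T_timg:
  assumes g: "g \<in> S"
  shows "T g (timg v) = timg (\<lambda>k. \<Sum>i\<in>B. m (inv_point G g) i k * v i)"
proof -
  let ?h = "inv_point G g"
  have h: "?h \<in> S" by (rule inv_S[OF g])
  have comm: "(\<Sum>l\<in>B. m g i l * t (l, j)) = (\<Sum>l\<in>B. t (i, l) * m ?h j l)" if i: "i \<in> B" and j: "j \<in> B" for i j
  proof -
    have "(\<Sum>l\<in>B. m g i l * t (l, j)) = (\<Sum>l\<in>B. m g i l * (\<Sum>k\<in>B \<times> B. (m ?h l (fst k) * m ?h j (snd k)) * t k))"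
      using t_inv[OF h, symmetric] j by (intro sum.cong refl) (simp add: tact_def)
    also have "\<dots> = (\<Sum>k\<in>B \<times> B. (\<Sum>l\<in>B. m g i l * m ?h l (fst k)) * m ?h j (snd k) * t k)"
      unfolding sum_distrib_left by (subst sum.swap) (simp add: sum_distrib_right sum_distrib_left mult_ac)
    also have "\<dots> = (\<Sum>k\<in>B \<times> B. (if i = fst k then m ?h j (snd k) * t k else 0))"
    proof (intro sum.cong refl)
      fix k assume k: "k \<in> B \<times> B"
      have "(\<Sum>l\<in>B. m g i l * m ?h l (fst k)) = m (gm ?h g) i (fst k)"
        using k i by (intro m_gm[symmetric] h g) auto
      also have "\<dots> = (if i = fst k then 1 else 0)" using k i by (simp add: gm_inv[OF g] m_unit mem_Times_iff)
      finally show "(\<Sum>l\<in>B. m g i l * m ?h l (fst k)) * m ?h j (snd k) * t k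
          = (if i = fst k then m ?h j (snd k) * t k else 0)"
        by simp
    qed
    also have "\<dots> = (\<Sum>a\<in>B. \<Sum>b\<in>B. (if i = a then m ?h j b * t (a, b) else 0))"
      by (simp add: sum.cartesian_product case_prod_unfold cong: if_cong)
    also have "\<dots> = (\<Sum>b\<in>B. m ?h j b * t (i, b))"
      by (subst sum.swap) (simp add: finB i)
    finally show ?thesis by (simp add: mult.commute)
  qed
  have "(\<Sum>l\<in>B. m g i l * tapp v l) = tapp (\<lambda>k. \<Sum>j\<in>B. m ?h j k * v j) i" if i: "i \<in> B" for i
  proof -
    have "(\<Sum>l\<in>B. m g i l * tapp v l) = (\<Sum>j\<in>B. (\<Sum>l\<in>B. m g i l * t (l, j)) * v j)"
      unfolding tapp_def sum_distrib_left by (subst sum.swap) (simp add: sum_distrib_right mult.assoc)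
    also have "\<dots> = (\<Sum>j\<in>B. (\<Sum>l\<in>B. t (i, l) * m ?h j l) * v j)"
      by (intro sum.cong refl) (simp add: comm[OF i])
    also have "\<dots> = tapp (\<lambda>k. \<Sum>j\<in>B. m ?h j k * v j) i"
      unfolding tapp_def sum_distrib_left sum_distrib_right by (subst sum.swap) (simp add: mult.assoc)
    finally show ?thesis .
  qed
  then show ?thesis unfolding timg_def T_comb[OF g] by (intro sum.cong refl) simp
qed

text \<open>Invariance of the tensor is invariance of its quadratic form; polarisation passes to the
  bilinear form.\<close>

lemma tbil_invariant:
  assumes g: "g \<in> S"
  shows "tbil (\<lambda>k. \<Sum>i\<in>B. m g i k * v i) (\<lambda>k. \<Sum>i\<in>B. m g i k * w i) = tbil v w"
proof -
  let ?v = "\<lambda>v k. \<Sum>i\<in>B. m g i k * v i"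
  have form: "tbil (?v u) (?v u) = tbil u u" for u
  proof -
    have "tensor_form B t (?v u) = tensor_form B (tact g t) u" by (rule tensor_form_tact[symmetric])
    also have "\<dots> = tensor_form B t u" unfolding tensor_form_def
      by (intro sum.cong refl arg_cong2[of _ _ _ _ "(*)"] t_inv[OF g])
    finally show ?thesis by (simp add: tbil_form)
  qed
  have add: "?v (\<lambda>i. v i + w i) = (\<lambda>i. ?v v i + ?v w i)" by (simp add: sum.distrib distrib_left)
  have pol: "tbil (\<lambda>i. a i + b i) (\<lambda>i. a i + b i) = tbil a a + tbil b b + 2 * tbil a b" for a b
    by (simp add: tbil_add tbil_sym[of _ "\<lambda>i. a i + b i"] tbil_sym[of b a])
  have "2 * tbil (?v v) (?v w) = 2 * tbil v w"
    using form[of "\<lambda>i. v i + w i"] form[of v] form[of w] unfolding add pol by simp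
  then show ?thesis by simp
qed

lemma orthogonal_action_timg: "orthogonal_action cmul S T (range timg) inner B"
proof
  show "MP.subspace (range timg)"
  proof (rule MP.subspaceI)
    have "timg (\<lambda>_. 0) = 0" by (simp add: timg_def tapp_def)
    then show "0 \<in> range timg" by (metis rangeI)
    show "\<And>x y. x \<in> range timg \<Longrightarrow> y \<in> range timg \<Longrightarrow> x + y \<in> range timg" by (auto simp flip: timg_add)
    show "\<And>c x. x \<in> range timg \<Longrightarrow> cmul c x \<in> range timg" by (auto simp flip: timg_scale)
  qed
  show "range timg \<subseteq> MP.span B"
  proof
    fix x assume "x \<in> range timg"
    then obtain v where x: "x = timg v" by blast
    show "x \<in> MP.span B" unfolding x timg_def by (intro MP.span_sum MP.span_scale MP.span_base)
  qed
  show "\<exists>h\<in>S. \<forall>x\<in>range timg. T g (T h x) = x" if g: "g \<in> S" for g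
  proof (intro bexI[of _ "inv_point G g"] ballI)
    fix x assume "x \<in> range timg"
    then obtain v where x: "x = timg v" by blast
    have "x \<in> range (nf V)" unfolding x timg_def
      by (intro MP.subspace_sum[OF subspace_range_nf[OF ideal_V]]
          MP.subspace_scale[OF subspace_range_nf[OF ideal_V]])
        (use Bnf in blast)
    then show "T g (T (inv_point G g) x) = x"
      using T_gm[OF inv_S[OF g] g] gm_inv[OF g] T_unit by simp
  qed (rule inv_S[OF g])
  show "inner (T g x) (T g y) = inner x y" if "g \<in> S" "x \<in> range timg" "y \<in> range timg" for g x y
    using that tbil_invariant[OF inv_S[OF that(1)]] by (auto simp: T_timg inner_timg)
  show "0 < inner x x" if "x \<in> range timg" "x \<noteq> 0" for x
    using that tbil_pos by (auto simp: inner_timg)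
qed (auto simp: T_add T_cmul finB T_timg inner_timg tbil_add tbil_scale tbil_sym simp flip: timg_add timg_scale)

text \<open>The column \<open>timg (e j)\<close> of the tensor is expanded in \<open>C\<close>. Its
  coefficient at x is the j-th coordinate of x, so regrouping the sum over j multiplies each x by
  its own expansion in \<open>B\<close>.\<close>

theorem tensor_orthonormal_squares:
  assumes "orthogonal_action.orthonormal (range timg) inner C" "MP.span C = range timg"
  shows "(\<Sum>x\<in>C. x * x) = tensor_value B t"
proof -
  interpret O: orthogonal_action cmul S T "range timg" inner B by (rule orthogonal_action_timg)
  have C: "finite C" "C \<subseteq> range timg" using assms(1) by (auto simp: O.orthonormal_def)
  define e where "e j i = (if i = j then 1 else 0 :: 'r)" for j i :: "('n, 'r) mpoly"
  have "\<exists>v. timg v = x" if "x \<in> C" for x using that C by auto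
  then obtain v where v: "\<And>x. x \<in> C \<Longrightarrow> timg (v x) = x" by metis
  have inner_e: "inner (timg (e j)) x = tapp (v x) j" if "j \<in> B" "x \<in> C" for j x
  proof -
    have "inner (timg (e j)) x = tbil (e j) (v x)" using inner_timg[of "e j" "v x"] v[OF that(2)] by simp
    also have "\<dots> = (\<Sum>i\<in>B. if i = j then tapp (v x) i else 0)"
      unfolding tbil_def e_def by (intro sum.cong refl) simp
    finally show ?thesis using that finB by simp
  qed
  have ej: "timg (e j) = (\<Sum>i\<in>B. cmul (t (i, j)) i)" if "j \<in> B" for j
    unfolding timg_def tapp_def e_def
    by (intro sum.cong refl) (use that finB in \<open>simp add: if_distrib[of "\<lambda>c. _ * c"] cong: if_cong\<close>)
  have "tensor_value B t = (\<Sum>i\<in>B. \<Sum>j\<in>B. cmul (t (i, j)) i * j)"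
    unfolding tensor_value_def sum.cartesian_product
    by (intro sum.cong refl) (simp add: cmul_def mult.assoc split: prod.splits)
  also have "\<dots> = (\<Sum>j\<in>B. timg (e j) * j)"
    by (subst sum.swap) (simp add: ej sum_distrib_right)
  also have "\<dots> = (\<Sum>j\<in>B. \<Sum>x\<in>C. cmul (tapp (v x) j) x * j)"
  proof (intro sum.cong refl)
    fix j assume j: "j \<in> B"
    have "timg (e j) = (\<Sum>x\<in>C. cmul (inner (timg (e j)) x) x)"
      by (rule O.orthonormal_expand[OF assms(1)]) (simp add: assms(2))
    also have "\<dots> = (\<Sum>x\<in>C. cmul (tapp (v x) j) x)" using inner_e[OF j] by simp
    finally show "timg (e j) * j = (\<Sum>x\<in>C. cmul (tapp (v x) j) x * j)" by (simp add: sum_distrib_right)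
  qed
  also have "\<dots> = (\<Sum>x\<in>C. x * (\<Sum>j\<in>B. cmul (tapp (v x) j) j))"
    by (subst sum.swap) (simp add: sum_distrib_left cmul_def mult_ac)
  also have "\<dots> = (\<Sum>x\<in>C. x * x)" using v by (simp add: timg_def)
  finally show ?thesis ..
qed

end

end

text \<open>The form in which the decomposition leaves the context of a particular tensor: a basis
  of normal forms for an irreducible stable subspace.\<close>

definition irreducible_family :: "('n, 'r) mpoly set \<Rightarrow> bool" where
  "irreducible_family D \<longleftrightarrow> finite D \<and> MP.independent D \<and> D \<subseteq> range (nf V) \<and>
     (\<forall>g\<in>S. \<forall>y\<in>MP.span D. T g y \<in> MP.span D) \<and>
     (\<forall>W. MP.subspace W \<longrightarrow> W \<subseteq> MP.span D \<longrightarrow> (\<forall>g\<in>S. \<forall>y\<in>W. T g y \<in> W) \<longrightarrow> W = {0} \<or> W = MP.span D)"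

theorem invariant_sos_irreducible:
  fixes h :: "nat \<Rightarrow> ('n, 'r) mpoly"
  assumes p: "\<And>g. g \<in> S \<Longrightarrow> trans g p - p \<in> V" and h: "(\<Sum>i<n. h i * h i) - p \<in> V"
  obtains C where "finite C" "(\<Sum>x\<in>C. x * x) - p \<in> V"
    "\<And>x. x \<in> C \<Longrightarrow> \<exists>D. irreducible_family D \<and> x \<in> D"
proof -
  define H where "H = (\<lambda>i. nf V (h i)) ` {..<n}"
  obtain B where B: "finite B" "MP.independent B" "B \<subseteq> range (nf V)" "H \<subseteq> MP.span B"
    "\<And>g b. g \<in> S \<Longrightarrow> b \<in> B \<Longrightarrow> T g b \<in> MP.span B"
    using orbit_span[of H] unfolding H_def by auto
  obtain M where M: "\<And>g b. g \<in> S \<Longrightarrow> b \<in> B \<Longrightarrow> T g b = (\<Sum>c\<in>B. cmul (peval g (M c b)) c)"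
    using matrix_coefficients[OF B(1,2,5)] by blast
  note ctxt = B(1-3) M
  have "\<exists>u. nf V (h i) = (\<Sum>b\<in>B. cmul (u b) b)" if "i < n" for i
  proof -
    have "nf V (h i) \<in> MP.span B" using that B(4) by (auto simp: H_def)
    then show ?thesis using MP.span_finite[OF B(1)] by auto
  qed
  then obtain u where u: "\<And>i. i < n \<Longrightarrow> nf V (h i) = (\<Sum>b\<in>B. cmul (u i b) b)" by metis
  \<comment> \<open>The Gram tensor of the given squares: the sum of the tensor squares of the
    coordinate vectors \<open>u i\<close>.\<close>
  define t0 where "t0 = (\<lambda>q. \<Sum>i<n. u i (fst q) * u i (snd q))"
  have "sos_tensor B p t0"
    unfolding sos_tensor_def
  proof (intro conjI ballI allI)
    show "0 \<le> t0 ij - t0 (snd ij, fst ij)" for ij by (simp add: t0_def mult.commute)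
    fix v
    have "tensor_form B t0 v = (\<Sum>i<n. \<Sum>q\<in>B \<times> B. (u i (fst q) * v (fst q)) * (u i (snd q) * v (snd q)))"
      unfolding tensor_form_def t0_def sum_distrib_right by (subst sum.swap) (simp add: mult_ac)
    also have "\<dots> = (\<Sum>i<n. (\<Sum>b\<in>B. u i b * v b) * (\<Sum>b\<in>B. u i b * v b))"
      by (intro sum.cong refl) (rule sum_pairs_product)
    also have "0 \<le> \<dots>" by (intro sum_nonneg) simp
    finally show "0 \<le> tensor_form B t0 v" .
  next
    have "tensor_value B t0 = (\<Sum>i<n. \<Sum>q\<in>B \<times> B. cmul (u i (fst q)) (fst q) * cmul (u i (snd q)) (snd q))"
      unfolding tensor_value_def t0_def MP.scale_sum_left
      by (subst sum.swap) (simp add: cmul_def Const_simps mult_ac)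
    also have "\<dots> = (\<Sum>i<n. (\<Sum>b\<in>B. cmul (u i b) b) * (\<Sum>b\<in>B. cmul (u i b) b))"
      by (intro sum.cong refl) (rule sum_pairs_product)
    also have "\<dots> = (\<Sum>i<n. nf V (h i) * nf V (h i))" by (intro sum.cong refl) (simp add: u)
    finally have "nf V (tensor_value B t0) = (\<Sum>i<n. nf V (h i * h i))"
      by (simp add: nf_sum[OF ideal_V] nf_mult[OF ideal_V])
    also have "\<dots> = nf V (\<Sum>i<n. h i * h i)" by (simp add: nf_sum[OF ideal_V])
    also have "\<dots> = nf V p" using h by (simp add: nf_eq_iff[OF ideal_V])
    finally show "nf V (tensor_value B t0) = nf V p" .
  qed
  from invariant_sos_tensor[OF ctxt this p]
  obtain t where t: "sos_tensor B p t" "\<And>g i. g \<in> S \<Longrightarrow> i \<in> B \<times> B \<Longrightarrow> tact B M g t i = t i"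
    by blast
  define U where "U = range (timg B t)"
  interpret O: orthogonal_action cmul S T U "inner B t" B
    unfolding U_def by (rule orthogonal_action_timg[OF ctxt t])
  have "O.invariant U" unfolding O.invariant_def using O.U O.T_U by auto
  then obtain C where C: "O.orthonormal C" "MP.span C = U"
    "\<And>x. x \<in> C \<Longrightarrow> \<exists>D. O.orthonormal D \<and> x \<in> D \<and> O.irreducible_subspace (MP.span D)"
    by (rule O.orthogonal_decomposition) blast
  have "MP.span B \<subseteq> range (nf V)" by (rule MP.span_minimal[OF B(3) subspace_range_nf[OF ideal_V]])
  then have Unf: "U \<subseteq> range (nf V)" using O.UB0 by blast
  show ?thesis
  proof (rule that)
    show "finite C" using C(1) by (simp add: O.orthonormal_def)
    have "(\<Sum>x\<in>C. x * x) = tensor_value B t"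
      using tensor_orthonormal_squares[OF ctxt t] C(1,2) unfolding U_def by blast
    then show "(\<Sum>x\<in>C. x * x) - p \<in> V" using t(1) by (simp add: sos_tensor_def nf_eq_iff[OF ideal_V])
    fix x assume "x \<in> C"
    then obtain D where D: "O.orthonormal D" "x \<in> D" "O.irreducible_subspace (MP.span D)" using C(3) by blast
    have DU: "finite D" "D \<subseteq> U" using D(1) by (auto simp: O.orthonormal_def)
    have irr: "W = {0} \<or> W = MP.span D"
      if "MP.subspace W" "W \<subseteq> MP.span D" "\<forall>g\<in>S. \<forall>y\<in>W. T g y \<in> W" for W
      using D(3) that O.span_U[OF DU(2)] unfolding O.irreducible_subspace_def O.invariant_def by blast
    have st: "T g y \<in> MP.span D" if "g \<in> S" "y \<in> MP.span D" for g y
      using D(3) that unfolding O.irreducible_subspace_def O.invariant_def by blast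
    have "irreducible_family D"
      unfolding irreducible_family_def
    proof (intro conjI ballI allI impI)
      show "finite D" "D \<subseteq> range (nf V)" using DU Unf by auto
      show "MP.independent D" by (rule O.orthonormal_independent[OF D(1)])
    qed (rule st irr; assumption)+
    then show "\<exists>D. irreducible_family D \<and> x \<in> D" using D(2) by blast
  qed
qed

end

section \<open>The coordinate ring as a module\<close>

lemma cl_eq: "V +>\<^bsub>poly_ring\<^esub> p = {q. q - p \<in> V}" for V :: "('v, 'r::comm_ring_1) mpoly set"
proof -
  have "q - p \<in> V \<Longrightarrow> q \<in> (\<Union>h\<in>V. {h + p})" for q by (rule UN_I[of "q - p"]) auto
  then show ?thesis unfolding a_r_coset_def' by (auto simp: poly_ring_simps)
qed

lemma standard_submoduleD:
  assumes "submodule W (ring_of_type_algebra :: 'r::comm_ring_1 ring) M"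
  shows "W \<subseteq> carrier M" "\<zero>\<^bsub>M\<^esub> \<in> W" "x \<in> W \<Longrightarrow> y \<in> W \<Longrightarrow> x \<oplus>\<^bsub>M\<^esub> y \<in> W" "x \<in> W \<Longrightarrow> c \<odot>\<^bsub>M\<^esub> x \<in> W"
  using assms unfolding submodule_def subgroup_def submodule_axioms_def
  by (auto simp: ring_of_type_algebra_def)

lemma std_module_simps:
  "carrier (std_module d) = {..<d} \<rightarrow>\<^sub>E UNIV"
  "\<zero>\<^bsub>std_module d\<^esub> = (\<lambda>j\<in>{..<d}. 0)"
  "u \<oplus>\<^bsub>std_module d\<^esub> v = (\<lambda>j\<in>{..<d}. u j + v j)"
  "c \<odot>\<^bsub>std_module d\<^esub> u = (\<lambda>j\<in>{..<d}. c * u j)"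
  by (simp_all add: module_power_def scalar_module_def ring_of_type_algebra_def ring.defs module.defs)

lemma scalar_module_simps:
  "carrier scalar_module = UNIV" "x \<oplus>\<^bsub>scalar_module\<^esub> y = x + y" "c \<odot>\<^bsub>scalar_module\<^esub> x = c * x"
  by (simp_all add: scalar_module_def ring_of_type_algebra_def ring.defs module.defs)

lemma module_power_simps:
  "carrier (module_power M k) = {..<k} \<rightarrow>\<^sub>E carrier M"
  "u \<oplus>\<^bsub>module_power M k\<^esub> v = (\<lambda>j\<in>{..<k}. u j \<oplus>\<^bsub>M\<^esub> v j)"
  "c \<odot>\<^bsub>module_power M k\<^esub> u = (\<lambda>j\<in>{..<k}. c \<odot>\<^bsub>M\<^esub> u j)"
  by (simp_all add: module_power_def)

context compact_G_variety
begin

abbreviation cl :: "('n, 'r) mpoly \<Rightarrow> ('n, 'r) mpoly set" where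
  "cl p \<equiv> V +>\<^bsub>poly_ring\<^esub> p"

lemma cl_iff: "cl p = cl q \<longleftrightarrow> p - q \<in> V"
proof
  assume "cl p = cl q"
  moreover have "p \<in> cl p" using mideal_0[OF ideal_V] by (simp add: cl_eq)
  ultimately show "p - q \<in> V" by (simp add: cl_eq)
next
  assume pq: "p - q \<in> V"
  have "x - p \<in> V \<longleftrightarrow> x - q \<in> V" for x
    using mideal_add[OF ideal_V _ pq, of "x - p"] mideal_diff[OF ideal_V _ pq, of "x - q"] by auto
  then show "cl p = cl q" by (simp add: cl_eq)
qed

lemma cl_nf: "cl (nf V p) = cl p"
  unfolding cl_iff by (rule nf_minus_self[OF ideal_V])

lemma cl_inj: "x \<in> range (nf V) \<Longrightarrow> y \<in> range (nf V) \<Longrightarrow> cl x = cl y \<Longrightarrow> x = y"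
  unfolding cl_iff nf_eq_iff[OF ideal_V, symmetric] using nf_nf[OF ideal_V] by auto

lemma poly_ring_ideal: "ideal V poly_ring"
  by (simp add: poly_ring_ideal_iff ideal_V)

lemma coord_ring_simps:
  "carrier (coord_ring V) = range cl"
  "\<zero>\<^bsub>coord_ring V\<^esub> = cl 0" "\<one>\<^bsub>coord_ring V\<^esub> = cl 1"
  "cl p \<oplus>\<^bsub>coord_ring V\<^esub> cl q = cl (p + q)" "cl p \<otimes>\<^bsub>coord_ring V\<^esub> cl q = cl (p * q)"
  "c \<odot>\<^bsub>coord_ring V\<^esub> cl p = cl (cmul c p)"
proof -
  interpret I: ideal V poly_ring by (rule poly_ring_ideal)
  have m: "rcoset_mult poly_ring V (cl p) (cl q) = cl (p * q)" for p q
    using I.rcoset_mult_add[of p q] by (simp add: poly_ring_simps)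
  show "carrier (coord_ring V) = range cl"
    by (auto simp: coord_ring_def ring.defs FactRing_def A_RCOSETS_def' poly_ring_simps(1))
  show "\<zero>\<^bsub>coord_ring V\<^esub> = cl 0" by (simp add: coord_ring_def ring.defs FactRing_def cl_eq)
  show "\<one>\<^bsub>coord_ring V\<^esub> = cl 1" by (simp add: coord_ring_def ring.defs FactRing_def poly_ring_simps)
  show "cl p \<oplus>\<^bsub>coord_ring V\<^esub> cl q = cl (p + q)"
    using I.a_rcos_sum[of p q] by (simp add: coord_ring_def ring.defs FactRing_def poly_ring_simps)
  show "cl p \<otimes>\<^bsub>coord_ring V\<^esub> cl q = cl (p * q)"
    by (simp add: coord_ring_def ring.defs FactRing_def m)
  show "c \<odot>\<^bsub>coord_ring V\<^esub> cl p = cl (cmul c p)"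
    by (simp add: coord_ring_def ring.defs module.defs FactRing_def m cmul_def)
qed

lemma coord_ring_abelian_group: "abelian_group (coord_ring V)"
proof (rule abelian_groupI)
  fix x assume "x \<in> carrier (coord_ring V)"
  then obtain p where p: "x = cl p" by (auto simp: coord_ring_simps)
  have "cl (- p) \<oplus>\<^bsub>coord_ring V\<^esub> cl p = \<zero>\<^bsub>coord_ring V\<^esub>" by (simp add: coord_ring_simps)
  then show "\<exists>y\<in>carrier (coord_ring V). y \<oplus>\<^bsub>coord_ring V\<^esub> x = \<zero>\<^bsub>coord_ring V\<^esub>"
    unfolding p by (intro bexI[of _ "cl (- p)"]) (auto simp: coord_ring_simps(1))
qed (auto simp: coord_ring_simps add_ac)

lemma coord_ring_inv: "inv\<^bsub>add_monoid (coord_ring V)\<^esub> (cl p) = cl (- p)"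
proof -
  interpret A: abelian_group "coord_ring V" by (rule coord_ring_abelian_group)
  have "\<ominus>\<^bsub>coord_ring V\<^esub> (cl p) = cl (- p)"
    by (rule A.minus_equality) (simp_all add: coord_ring_simps)
  then show ?thesis by (simp add: a_inv_def)
qed

lemma coord_ring_square: "cl p [^]\<^bsub>coord_ring V\<^esub> (2::nat) = cl (p * p)"
  by (simp add: nat_pow_def numeral_2_eq_2 coord_ring_simps)

lemma coord_ring_finsum:
  fixes m :: nat
  shows "(\<Oplus>\<^bsub>coord_ring V\<^esub>i\<in>{..<m}. cl (p i)) = cl (\<Sum>i<m. p i)"
proof -
  interpret A: abelian_group "coord_ring V" by (rule coord_ring_abelian_group)
  show ?thesis
    by (induction m) (simp_all add: lessThan_Suc A.finsum_insert Pi_def coord_ring_simps add.commute)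
qed

lemma subspace_submodule:
  assumes "MP.subspace Y"
  shows "submodule (cl ` Y) (ring_of_type_algebra :: 'r ring) (coord_ring V)"
proof (intro submodule.intro subgroup.intro submodule_axioms.intro)
  show "x \<otimes>\<^bsub>add_monoid (coord_ring V)\<^esub> y \<in> cl ` Y" if "x \<in> cl ` Y" "y \<in> cl ` Y" for x y
    using that MP.subspace_add[OF assms] by (auto simp: coord_ring_simps)
  show "inv\<^bsub>add_monoid (coord_ring V)\<^esub> x \<in> cl ` Y" if "x \<in> cl ` Y" for x
    using that MP.subspace_neg[OF assms] by (auto simp: coord_ring_inv)
  show "c \<odot>\<^bsub>coord_ring V\<^esub> x \<in> cl ` Y" if "x \<in> cl ` Y" for c x
    using that MP.subspace_scale[OF assms] by (auto simp: coord_ring_simps)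
qed (use MP.subspace_0[OF assms] in \<open>auto simp: coord_ring_simps\<close>)

lemma submodule_subspace:
  assumes "submodule W (ring_of_type_algebra :: 'r ring) (coord_ring V)"
  shows "MP.subspace {x. cl x \<in> W}"
  using standard_submoduleD[OF assms] by (intro MP.subspaceI) (auto simp flip: coord_ring_simps)

lemma translate_cl:
  assumes "g \<in> S"
  shows "translate V \<alpha> g (cl p) = cl (trans g p)"
proof -
  have "cl (trans g q) = cl (trans g p)" if "q \<in> cl p" for q
    using trans_cong[OF assms] that by (simp add: cl_iff) (simp add: cl_eq)
  moreover have "p \<in> cl p" using mideal_0[OF ideal_V] by (simp add: cl_eq)
  ultimately show ?thesis unfolding translate_def pullback_def trans_def by blast
qed

section \<open>Group laws on rational points\<close>

lemma gm_unit_right: "gm g (gunit G) = g" if "g \<in> S"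
proof -
  have "mcomp (gmult G) (case_sum Var (\<lambda>i. Const (gunit G i))) k - Var k \<in> gideal G" for k
    using lag by (simp add: linear_algebraic_group_def same_morphism_def)
  then have "peval g (mcomp (gmult G) (case_sum Var (\<lambda>i. Const (gunit G i))) k - Var k) = 0" for k
    using that unfolding S_iff by blast
  then show ?thesis
    by (simp add: fun_eq_iff mcomp_def peval_subst peval_case_sum gm_def peval_simps)
qed

lemma gm_unit_left: "gm (gunit G) g = g" if "g \<in> S"
proof -
  have "mcomp (gmult G) (case_sum (\<lambda>i. Const (gunit G i)) Var) k - Var k \<in> gideal G" for k
    using lag by (simp add: linear_algebraic_group_def same_morphism_def)
  then have "peval g (mcomp (gmult G) (case_sum (\<lambda>i. Const (gunit G i)) Var) k - Var k) = 0" for k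
    using that unfolding S_iff by blast
  then show ?thesis
    by (simp add: fun_eq_iff mcomp_def peval_subst peval_case_sum gm_def peval_simps)
qed

lemma gm_assoc:
  assumes "g \<in> S" "h \<in> S" "k \<in> S"
  shows "gm g (gm h k) = gm (gm g h) k"
proof
  fix i
  have hk: "case_sum h k \<in> rational_points (scheme_prod (gideal G) (gideal G))"
    using peval_scheme_prod[OF _ assms(2,3)] by (simp add: rational_points_def)
  have "mcomp (gmult G) (case_sum (\<lambda>i. Var (Inl i)) (mcomp (gmult G) (\<lambda>i. Var (Inr i)))) i
     - mcomp (gmult G) (case_sum (mcomp (gmult G) (case_sum (\<lambda>i. Var (Inl i)) (\<lambda>i. Var (Inr (Inl i)))))
         (\<lambda>i. Var (Inr (Inr i)))) i
     \<in> scheme_prod (gideal G) (scheme_prod (gideal G) (gideal G))"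
    using lag by (simp add: linear_algebraic_group_def same_morphism_def)
  from peval_scheme_prod[OF this assms(1) hk] show "gm g (gm h k) i = gm (gm g h) k i"
    by (simp add: peval_simps mcomp_def peval_subst peval_case_sum gm_def)
qed

lemma inv_unique:
  assumes "g \<in> S" "h \<in> S" "gm g h = gunit G"
  shows "inv_point G g = h"
proof -
  have "inv_point G g = gm (inv_point G g) (gm g h)" using assms gm_unit_right inv_S by simp
  also have "\<dots> = gm (gm (inv_point G g) g) h" by (intro gm_assoc inv_S assms)
  also have "\<dots> = h" using assms gm_inv gm_unit_left by simp
  finally show ?thesis .
qed

lemma inv_inv: "g \<in> S \<Longrightarrow> inv_point G (inv_point G g) = g"
  by (rule inv_unique) (simp_all add: inv_S gm_inv)

lemma inv_unit: "inv_point G (gunit G) = gunit G"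
  by (rule inv_unique) (simp_all add: gunit_S gm_unit_right)

lemma inv_gm:
  assumes "g \<in> S" "h \<in> S"
  shows "inv_point G (gm g h) = gm (inv_point G h) (inv_point G g)"
proof (rule inv_unique)
  let ?g = "inv_point G g" and ?h = "inv_point G h"
  have "gm (gm g h) (gm ?h ?g) = gm g (gm h (gm ?h ?g))" by (intro gm_assoc[symmetric] gm_S inv_S assms)
  also have "gm h (gm ?h ?g) = gm (gm h ?h) ?g" by (intro gm_assoc inv_S assms)
  also have "\<dots> = ?g" using assms by (simp add: gm_inv gm_unit_left inv_S)
  finally show "gm (gm g h) (gm ?h ?g) = gunit G" using assms by (simp add: gm_inv)
qed (intro gm_S inv_S assms)+

lemma coord_act_cl: "g \<in> S \<Longrightarrow> coord_act G V \<alpha> g (cl p) = cl (T (inv_point G g) p)"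
  by (simp add: coord_act_def translate_cl inv_S T_def cl_nf)

text \<open>As a member of an independent set x is nonzero, so by irreducibility it generates the
  whole span of \<open>D\<close>; the module is one copy of the type given by the matrices of the
  action on \<open>D\<close>.\<close>

theorem irreducible_semi_invariant:
  assumes D: "irreducible_family D" and xD: "x \<in> D"
  shows "semi_invariant G V \<alpha> (cl x)"
proof -
  have finD: "finite D" and indD: "MP.independent D" and Dnf: "D \<subseteq> range (nf V)"
    and stable: "\<And>g y. g \<in> S \<Longrightarrow> y \<in> MP.span D \<Longrightarrow> T g y \<in> MP.span D"
    using D by (simp_all add: irreducible_family_def)
  have irred: "W = {0} \<or> W = MP.span D"
    if "MP.subspace W" "W \<subseteq> MP.span D" "\<forall>g\<in>S. \<forall>y\<in>W. T g y \<in> W" for W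
    using D that unfolding irreducible_family_def by blast
  obtain M where M: "\<And>g b. g \<in> S \<Longrightarrow> b \<in> D \<Longrightarrow> T g b = (\<Sum>c\<in>D. cmul (peval g (M c b)) c)"
    using matrix_coefficients[OF finD indD] stable MP.span_base by blast
  note ctxt = finD indD Dnf M
  define d where "d = card D"
  obtain e where e: "bij_betw e {..<d} D" unfolding d_def
    using ex_bij_betw_nat_finite[OF finD] by (auto simp: atLeast0LessThan)
  have eD: "e i \<in> D" if "i < d" for i using e that by (auto simp: bij_betw_def)
  have e_eq: "e i = e j \<longleftrightarrow> i = j" if "i < d" "j < d" for i j
    using e that by (auto simp: bij_betw_def inj_on_def)
  have sumD: "(\<Sum>c\<in>D. f c) = (\<Sum>i<d. f (e i))" for f :: "('n, 'r) mpoly \<Rightarrow> 'z::comm_monoid_add"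
    by (rule sum.reindex_bij_betw[OF e, symmetric])
  \<comment> \<open>Inversion turns the right action \<open>T\<close> into the left action
    \<open>coord_act\<close>, so the matrix products come out in the order required by
    \<open>matrix_representation\<close>.\<close>
  define \<rho> where "\<rho> i j = subst (ginv G) (M (e i) (e j))" for i j
  have \<rho>: "peval g (\<rho> i j) = peval (inv_point G g) (M (e i) (e j))" for g i j
    by (simp add: \<rho>_def peval_subst inv_point_def[abs_def])
  define vec where "vec v = (\<Sum>i<d. cmul (v i) (e i))" for v :: "nat \<Rightarrow> 'r"
  have vecD: "vec v = (\<Sum>c\<in>D. cmul (v (inv_into {..<d} e c)) c)" for v
    unfolding vec_def sumD using e by (intro sum.cong refl) (simp add: bij_betw_inv_into_left)
  have vec_span: "vec v \<in> MP.span D" for v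
    unfolding vec_def by (intro MP.span_sum MP.span_scale MP.span_base eD) simp
  have vec_inj: "v i = w i" if "vec v = vec w" "i < d" for v w i
    using coeffs_eq[OF ctxt, of "\<lambda>c. v (inv_into {..<d} e c)" "\<lambda>c. w (inv_into {..<d} e c)" "e i"] that eD e
    unfolding vecD by (simp add: bij_betw_inv_into_left)
  have vec_ex: "\<exists>v\<in>{..<d} \<rightarrow>\<^sub>E UNIV. y = vec v" if "y \<in> MP.span D" for y
  proof -
    obtain u where "y = (\<Sum>c\<in>D. cmul (u c) c)" using \<open>y \<in> MP.span D\<close> MP.span_finite[OF finD] by auto
    then have "y = vec (\<lambda>i\<in>{..<d}. u (e i))" by (simp add: vec_def sumD)
    then show ?thesis by (intro bexI[of _ "\<lambda>i\<in>{..<d}. u (e i)"]) auto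
  qed
  have vec_add: "vec (\<lambda>i\<in>{..<d}. v i + w i) = vec v + vec w" for v w
    by (simp add: vec_def MP.scale_left_distrib sum.distrib)
  have vec_scale: "vec (\<lambda>i\<in>{..<d}. c * v i) = cmul c (vec v)" for c v
    by (simp add: vec_def MP.scale_sum_right)
  have vec_0: "vec (\<lambda>i\<in>{..<d}. 0) = 0" by (simp add: vec_def)
  have vec_act: "vec (matrix_act d \<rho> g v) = T (inv_point G g) (vec v)" if g: "g \<in> S" for g v
  proof -
    have "T (inv_point G g) (vec v) = (\<Sum>j<d. \<Sum>i<d. cmul (v j * peval g (\<rho> i j)) (e i))"
      unfolding vec_def T_sum T_cmul \<rho>
      by (intro sum.cong refl) (simp add: M[OF inv_S[OF g] eD] sumD MP.scale_sum_right)
    also have "\<dots> = (\<Sum>i<d. \<Sum>j<d. cmul (v j * peval g (\<rho> i j)) (e i))" by (rule sum.swap)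
    also have "\<dots> = vec (matrix_act d \<rho> g v)"
      by (simp add: vec_def matrix_act_def MP.scale_sum_left mult.commute)
    finally show ?thesis ..
  qed
  have x_span: "x \<in> MP.span D" using xD by (rule MP.span_base)
  have x0: "x \<noteq> 0" using xD indD MP.dependent_zero by blast
  have span_nf: "MP.span D \<subseteq> range (nf V)" by (rule MP.span_minimal[OF Dnf subspace_range_nf[OF ideal_V]])
  have cl_span_inj: "y = z" if "y \<in> MP.span D" "z \<in> MP.span D" "cl y = cl z" for y z
    by (rule cl_inj) (use that span_nf in auto)
  have rep: "matrix_representation G d \<rho>"
    unfolding matrix_representation_def
  proof (intro conjI allI impI)
    fix i j assume ij: "i < d" "j < d"
    show "peval (gunit G) (\<rho> i j) = (if i = j then 1 else 0)"
      unfolding \<rho> inv_unit by (simp add: m_unit[OF ctxt eD[OF ij(1)] eD[OF ij(2)]] e_eq[OF ij])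
    \<comment> \<open>The homomorphism law is an identity in the coordinate ring of G \<times> G;
      density reduces it to pairs of rational points.\<close>
    show "subst (gmult G) (\<rho> i j) - (\<Sum>l<d. subst (\<lambda>k. Var (Inl k)) (\<rho> i l) * subst (\<lambda>k. Var (Inr k)) (\<rho> l j))
        \<in> scheme_prod (gideal G) (gideal G)"
    proof (rule zariski_dense_prod[OF dense dense ideal_G])
      fix g h assume gh: "g \<in> S" "h \<in> S"
      have "peval (case_sum g h) (subst (gmult G) (\<rho> i j)) = peval (inv_point G (gm g h)) (M (e i) (e j))"
        by (simp add: peval_subst \<rho> flip: gm_def)
      also have "\<dots> = (\<Sum>a\<in>D. peval (inv_point G g) (M (e i) a) * peval (inv_point G h) (M a (e j)))"
        unfolding inv_gm[OF gh]
          by (rule m_gm[OF ctxt inv_S[OF gh(2)] inv_S[OF gh(1)] eD[OF ij(1)] eD[OF ij(2)]])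
      also have "\<dots> = (\<Sum>l<d. peval g (\<rho> i l) * peval h (\<rho> l j))" by (simp add: sumD \<rho>)
      finally show "peval (case_sum g h) (subst (gmult G) (\<rho> i j)
          - (\<Sum>l<d. subst (\<lambda>k. Var (Inl k)) (\<rho> i l) * subst (\<lambda>k. Var (Inr k)) (\<rho> l j))) = 0"
        by (simp add: peval_simps peval_sum) (simp add: peval_subst peval_simps)
    qed
  qed
  have irr: "irreducible_gmodule S (std_module d) (matrix_act d \<rho>)"
    unfolding irreducible_gmodule_def
  proof (intro conjI allI impI)
    obtain v where v: "v \<in> {..<d} \<rightarrow>\<^sub>E UNIV" "x = vec v" using vec_ex[OF x_span] by blast
    then have "v \<noteq> (\<lambda>j\<in>{..<d}. 0)" using x0 vec_0 by auto
    show "carrier (std_module d) \<noteq> {\<zero>\<^bsub>std_module d\<^esub> :: nat \<Rightarrow> 'r}"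
    proof
      assume "carrier (std_module d) = {\<zero>\<^bsub>std_module d\<^esub> :: nat \<Rightarrow> 'r}"
      then have "v \<in> {\<lambda>j\<in>{..<d}. 0}" using v(1) unfolding std_module_simps by (simp only:)
      then show False using \<open>v \<noteq> _\<close> by (simp only: singleton_iff)
    qed
    fix W assume W: "is_gsubmodule S (std_module d) (matrix_act d \<rho>) W"
    then have sm: "submodule W (ring_of_type_algebra :: 'r ring) (std_module d)"
      and st: "\<And>g w. g \<in> S \<Longrightarrow> w \<in> W \<Longrightarrow> matrix_act d \<rho> g w \<in> W" by (auto simp: is_gsubmodule_def)
    note W' = standard_submoduleD[OF sm, unfolded std_module_simps]
    have "vec ` W = {0} \<or> vec ` W = MP.span D"
    proof (rule irred)
      show "MP.subspace (vec ` W)"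
      proof (rule MP.subspaceI)
        show "0 \<in> vec ` W" using W'(2) vec_0 by (metis imageI)
        show "y + z \<in> vec ` W" if "y \<in> vec ` W" "z \<in> vec ` W" for y z
          using that W'(3) by (auto simp flip: vec_add)
        show "cmul c y \<in> vec ` W" if "y \<in> vec ` W" for c y
          using that W'(4) by (auto simp flip: vec_scale)
      qed
      show "vec ` W \<subseteq> MP.span D" using vec_span by blast
      show "\<forall>g\<in>S. \<forall>y\<in>vec ` W. T g y \<in> vec ` W"
      proof (intro ballI)
        fix g y assume g: "g \<in> S" and "y \<in> vec ` W"
        then obtain w where w: "w \<in> W" "y = vec w" by blast
        have "T g y = vec (matrix_act d \<rho> (inv_point G g) w)"
          unfolding vec_act[OF inv_S[OF g]] inv_inv[OF g] w(2) ..
        then show "T g y \<in> vec ` W" using st[OF inv_S[OF g] w(1)] by blast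
      qed
    qed
    then show "W = {\<zero>\<^bsub>std_module d\<^esub>} \<or> W = carrier (std_module d)"
    proof
      assume *: "vec ` W = {0}"
      have "w = (\<lambda>j\<in>{..<d}. 0)" if "w \<in> W" for w
      proof -
        have "vec w = vec (\<lambda>j\<in>{..<d}. 0)" using * that vec_0 by auto
        then have "w i = (\<lambda>j\<in>{..<d}. 0) i" if "i < d" for i using vec_inj that by blast
        then show ?thesis using W'(1) \<open>w \<in> W\<close> by (intro PiE_ext[of w "{..<d}" "\<lambda>_. UNIV"]) auto
      qed
      then show ?thesis using W'(2) unfolding std_module_simps by blast
    next
      assume *: "vec ` W = MP.span D"
      have "v \<in> W" if v: "v \<in> {..<d} \<rightarrow>\<^sub>E UNIV" for v
      proof -
        have "vec v \<in> vec ` W" unfolding * by (rule vec_span)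
        then obtain w where w: "w \<in> W" "vec v = vec w" by blast
        then have "v = w" using W'(1) v vec_inj by (intro PiE_ext[of v "{..<d}" "\<lambda>_. UNIV"]) auto
        then show ?thesis using w by simp
      qed
      then show ?thesis using W'(1) unfolding std_module_simps by blast
    qed
  qed
  have gen: "generated_gsubmodule S (coord_ring V) (coord_act G V \<alpha>) (cl x) = cl ` MP.span D"
  proof (rule equalityI)
    have "is_gsubmodule S (coord_ring V) (coord_act G V \<alpha>) (cl ` MP.span D)"
      unfolding is_gsubmodule_def
      using subspace_submodule[OF MP.subspace_span] stable inv_S by (auto simp: coord_act_cl)
    then show "generated_gsubmodule S (coord_ring V) (coord_act G V \<alpha>) (cl x) \<subseteq> cl ` MP.span D"
      unfolding generated_gsubmodule_def using x_span by blast
    show "cl ` MP.span D \<subseteq> generated_gsubmodule S (coord_ring V) (coord_act G V \<alpha>) (cl x)"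
      unfolding generated_gsubmodule_def
    proof (rule Inter_greatest)
      fix W assume "W \<in> {W. is_gsubmodule S (coord_ring V) (coord_act G V \<alpha>) W \<and> cl x \<in> W}"
      then have sm: "submodule W (ring_of_type_algebra :: 'r ring) (coord_ring V)"
        and st: "\<And>g w. g \<in> S \<Longrightarrow> w \<in> W \<Longrightarrow> coord_act G V \<alpha> g w \<in> W" and xW: "cl x \<in> W"
        by (auto simp: is_gsubmodule_def)
      \<comment> \<open>The part of the span that maps into W is stable and contains x \<noteq> 0,
        so irreducibility makes it the whole span.\<close>
      let ?X = "{y. cl y \<in> W} \<inter> MP.span D"
      have "?X = {0} \<or> ?X = MP.span D"
      proof (rule irred)
        show "MP.subspace ?X" by (intro MP.subspace_inter submodule_subspace sm MP.subspace_span)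
        show "\<forall>g\<in>S. \<forall>y\<in>?X. T g y \<in> ?X"
        proof (intro ballI)
          fix g y assume g: "g \<in> S" and y: "y \<in> ?X"
          have "coord_act G V \<alpha> (inv_point G g) (cl y) = cl (T g y)"
            using coord_act_cl[OF inv_S[OF g]] inv_inv[OF g] by simp
          then show "T g y \<in> ?X" using st[OF inv_S[OF g], of "cl y"] y stable[OF g] by simp
        qed
      qed simp
      then have "?X = MP.span D" using xW x_span x0 by blast
      then show "cl ` MP.span D \<subseteq> W" by blast
    qed
  qed
  \<comment> \<open>The coordinate vector of a class from the span; it is unique because
    \<open>cl\<close> is injective on normal forms, \<open>D\<close> is independent and the vectors
    are extensional.\<close>
  define coef where "coef w = (THE v. v \<in> {..<d} \<rightarrow>\<^sub>E UNIV \<and> cl (vec v) = w)" for w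
  have coef: "coef (cl (vec v)) = v" if "v \<in> {..<d} \<rightarrow>\<^sub>E UNIV" for v
    unfolding coef_def
  proof (rule the_equality)
    fix w assume w: "w \<in> {..<d} \<rightarrow>\<^sub>E UNIV \<and> cl (vec w) = cl (vec v)"
    then have "vec w = vec v" using cl_span_inj vec_span by blast
    then show "w = v" using w that vec_inj by (intro PiE_ext[of w "{..<d}" "\<lambda>_. UNIV"]) auto
  qed (use that in simp)
  have cl_span: "cl ` MP.span D = (\<lambda>v. cl (vec v)) ` ({..<d} \<rightarrow>\<^sub>E UNIV)"
    using vec_ex vec_span by (auto simp: image_iff)
  let ?N = "coord_ring V\<lparr>carrier := cl ` MP.span D\<rparr>"
  \<comment> \<open>The number of copies is 1, so a coordinate vector is wrapped as a function on
    \<open>{..<1}\<close>.\<close>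
  have "isomorphic_gmodules S ?N (coord_act G V \<alpha>) (module_power (std_module d) 1)
      (act_power 1 (matrix_act d \<rho>))"
    unfolding isomorphic_gmodules_def
  proof (intro exI[of _ "\<lambda>w. \<lambda>j\<in>{..<1::nat}. coef w"] conjI ballI allI)
    show "bij_betw (\<lambda>w. \<lambda>j\<in>{..<1::nat}. coef w) (carrier ?N) (carrier (module_power (std_module d) 1))"
      unfolding bij_betw_def
    proof
      show "inj_on (\<lambda>w. \<lambda>j\<in>{..<1::nat}. coef w) (carrier ?N)"
      proof (rule inj_onI)
        fix w w' assume ww: "w \<in> carrier ?N" "w' \<in> carrier ?N"
          "(\<lambda>j\<in>{..<1::nat}. coef w) = (\<lambda>j\<in>{..<1::nat}. coef w')"
        obtain v v' where v: "v \<in> {..<d} \<rightarrow>\<^sub>E UNIV" "w = cl (vec v)" "v' \<in> {..<d} \<rightarrow>\<^sub>E UNIV" "w' = cl (vec v')"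
          using ww(1,2) unfolding cl_span by auto
        have "coef w = coef w'" using fun_cong[OF ww(3), of 0] by simp
        then show "w = w'" using v coef by simp
      qed
      show "(\<lambda>w. \<lambda>j\<in>{..<1::nat}. coef w) ` carrier ?N = carrier (module_power (std_module d) 1)"
      proof (intro equalityI subsetI)
        fix F :: "nat \<Rightarrow> nat \<Rightarrow> 'r" assume F: "F \<in> carrier (module_power (std_module d) 1)"
        then have F0: "F 0 \<in> {..<d} \<rightarrow>\<^sub>E UNIV" unfolding module_power_simps(1) std_module_simps(1) by auto
        have "F = (\<lambda>j\<in>{..<1::nat}. coef (cl (vec (F 0))))"
          using F coef[OF F0] unfolding module_power_simps(1)
          by (intro PiE_ext[of F "{..<1}" "\<lambda>_. carrier (std_module d)"]) (auto simp: std_module_simps F0)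
        then show "F \<in> (\<lambda>w. \<lambda>j\<in>{..<1::nat}. coef w) ` carrier ?N"
          using vec_span[of "F 0"] by simp
      next
        fix F assume "F \<in> (\<lambda>w. \<lambda>j\<in>{..<1::nat}. coef w) ` carrier ?N"
        then obtain v where v: "v \<in> {..<d} \<rightarrow>\<^sub>E UNIV" "F = (\<lambda>j\<in>{..<1::nat}. coef (cl (vec v)))"
          unfolding cl_span by auto
        show "F \<in> carrier (module_power (std_module d) 1)"
          unfolding v(2) coef[OF v(1)] module_power_simps(1) scalar_module_simps(1) restrict_PiE_iff
          by (intro ballI v(1))
      qed
    qed
  next
    fix w w' assume "w \<in> carrier ?N" "w' \<in> carrier ?N"
    then obtain v v' where v: "v \<in> {..<d} \<rightarrow>\<^sub>E UNIV" "w = cl (vec v)" "v' \<in> {..<d} \<rightarrow>\<^sub>E UNIV" "w' = cl (vec v')"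
      unfolding cl_span by auto
    have "w \<oplus>\<^bsub>?N\<^esub> w' = cl (vec (\<lambda>i\<in>{..<d}. v i + v' i))" by (simp add: v coord_ring_simps vec_add)
    then show "(\<lambda>j\<in>{..<1::nat}. coef (w \<oplus>\<^bsub>?N\<^esub> w'))
        = (\<lambda>j\<in>{..<1::nat}. coef w) \<oplus>\<^bsub>module_power (std_module d) 1\<^esub> (\<lambda>j\<in>{..<1::nat}. coef w')"
      using v by (intro ext) (simp add: coef module_power_simps(2) scalar_module_simps cong: if_cong)
  next
    fix c w assume "w \<in> carrier ?N"
    then obtain v where v: "v \<in> {..<d} \<rightarrow>\<^sub>E UNIV" "w = cl (vec v)" unfolding cl_span by auto
    have "c \<odot>\<^bsub>?N\<^esub> w = cl (vec (\<lambda>i\<in>{..<d}. c * v i))" by (simp add: v coord_ring_simps vec_scale)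
    then show "(\<lambda>j\<in>{..<1::nat}. coef (c \<odot>\<^bsub>?N\<^esub> w)) = c \<odot>\<^bsub>module_power (std_module d) 1\<^esub> (\<lambda>j\<in>{..<1::nat}. coef w)"
      using v by (intro ext) (simp add: coef module_power_simps(3) scalar_module_simps cong: if_cong)
  next
    fix g w assume g: "g \<in> S" and "w \<in> carrier ?N"
    then obtain v where v: "v \<in> {..<d} \<rightarrow>\<^sub>E UNIV" "w = cl (vec v)" unfolding cl_span by auto
    have "coord_act G V \<alpha> g w = cl (vec (matrix_act d \<rho> g v))" by (simp add: v coord_act_cl[OF g] vec_act[OF g])
    moreover have "matrix_act d \<rho> g v \<in> {..<d} \<rightarrow>\<^sub>E UNIV" by (simp add: matrix_act_def)
    ultimately show "(\<lambda>j\<in>{..<1::nat}. coef (coord_act G V \<alpha> g w))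
        = act_power 1 (matrix_act d \<rho>) g (\<lambda>j\<in>{..<1::nat}. coef w)"
      using v by (simp add: coef act_power_def cong: restrict_cong)
  qed
  then have "semi_invariant_of_type G V \<alpha> d \<rho> (cl x)"
    unfolding semi_invariant_of_type_def gen by (auto simp: coord_ring_simps)
  then show ?thesis using rep irr unfolding semi_invariant_def irreducible_representation_def by blast
qed

end

theorem theorem2p16:
  fixes G :: "('g::finite, 'r::real_closed_field) group_scheme"
    and V :: "('n::finite, 'r) mpoly set"
    and \<alpha> :: "'n \<Rightarrow> ('g + 'n, 'r) mpoly"
    and f :: "('n, 'r) mpoly set"
  assumes "linear_algebraic_group G"
    and "zariski_dense (group_points G) (gideal G)"
    and "semialg_compact (group_points G)"
    and "affine_G_variety G V \<alpha>"
    and "f \<in> invariant_ring G V \<alpha>"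
    and "\<exists>(m::nat) h. (\<forall>i<m. h i \<in> carrier (coord_ring V)) \<and>
           f = (\<Oplus>\<^bsub>coord_ring V\<^esub>i\<in>{..<m}. h i [^]\<^bsub>coord_ring V\<^esub> (2::nat))"
  shows "\<exists>(m::nat) h. (\<forall>i<m. h i \<in> carrier (coord_ring V) \<and> semi_invariant G V \<alpha> (h i)) \<and>
           f = (\<Oplus>\<^bsub>coord_ring V\<^esub>i\<in>{..<m}. h i [^]\<^bsub>coord_ring V\<^esub> (2::nat))"
proof -
  interpret compact_G_variety G V \<alpha> by unfold_locales (rule assms)+
  interpret A: abelian_group "coord_ring V" by (rule coord_ring_abelian_group)
  have sos: "(\<Oplus>\<^bsub>coord_ring V\<^esub>i\<in>{..<m}. h i [^]\<^bsub>coord_ring V\<^esub> (2::nat)) = cl (\<Sum>i<m. p i * p i)"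
    if "\<And>i. i < m \<Longrightarrow> h i = cl (p i)" for m :: nat and h p
    using that coord_ring_finsum[of "\<lambda>i. p i * p i" m]
    by (subst A.finsum_cong'[of _ _ "\<lambda>i. cl (p i * p i)"]) (auto simp: coord_ring_square coord_ring_simps)
  obtain m h where h: "\<forall>i<m. h i \<in> carrier (coord_ring V)"
    "f = (\<Oplus>\<^bsub>coord_ring V\<^esub>i\<in>{..<m::nat}. h i [^]\<^bsub>coord_ring V\<^esub> (2::nat))"
    using assms(6) by blast
  have "\<forall>i<m. \<exists>q. h i = cl q" using h(1) by (auto simp: coord_ring_simps)
  then obtain q where q: "\<And>i. i < m \<Longrightarrow> h i = cl (q i)" by metis
  \<comment> \<open>A polynomial representative of f; invariance of f becomes the congruence of p
    with its translates modulo \<open>V\<close>.\<close>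
  define p where "p = (\<Sum>i<m. q i * q i)"
  have f: "f = cl p" unfolding h(2) p_def by (rule sos[OF q])
  have inv: "trans g p - p \<in> V" if "g \<in> S" for g
    using assms(5) that unfolding invariant_ring_def f by (auto simp: translate_cl cl_iff)
  have "(\<Sum>i<m. q i * q i) - p \<in> V" using mideal_0[OF ideal_V] by (simp add: p_def)
  from invariant_sos_irreducible[of p q m, OF inv this]
  obtain C where C: "finite C" "(\<Sum>x\<in>C. x * x) - p \<in> V"
    "\<And>x. x \<in> C \<Longrightarrow> \<exists>D. irreducible_family D \<and> x \<in> D"
    by blast
  have semi: "semi_invariant G V \<alpha> (cl x)" if x: "x \<in> C" for x
    using C(3)[OF x] irreducible_semi_invariant by blast
  obtain e where e: "bij_betw e {..<card C} C"
    using ex_bij_betw_nat_finite[OF C(1)] by (auto simp: atLeast0LessThan)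
  have "f = cl (\<Sum>x\<in>C. x * x)" unfolding f cl_iff using mideal_minus[OF ideal_V C(2)] by simp
  also have "(\<Sum>x\<in>C. x * x) = (\<Sum>i<card C. e i * e i)" by (rule sum.reindex_bij_betw[OF e, symmetric])
  finally have "f = (\<Oplus>\<^bsub>coord_ring V\<^esub>i\<in>{..<card C}. cl (e i) [^]\<^bsub>coord_ring V\<^esub> (2::nat))"
    using sos[of "card C" "\<lambda>i. cl (e i)" e] by simp
  moreover have "e i \<in> C" if "i < card C" for i using e that by (auto simp: bij_betw_def)
  ultimately show ?thesis using semi
    by (intro exI[of _ "card C"] exI[of _ "\<lambda>i. cl (e i)"]) (auto simp: coord_ring_simps)
qed

end
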